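(* Let $\mathcal B$ be a linearly ordered set, let $N:\mathcal B\times\mathcal B\to\mathbb Z$ be a symmetric function, and let $\mathfrak F_N(\mathcal B)$ be the free vertex algebra generated by $\mathcal B$ with respect to the locality bound $N$. Then a linear basis of $\mathfrak F_N(\mathcal B)$ is given by the set of all right-normed monomials $$a_{1\,(m_1)}\bigl(a_{2\,(m_2)}\cdots(a_{k\,(m_k)}\mathbf 1)\cdots\bigr),\qquad k\ge 0,\ a_i\in\mathcal B,\ m_i\in\mathbb Z,\ m_k<0,$$ (where $k=0$ gives the monomial $\mathbf 1$) such that for all $1\le i\le k-1$ $$m_i-m_{i+1}\le\begin{cases}\displaystyle\sum_{j=i+1}^kN(a_i,a_j)-\sum_{j=i+2}^kN(a_{i+1},a_j)&\text{if } a_i\le a_{i+1},\\[2mm]\displaystyle\sum_{j=i+1}^kN(a_i,a_j)-\sum_{j=i+2}^kN(a_{i+1},a_j)-1&\text{otherwise.}\end{cases}$$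
   Context: All spaces are over a field $\Bbbk$ of characteristic $0$. A vertex algebra is a superspace $A=A_{\bar0}\oplus A_{\bar1}$ with even bilinear products $(a,b)\mapsto a_{(n)}b$, $n\in\mathbb Z$, and a distinguished even element $\mathbf 1$. Put $Da=a_{(-2)}\mathbf 1$, $D^{(k)}=\frac1{k!}D^k$, $Y(a)(z)=\sum_{n\in\mathbb Z}a_{(n)}z^{-n-1}$, where $a_{(n)}$ is viewed as an operator on $A$. Axioms: (V1) $a_{(n)}b=0$ for $n\gg0$; (V2) $\mathbf 1_{(n)}a=\delta_{n,-1}a$, $a_{(n)}\mathbf 1=0$ for $n\ge0$ and $a_{(n)}\mathbf 1=D^{(-n-1)}a$ for $n<0$; (V3) $(Da)_{(n)}b=-n\,a_{(n-1)}b$ and $a_{(n)}(Db)=n\,a_{(n-1)}b+D(a_{(n)}b)$; (V4) locality: for parity-homogeneous $a,b$ there is $M\in\mathbb Z$ such that $Y(a)(w)Y(b)(z)\,\iota_{w,z}(w-z)^M=(-1)^{p(a)p(b)}Y(b)(z)Y(a)(w)\,\iota_{z,w}(w-z)^M$, where $p$ is the parity and $\iota_{w,z}$ (resp. $\iota_{z,w}$) means expansion in nonnegative powers of $z$ (resp. of $w$). Homomorphisms preserve $\mathbf 1$ and all products. Free vertex algebra: for a set $\mathcal B$ and a symmetric $N:\mathcal B\times\mathcal B\to\mathbb Z$, $\mathfrak F_N(\mathcal B)$ is the vertex algebra generated by $\mathcal B$, where $a\in\mathcal B$ has parity $N(a,a)\bmod 2$ and $a_{(n)}b=0$ for $a,b\in\mathcal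 B$, $n\ge N(a,b)$, which is universal with these properties: for any vertex algebra $A$ and any map $\iota:\mathcal B\to A$ with $\iota(a)$ of parity $N(a,a)\bmod 2$ and $\iota(a)_{(n)}\iota(b)=0$ whenever $n\ge N(a,b)$, there is a unique vertex algebra homomorphism $\mathfrak F_N(\mathcal B)\to A$ extending $\iota$. It exists and is unique up to isomorphism. *)

theory Defs
  imports Complex_Main "HOL-Library.Z2" "HOL-Library.Groups_Big_Fun" "HOL-Library.Function_Algebras"
begin

text \<open>The underlying superspace is a graded subspace of an ambient vector space, which is the type
  \<open>'v\<close> with scalar multiplication \<open>vscale A\<close>; the products matter only on \<open>carrier A\<close>.
  Parities live in the two-element field \<open>bit\<close>, and \<open>vprod A n a b\<close> stands for \<open>a\<^sub>(\<^sub>n\<^sub>) b\<close>.\<close>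

record ('k, 'v) vertex_struct =
  vscale :: "'k \<Rightarrow> 'v \<Rightarrow> 'v"
  vpart :: "bit \<Rightarrow> 'v set"
  vac :: 'v
  vprod :: "int \<Rightarrow> 'v \<Rightarrow> 'v \<Rightarrow> 'v"

definition carrier :: "('k, 'v::ab_group_add) vertex_struct \<Rightarrow> 'v set" where
  "carrier A = {x + y | x y. x \<in> vpart A 0 \<and> y \<in> vpart A 1}"

definition D :: "('k, 'v) vertex_struct \<Rightarrow> 'v \<Rightarrow> 'v" where
  "D A a = vprod A (-2) a (vac A)"

definition divided_D :: "nat \<Rightarrow> ('k::field_char_0, 'v) vertex_struct \<Rightarrow> 'v \<Rightarrow> 'v" where
  "divided_D k A a = vscale A (1 / fact k) ((D A ^^ k) a)"

definition koszul_sign :: "bit \<Rightarrow> bit \<Rightarrow> 'k::field_char_0" where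
  "koszul_sign p q = (if p = 1 \<and> q = 1 then -1 else 1)"

text \<open>The coefficients at \<open>w\<^bsup>-m-1\<^esup> z\<^bsup>-n-1\<^esup>\<close> of
  \<open>Y(a)(w) Y(b)(z) \<iota>\<^bsub>w,z\<^esub>(w-z)\<^bsup>M\<^esup>\<close> and of \<open>Y(b)(z) Y(a)(w) \<iota>\<^bsub>z,w\<^esub>(w-z)\<^bsup>M\<^esup>\<close>, applied to \<open>c\<close>. Here
  \<open>\<iota>\<^bsub>w,z\<^esub>(w-z)\<^bsup>M\<^esup>\<close> is the sum of \<open>(M choose s) w\<^bsup>M-s\<^esup> (-z)\<^bsup>s\<^esup>\<close> and
  \<open>\<iota>\<^bsub>z,w\<^esub>(w-z)\<^bsup>M\<^esup>\<close> the sum of \<open>(M choose s) w\<^bsup>s\<^esup> (-z)\<^bsup>M-s\<^esup>\<close>, over all \<open>s \<ge> 0\<close>.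
  The sums have finite support because \<open>b\<^sub>(\<^sub>n\<^sub>) c\<close> and \<open>a\<^sub>(\<^sub>m\<^sub>) c\<close> vanish for large indices.\<close>

definition locality_coeff_wz ::
    "('k::field_char_0, 'v::ab_group_add) vertex_struct \<Rightarrow> int \<Rightarrow> 'v \<Rightarrow> 'v \<Rightarrow> int \<Rightarrow> int \<Rightarrow> 'v \<Rightarrow> 'v" where
  "locality_coeff_wz A M a b m n c =
     Sum_any (\<lambda>s::nat. vscale A ((of_int M gchoose s) * (-1) ^ s)
       (vprod A (m + M - int s) a (vprod A (n + int s) b c)))"

definition locality_coeff_zw ::
    "('k::field_char_0, 'v::ab_group_add) vertex_struct \<Rightarrow> int \<Rightarrow> 'v \<Rightarrow> 'v \<Rightarrow> int \<Rightarrow> int \<Rightarrow> 'v \<Rightarrow> 'v" where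
  "locality_coeff_zw A M a b m n c =
     Sum_any (\<lambda>s::nat. vscale A ((of_int M gchoose s) * (-1) powi (M - int s))
       (vprod A (n + M - int s) b (vprod A (m + int s) a c)))"

locale vertex_algebra = vector_space "vscale A"
  for A :: "('k::field_char_0, 'v::ab_group_add) vertex_struct" +
  assumes subspace_part: "subspace (vpart A p)"
    and parts_disjoint: "vpart A 0 \<inter> vpart A 1 = {0}"
    and vac_even: "vac A \<in> vpart A 0"
    and prod_parity: "\<lbrakk>a \<in> vpart A p; b \<in> vpart A q\<rbrakk> \<Longrightarrow> vprod A n a b \<in> vpart A (p + q)"
    and prod_add_left: "\<lbrakk>a \<in> carrier A; b \<in> carrier A; c \<in> carrier A\<rbrakk> \<Longrightarrow>
      vprod A n (a + b) c = vprod A n a c + vprod A n b c"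
    and prod_add_right: "\<lbrakk>a \<in> carrier A; b \<in> carrier A; c \<in> carrier A\<rbrakk> \<Longrightarrow>
      vprod A n a (b + c) = vprod A n a b + vprod A n a c"
    and prod_scale_left: "\<lbrakk>a \<in> carrier A; b \<in> carrier A\<rbrakk> \<Longrightarrow>
      vprod A n (vscale A r a) b = vscale A r (vprod A n a b)"
    and prod_scale_right: "\<lbrakk>a \<in> carrier A; b \<in> carrier A\<rbrakk> \<Longrightarrow>
      vprod A n a (vscale A r b) = vscale A r (vprod A n a b)"
    and truncation: "\<lbrakk>a \<in> carrier A; b \<in> carrier A\<rbrakk> \<Longrightarrow> \<exists>n0. \<forall>n\<ge>n0. vprod A n a b = 0"
    and vac_left: "a \<in> carrier A \<Longrightarrow> vprod A n (vac A) a = (if n = -1 then a else 0)"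
    and vac_right_nonneg: "\<lbrakk>a \<in> carrier A; n \<ge> 0\<rbrakk> \<Longrightarrow> vprod A n a (vac A) = 0"
    and vac_right_neg: "\<lbrakk>a \<in> carrier A; n < 0\<rbrakk> \<Longrightarrow> vprod A n a (vac A) = divided_D (nat (-n-1)) A a"
    and D_left: "\<lbrakk>a \<in> carrier A; b \<in> carrier A\<rbrakk> \<Longrightarrow>
      vprod A n (D A a) b = vscale A (- of_int n) (vprod A (n - 1) a b)"
    and D_right: "\<lbrakk>a \<in> carrier A; b \<in> carrier A\<rbrakk> \<Longrightarrow>
      vprod A n a (D A b) = vscale A (of_int n) (vprod A (n - 1) a b) + D A (vprod A n a b)"
    and locality: "\<lbrakk>a \<in> vpart A p; b \<in> vpart A q\<rbrakk> \<Longrightarrow>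
      \<exists>M. \<forall>m n. \<forall>c\<in>carrier A.
        locality_coeff_wz A M a b m n c = vscale A (koszul_sign p q) (locality_coeff_zw A M a b m n c)"

definition vertex_hom ::
    "('k::field_char_0, 'v::ab_group_add) vertex_struct \<Rightarrow> ('k, 'u::ab_group_add) vertex_struct \<Rightarrow>
     ('v \<Rightarrow> 'u) \<Rightarrow> bool" where
  "vertex_hom A A' f \<longleftrightarrow>
     (\<forall>x\<in>carrier A. f x \<in> carrier A') \<and>
     (\<forall>x\<in>carrier A. \<forall>y\<in>carrier A. f (x + y) = f x + f y) \<and>
     (\<forall>r. \<forall>x\<in>carrier A. f (vscale A r x) = vscale A' r (f x)) \<and>
     f (vac A) = vac A' \<and>
     (\<forall>n. \<forall>x\<in>carrier A. \<forall>y\<in>carrier A. f (vprod A n x y) = vprod A' n (f x) (f y))"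

definition vertex_subalgebra ::
    "('k::field_char_0, 'v::ab_group_add) vertex_struct \<Rightarrow> 'v set \<Rightarrow> bool" where
  "vertex_subalgebra A S \<longleftrightarrow>
     S \<subseteq> carrier A \<and> module.subspace (vscale A) S \<and> vac A \<in> S \<and>
     (\<forall>n. \<forall>x\<in>S. \<forall>y\<in>S. vprod A n x y \<in> S)"

definition generated_by ::
    "('k::field_char_0, 'v::ab_group_add) vertex_struct \<Rightarrow> 'v set \<Rightarrow> bool" where
  "generated_by A X \<longleftrightarrow> (\<forall>S. vertex_subalgebra A S \<and> X \<subseteq> S \<longrightarrow> S = carrier A)"

definition respects_bound ::
    "'b set \<Rightarrow> ('b \<Rightarrow> 'b \<Rightarrow> int) \<Rightarrow> ('k, 'v::zero) vertex_struct \<Rightarrow> ('b \<Rightarrow> 'v) \<Rightarrow> bool" where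
  "respects_bound B N A \<iota> \<longleftrightarrow>
     (\<forall>a\<in>B. \<iota> a \<in> vpart A (of_int (N a a))) \<and>
     (\<forall>a\<in>B. \<forall>b\<in>B. \<forall>n\<ge>N a b. vprod A n (\<iota> a) (\<iota> b) = 0)"

text \<open>\<open>F\<close>, with generators \<open>\<iota> a\<close> for \<open>a \<in> B\<close>, is free. HOL cannot quantify over all types inside a
  formula, so the target \<open>A\<close> of the universal property ranges over all vertex algebras that are
  subspaces of the space of functions \<open>('b \<times> int) list \<Rightarrow> 'k\<close>, under any scalar multiplication.
  This loses nothing: whatever the type of the target, the subalgebra generated by the image of
  \<open>B\<close> has dimension at most \<open>max |B| \<aleph>\<^sub>0\<close>, so it is isomorphic to such an \<open>A\<close>.\<close>

definition free_vertex_algebra ::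
    "'b set \<Rightarrow> ('b \<Rightarrow> 'b \<Rightarrow> int) \<Rightarrow> ('k::field_char_0, 'v::ab_group_add) vertex_struct \<Rightarrow> ('b \<Rightarrow> 'v) \<Rightarrow> bool" where
  "free_vertex_algebra B N F \<iota> \<longleftrightarrow>
     vertex_algebra F \<and> respects_bound B N F \<iota> \<and> generated_by F (\<iota> ` B) \<and>
     (\<forall>(A :: ('k, ('b \<times> int) list \<Rightarrow> 'k) vertex_struct) \<kappa>.
        vertex_algebra A \<and> respects_bound B N A \<kappa> \<longrightarrow>
        (\<exists>f. vertex_hom F A f \<and> (\<forall>a\<in>B. f (\<iota> a) = \<kappa> a) \<and>
          (\<forall>g. vertex_hom F A g \<and> (\<forall>a\<in>B. g (\<iota> a) = \<kappa> a) \<longrightarrow> (\<forall>x\<in>carrier F. g x = f x))))"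

text \<open>The list \<open>[(a\<^sub>1, m\<^sub>1), \<dots>, (a\<^sub>k, m\<^sub>k)]\<close> encodes the right-normed monomial
  \<open>a\<^sub>1 \<^sub>(\<^sub>m\<^sub>1\<^sub>) (\<dots> (a\<^sub>k \<^sub>(\<^sub>m\<^sub>k\<^sub>) 1) \<dots>)\<close>; list positions count from \<open>0\<close>.\<close>

definition monomial :: "('k, 'v) vertex_struct \<Rightarrow> ('b \<Rightarrow> 'v) \<Rightarrow> ('b \<times> int) list \<Rightarrow> 'v" where
  "monomial A \<iota> w = foldr (\<lambda>(a, m) x. vprod A m (\<iota> a) x) w (vac A)"

definition basis_words :: "'b::linorder set \<Rightarrow> ('b \<Rightarrow> 'b \<Rightarrow> int) \<Rightarrow> ('b \<times> int) list set" where
  "basis_words B N =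
     {w. let k = length w; a = (\<lambda>i. fst (w ! i)); m = (\<lambda>i. snd (w ! i)) in
        (\<forall>i<k. a i \<in> B) \<and> (k > 0 \<longrightarrow> m (k - 1) < 0) \<and>
        (\<forall>i. i + 1 < k \<longrightarrow>
           m i - m (i + 1) \<le>
             (if a i \<le> a (i + 1)
              then (\<Sum>j\<in>{i+1..<k}. N (a i) (a j)) - (\<Sum>j\<in>{i+2..<k}. N (a (i + 1)) (a j))
              else (\<Sum>j\<in>{i+1..<k}. N (a i) (a j)) - (\<Sum>j\<in>{i+2..<k}. N (a (i + 1)) (a j)) - 1))}"

end

theory Submission
  imports Defs "HOL-Library.Multiset" "HOL-Library.Poly_Mapping"
begin

text \<open>To a word \<open>(a\<^sub>1, m\<^sub>1) \<dots> (a\<^sub>k, m\<^sub>k)\<close> attach the exponents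
  \<open>n\<^sub>i = - m\<^sub>i - 1 + \<Sum>\<^bsub>j>i\<^esub> N(a\<^sub>i, a\<^sub>j)\<close>.  In these coordinates the inequalities of the theorem say that the
  pairs \<open>(n\<^sub>i, a\<^sub>i)\<close> are sorted, by decreasing exponents and increasing letters, and \<open>m\<^sub>k < 0\<close> says that
  the exponents are nonnegative (lemma \<open>basis_words_iff\<close>).  So the words of the basis correspond to the
  multisets of pairs \<open>(a, n)\<close> with \<open>n \<ge> 0\<close>, that is, to the monomials in variables \<open>x\<^sub>a\<^sub>,\<^sub>n\<close>.

  Spanning holds in every vertex algebra generated by elements that satisfy the bound.  Dong's lemma
  and Goddard's uniqueness argument give the formula expressing \<open>(a\<^sub>(\<^sub>k\<^sub>)b)\<^sub>(\<^sub>m\<^sub>)c\<close> by the products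
  \<open>a\<^sub>(\<^sub>i\<^sub>)(b\<^sub>(\<^sub>j\<^sub>)c)\<close> and \<open>b\<^sub>(\<^sub>j\<^sub>)(a\<^sub>(\<^sub>i\<^sub>)c)\<close> (\<open>associativity\<close>).  It shows that right-normed
  monomials span, and that \<open>a, b\<close> are local of order exactly \<open>N(a, b)\<close> (\<open>bound_imp_local\<close>).  Locality of
  this order rewrites a word with two wrongly ordered neighbours into words of the same total exponent
  and the same letters whose first exponent is larger, or equal with a smaller first letter; the total
  bounds the first exponent, so the rewriting ends (\<open>straighten_step\<close>).

  Independence needs a vertex algebra in which the words are visibly independent.  On the polynomial
  ring in the variables \<open>x\<^sub>a\<^sub>,\<^sub>n\<close> put \<open>a(z) = \<Sum>\<^sub>n x\<^sub>a\<^sub>,\<^sub>n z\<^sup>n\<close> and let \<open>\<Gamma>\<^sub>a(z)\<close> be the ring homomorphism that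
  multiplies \<open>b(w)\<close> by \<open>\<plusminus>(z - w)\<^bsup>-N(a,b)\<^esup>\<close>.  The fields \<open>a(z) \<Gamma>\<^sub>a(z)\<close>, which describe the
  subalgebra generated by the \<open>e\<^sup>a\<close> in a lattice vertex algebra, are mutually local of order \<open>N(a, b)\<close> (\<open>gen_R\<close>), hence
  generate a vertex algebra of fields (\<open>vertex_algebra_field_struct\<close>).  The universal property maps the
  free algebra to it, and applying the field of a word to the polynomial \<open>1\<close> gives a coefficient of
  \<open>\<plusminus>\<Prod>\<^bsub>i<j\<^esub> (z\<^sub>i - z\<^sub>j)\<^bsup>-N(a\<^sub>i,a\<^sub>j)\<^esup> a\<^sub>1(z\<^sub>1) \<dots> a\<^sub>k(z\<^sub>k)\<close>.  It contains the monomial of the pairs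
  \<open>(a\<^sub>i, n\<^sub>i)\<close>, and its other exponents arise from \<open>(n\<^sub>i)\<close> by moving units to the left; as \<open>(n\<^sub>i)\<close> decreases,
  this increases the sum of squares.  So the words are triangular with respect to the monomials
  (\<open>word_vec_lookup\<close>), and independent.

  Formal distributions are represented by their coefficients, and the expansions of \<open>(x - y)\<^sup>k\<close> for all
  integers \<open>k\<close> are handled through their recursion in \<open>k\<close> (\<open>expand_unique\<close>).\<close>

section \<open>Binomial expansions of two-variable distributions\<close>

text \<open>Fields act on the subspace \<open>U\<close> of the ambient space, because the products of a vertex algebra
  are meaningful on its carrier only.\<close>

locale field_space = vector_space scale
  for scale :: "'k::field_char_0 \<Rightarrow> 'v::ab_group_add \<Rightarrow> 'v" +
  fixes U :: "'v set"
  assumes subspace_U: "subspace U"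
begin

text \<open>A function \<open>g\<close> of two indices stands for the distribution \<open>\<Sum> g i j x\<^bsup>-i-1\<^esup> y\<^bsup>-j-1\<^esup>\<close>, and
  \<open>expand e g k\<close> for its product with the expansion of \<open>(x + e y)\<^sup>k\<close> in nonnegative powers of \<open>y\<close>.  This
  makes sense if \<open>g i j\<close> vanishes for all large \<open>j\<close>, uniformly in \<open>i\<close>.\<close>

definition expand :: "'k \<Rightarrow> (int \<Rightarrow> int \<Rightarrow> 'v) \<Rightarrow> int \<Rightarrow> int \<Rightarrow> int \<Rightarrow> 'v" where
  "expand e g k p m =
     Sum_any (\<lambda>s::nat. scale (e ^ s * (of_int k gchoose s)) (g (p + k - int s) (m + int s)))"

lemma expand_eq_sum:
  assumes "\<And>i j. j \<ge> m + int n \<Longrightarrow> g i j = 0"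
  shows "expand e g k p m =
    (\<Sum>s<n. scale (e ^ s * (of_int k gchoose s)) (g (p + k - int s) (m + int s)))"
  unfolding expand_def
proof (rule Sum_any.expand_superset)
  show "{a. scale (e ^ a * (of_int k gchoose a)) (g (p + k - int a) (m + int a)) \<noteq> 0} \<subseteq> {..<n}"
  proof
    fix a assume "a \<in> {a. scale (e ^ a * (of_int k gchoose a)) (g (p + k - int a) (m + int a)) \<noteq> 0}"
    then have "g (p + k - int a) (m + int a) \<noteq> 0" by auto
    then have "\<not> m + int a \<ge> m + int n" using assms by blast
    then show "a \<in> {..<n}" by simp
  qed
qed simp

lemma expand_eq_sum_ge:
  assumes "\<forall>i. \<forall>j\<ge>j0. g i j = 0" "n \<ge> nat (j0 - m)"
  shows "expand e g k p m =
    (\<Sum>s<n. scale (e ^ s * (of_int k gchoose s)) (g (p + k - int s) (m + int s)))"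
  by (rule expand_eq_sum) (use assms in auto)

lemma expand_trunc:
  assumes "\<forall>i. \<forall>j\<ge>j0. g i j = 0" "m \<ge> j0"
  shows "expand e g k p m = 0"
  using expand_eq_sum[of m 0 g e k p] assms by auto

lemma expand_0 [simp]: "expand e g 0 p m = g p m"
proof -
  have "expand e g 0 p m = (\<Sum>s\<in>{0}. scale (e ^ s * (of_int 0 gchoose s)) (g (p + 0 - int s) (m + int s)))"
    unfolding expand_def by (rule Sum_any.expand_superset) (auto simp: gbinomial_0_left split: if_splits)
  then show ?thesis by simp
qed

lemma expand_Suc:
  assumes "\<exists>j0. \<forall>i. \<forall>j\<ge>j0. g i j = 0"
  shows "expand e g (k + 1) p m = expand e g k (p + 1) m + scale e (expand e g k p (m + 1))"
proof -
  obtain j0 where j0: "\<forall>i. \<forall>j\<ge>j0. g i j = 0" using assms by blast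
  define n where "n = nat (j0 - m)"
  let ?c = "\<lambda>s. of_int k gchoose s :: 'k"
  have pascal: "((of_int (k + 1) :: 'k) gchoose Suc s) = ?c s + ?c (Suc s)" for s
    using gbinomial_Suc_Suc[of "of_int k :: 'k" s] by (simp add: add.commute)
  have shift1: "p + k + 1 - int (Suc s) = p + k - int s" and shift2: "m + int (Suc s) = m + 1 + int s"
    and shift3: "p + (k + 1) = p + k + 1" for s
    by simp_all
  have "expand e g (k + 1) p m =
      (\<Sum>s<Suc n. scale (e ^ s * (of_int (k + 1) gchoose s)) (g (p + (k + 1) - int s) (m + int s)))"
    by (rule expand_eq_sum_ge[OF j0]) (simp add: n_def)
  also have "\<dots> = g (p + (k + 1)) m +
      (\<Sum>s<n. scale (e ^ Suc s * (of_int (k + 1) gchoose Suc s)) (g (p + (k + 1) - int (Suc s)) (m + int (Suc s))))"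
    by (simp only: sum.lessThan_Suc_shift) simp
  also have "\<dots> = g (p + k + 1) m +
      (\<Sum>s<n. scale (e ^ Suc s * (?c s + ?c (Suc s))) (g (p + k - int s) (m + 1 + int s)))"
    by (simp only: pascal shift1 shift2 shift3)
  finally have L: "expand e g (k + 1) p m = g (p + k + 1) m +
      (\<Sum>s<n. scale (e ^ Suc s * (?c s + ?c (Suc s))) (g (p + k - int s) (m + 1 + int s)))" .
  have R1: "expand e g k (p + 1) m = g (p + k + 1) m +
      (\<Sum>s<n. scale (e ^ Suc s * ?c (Suc s)) (g (p + k - int s) (m + 1 + int s)))"
    by (subst expand_eq_sum_ge[of j0 g _ "Suc n"])
       (simp_all add: j0 n_def sum.lessThan_Suc_shift algebra_simps del: sum.lessThan_Suc)
  have R2: "scale e (expand e g k p (m + 1)) =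
      (\<Sum>s<n. scale (e ^ Suc s * ?c s) (g (p + k - int s) (m + 1 + int s)))"
    by (subst expand_eq_sum_ge[of j0 g _ n])
       (simp_all add: j0 n_def scale_sum_right algebra_simps)
  show ?thesis unfolding L R1 R2
    by (simp add: sum.distrib ring_distribs scale_left_distrib)
qed

text \<open>Multiplication by \<open>x + e y\<close> is injective on distributions truncated in \<open>y\<close>; so a family of them
  indexed by the exponent of \<open>x + e y\<close> is determined by its member of exponent \<open>0\<close>.  This principle
  replaces the manipulation of binomial sums: to identify two expansions, compare their recursions.\<close>

lemma expand_unique:
  fixes H :: "int \<Rightarrow> int \<Rightarrow> int \<Rightarrow> 'v"
  assumes rec: "\<And>k p m. H (k + 1) p m = H k (p + 1) m + scale e (H k p (m + 1))"
    and base: "\<And>p m. H 0 p m = 0"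
    and trunc: "\<And>k. \<exists>m0. \<forall>p. \<forall>m\<ge>m0. H k p m = 0"
  shows "H k p m = 0"
proof -
  have nonneg: "H (int n) p m = 0" for n p m
  proof (induction n arbitrary: p m)
    case (Suc n)
    then show ?case using rec[of "int n" p m] by (simp add: add.commute)
  qed (simp add: base)
  have neg: "H (- int n) p m = 0" for n p m
  proof (induction n arbitrary: p m)
    case (Suc n)
    obtain m0 where m0: "\<And>p m. m \<ge> m0 \<Longrightarrow> H (- int (Suc n)) p m = 0" using trunc by blast
    have step: "H (- int (Suc n)) (p + 1) m = - scale e (H (- int (Suc n)) p (m + 1))" for p m
      using rec[of "- int (Suc n)" p m] Suc by (simp add: eq_neg_iff_add_eq_0)
    have "H (- int (Suc n)) p (m0 - int j) = 0" for p j
    proof (induction j arbitrary: p)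
      case (Suc j)
      show ?case using step[of "p - 1" "m0 - int (Suc j)"] Suc by simp
    qed (use m0 in auto)
    from this[of p "nat (m0 - m)"] m0[of m p] show ?case by (cases "m \<ge> m0") auto
  qed (simp add: base)
  show ?thesis using nonneg[of "nat k" p m] neg[of "nat (- k)" p m] by (cases "k \<ge> 0") auto
qed

lemma expand_in_U:
  assumes "\<And>i j. g i j \<in> U" "\<exists>j0. \<forall>i. \<forall>j\<ge>j0. g i j = 0"
  shows "expand e g k p m \<in> U"
proof -
  obtain j0 where j0: "\<forall>i. \<forall>j\<ge>j0. g i j = 0" using assms by blast
  show ?thesis
    by (subst expand_eq_sum_ge[OF j0 order_refl])
       (auto intro!: subspace_sum[OF subspace_U] subspace_scale[OF subspace_U] assms)
qed

definition lin :: "('v \<Rightarrow> 'v) \<Rightarrow> bool" where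
  "lin f \<longleftrightarrow> (\<forall>v\<in>U. f v \<in> U) \<and> (\<forall>u\<in>U. \<forall>v\<in>U. f (u + v) = f u + f v) \<and>
     (\<forall>c. \<forall>v\<in>U. f (scale c v) = scale c (f v))"

lemma linD:
  assumes "lin f"
  shows "v \<in> U \<Longrightarrow> f v \<in> U" "u \<in> U \<Longrightarrow> v \<in> U \<Longrightarrow> f (u + v) = f u + f v"
    "v \<in> U \<Longrightarrow> f (scale c v) = scale c (f v)"
  using assms by (auto simp: lin_def)

lemmas U_simps [simp, intro] =
  subspace_0[OF subspace_U] subspace_add[OF subspace_U] subspace_scale[OF subspace_U]
  subspace_diff[OF subspace_U] subspace_neg[OF subspace_U]

lemma lin_0: "lin f \<Longrightarrow> f 0 = 0"
  using linD(3)[of f 0 0] by simp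

lemma lin_minus: "lin f \<Longrightarrow> v \<in> U \<Longrightarrow> f (- v) = - f v"
  using linD(3)[of f v "-1"] by simp

lemma lin_diff: "lin f \<Longrightarrow> u \<in> U \<Longrightarrow> v \<in> U \<Longrightarrow> f (u - v) = f u - f v"
  using linD(2)[of f u "- v"] lin_minus[of f v] by simp

lemma lin_sum: "lin f \<Longrightarrow> (\<And>i. i \<in> I \<Longrightarrow> g i \<in> U) \<Longrightarrow> f (sum g I) = (\<Sum>i\<in>I. f (g i))"
proof (induction I rule: infinite_finite_induct)
  case (insert x F)
  then show ?case by (simp add: linD(2) subspace_sum[OF subspace_U])
qed (auto simp: lin_0)

lemma expand_lin:
  assumes f: "lin f" and g: "\<And>i j. g i j \<in> U" "\<exists>j0. \<forall>i. \<forall>j\<ge>j0. g i j = 0"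
  shows "f (expand e g k p m) = expand e (\<lambda>i j. f (g i j)) k p m"
proof -
  obtain j0 where j0: "\<forall>i. \<forall>j\<ge>j0. g i j = 0" using g by blast
  have j0': "\<forall>i. \<forall>j\<ge>j0. f (g i j) = 0" by (simp add: j0 lin_0[OF f])
  show ?thesis
    unfolding expand_eq_sum_ge[OF j0 order_refl, where m=m and e=e and k=k and p=p]
      expand_eq_sum_ge[OF j0' order_refl, where m=m and e=e and k=k and p=p]
    by (auto simp: lin_sum[OF f] g linD(3)[OF f])
qed

lemma expand_add:
  assumes "\<exists>j0. \<forall>i. \<forall>j\<ge>j0. g i j = 0" "\<exists>j0. \<forall>i. \<forall>j\<ge>j0. h i j = 0"
  shows "expand e (\<lambda>i j. g i j + h i j) k p m = expand e g k p m + expand e h k p m"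
proof -
  obtain j0 j1 where "\<forall>i. \<forall>j\<ge>j0. g i j = 0" "\<forall>i. \<forall>j\<ge>j1. h i j = 0" using assms by blast
  then have g: "\<forall>i. \<forall>j\<ge>max j0 j1. g i j = 0" and h: "\<forall>i. \<forall>j\<ge>max j0 j1. h i j = 0" by auto
  then have gh: "\<forall>i. \<forall>j\<ge>max j0 j1. g i j + h i j = 0" by auto
  show ?thesis
    unfolding expand_eq_sum_ge[OF g order_refl, where m=m and e=e and k=k and p=p] expand_eq_sum_ge[OF h order_refl, where m=m and e=e and k=k and p=p]
      expand_eq_sum_ge[of "max j0 j1" "\<lambda>i j. g i j + h i j", OF gh order_refl, where m=m and e=e and k=k and p=p]
    by (simp add: scale_right_distrib sum.distrib)
qed

lemma expand_scale:
  assumes "\<exists>j0. \<forall>i. \<forall>j\<ge>j0. g i j = 0"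
  shows "expand e (\<lambda>i j. scale c (g i j)) k p m = scale c (expand e g k p m)"
proof -
  obtain j0 where g: "\<forall>i. \<forall>j\<ge>j0. g i j = 0" using assms by blast
  then have cg: "\<forall>i. \<forall>j\<ge>j0. scale c (g i j) = 0" by auto
  show ?thesis
    unfolding expand_eq_sum_ge[OF g order_refl, where m=m and e=e and k=k and p=p]
      expand_eq_sum_ge[of j0 "\<lambda>i j. scale c (g i j)", OF cg order_refl, where m=m and e=e and k=k and p=p]
    by (simp add: scale_sum_right mult.commute)
qed

text \<open>The law \<open>(x + e y)\<^sup>k (x + e y)\<^sup>l = (x + e y)\<^bsup>k+l\<^esup>\<close>.\<close>

lemma expand_expand:
  assumes g: "\<exists>j0. \<forall>i. \<forall>j\<ge>j0. g i j = 0"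
  shows "expand e (expand e g l) k p m = expand e g (k + l) p m"
proof -
  obtain j0 where j0: "\<forall>i. \<forall>j\<ge>j0. g i j = 0" using g by blast
  have t: "\<forall>p. \<forall>m\<ge>j0. expand e g l p m = 0" for l
    by (intro allI impI expand_trunc[OF j0])
  then have t': "\<exists>j0. \<forall>i. \<forall>j\<ge>j0. expand e g l i j = 0" for l by blast
  have "expand e (expand e g l) k p m - expand e g (k + l) p m = 0"
  proof (rule expand_unique[where e=e and H="\<lambda>k p m. expand e (expand e g l) k p m - expand e g (k + l) p m"])
    fix k p m
    have "expand e g (k + 1 + l) p m = expand e g (k + l) (p + 1) m + scale e (expand e g (k + l) p (m + 1))"
      using expand_Suc[OF g, of e "k + l"] by (simp add: algebra_simps)
    then show "expand e (expand e g l) (k + 1) p m - expand e g (k + 1 + l) p m =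
       expand e (expand e g l) k (p + 1) m - expand e g (k + l) (p + 1) m +
       scale e (expand e (expand e g l) k p (m + 1) - expand e g (k + l) p (m + 1))"
      by (simp add: expand_Suc[OF t'] scale_right_diff_distrib)
  next
    fix k
    show "\<exists>m0. \<forall>p. \<forall>m\<ge>m0. expand e (expand e g l) k p m - expand e g (k + l) p m = 0"
      by (intro exI[of _ j0] allI impI) (use t[of "k + l"] expand_trunc[OF t[of l]] in auto)
  qed simp
  then show ?thesis by simp
qed

end

section \<open>Local fields and Dong's lemma\<close>

lemma funpow_diff:
  fixes f :: "'g::ab_group_add \<Rightarrow> 'g"
  assumes "\<And>x y. f (x - y) = f x - f y"
  shows "(f ^^ i) (x - y) = (f ^^ i) x - (f ^^ i) y"
  using assms by (induction i) auto

text \<open>In the binomial expansion of \<open>(P - Q)\<^bsup>i+j\<^esup>\<close> every term contains \<open>P\<^sup>i\<close> or \<open>Q\<^sup>j\<close>.\<close>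

lemma funpow_diff_nilpotent:
  fixes P Q :: "'g::ab_group_add \<Rightarrow> 'g"
  assumes P: "\<And>x y. P (x - y) = P x - P y" and Q: "\<And>x y. Q (x - y) = Q x - Q y"
    and PQ: "\<And>x. P (Q x) = Q (P x)"
  shows "(P ^^ i) t = 0 \<Longrightarrow> (Q ^^ j) t = 0 \<Longrightarrow> ((\<lambda>x. P x - Q x) ^^ (i + j)) t = 0"
proof (induction "i + j" arbitrary: i j t)
  case 0
  then show ?case by simp
next
  case (Suc n)
  let ?W = "\<lambda>x. P x - Q x"
  have W: "(?W ^^ r) (x - y) = (?W ^^ r) x - (?W ^^ r) y" for r x y
    by (rule funpow_diff) (simp add: P Q)
  have W0: "(?W ^^ r) 0 = 0" for r using W[of r 0 0] by simp
  have P0: "P 0 = 0" and Q0: "Q 0 = 0" using P[of 0 0] Q[of 0 0] by simp_all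
  have PQi: "(P ^^ r) (Q x) = Q ((P ^^ r) x)" for r x by (induction r) (simp_all add: PQ)
  have QPi: "(Q ^^ r) (P x) = P ((Q ^^ r) x)" for r x by (induction r) (simp_all add: PQ)
  show ?case
  proof (cases "i = 0 \<or> j = 0")
    case True
    then have "t = 0" using Suc.prems by auto
    then show ?thesis by (simp add: W0)
  next
    case False
    then obtain i' j' where ij: "i = Suc i'" "j = Suc j'" by (metis not0_implies_Suc)
    have 1: "(?W ^^ (i' + j)) (P t) = 0"
      by (rule Suc.hyps(1)) (use Suc ij in \<open>simp_all add: QPi P0 funpow_swap1 del: funpow.simps\<close>, simp_all add: funpow_swap1)
    have 2: "(?W ^^ (i + j')) (Q t) = 0"
      by (rule Suc.hyps(1)) (use Suc ij in \<open>simp_all add: PQi Q0 funpow_swap1 del: funpow.simps\<close>, simp_all add: funpow_swap1)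
    have "(?W ^^ (i + j)) t = (?W ^^ (i' + j)) (P t - Q t)"
      using funpow_Suc_right[of "i' + j" ?W] by (simp only: ij add_Suc o_apply)
    also have "\<dots> = (?W ^^ (i' + j)) (P t) - (?W ^^ (i + j')) (Q t)"
      by (simp only: W ij add_Suc add_Suc_right)
    finally show ?thesis using 1 2 by simp
  qed
qed

text \<open>On coefficients, \<open>nabla\<close> is multiplication by \<open>x - y\<close>; \<open>dxy\<close>, \<open>dxz\<close>, \<open>dyz\<close> are the analogues in
  three variables.\<close>

definition nabla :: "(int \<Rightarrow> int \<Rightarrow> 'v::ab_group_add) \<Rightarrow> int \<Rightarrow> int \<Rightarrow> 'v" where
  "nabla f = (\<lambda>p m. f (p + 1) m - f p (m + 1))"

definition dxy :: "(int \<Rightarrow> int \<Rightarrow> int \<Rightarrow> 'v::ab_group_add) \<Rightarrow> int \<Rightarrow> int \<Rightarrow> int \<Rightarrow> 'v" where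
  "dxy f = (\<lambda>p m n. f (p + 1) m n - f p (m + 1) n)"

definition dxz :: "(int \<Rightarrow> int \<Rightarrow> int \<Rightarrow> 'v::ab_group_add) \<Rightarrow> int \<Rightarrow> int \<Rightarrow> int \<Rightarrow> 'v" where
  "dxz f = (\<lambda>p m n. f (p + 1) m n - f p m (n + 1))"

definition dyz :: "(int \<Rightarrow> int \<Rightarrow> int \<Rightarrow> 'v::ab_group_add) \<Rightarrow> int \<Rightarrow> int \<Rightarrow> int \<Rightarrow> 'v" where
  "dyz f = (\<lambda>p m n. f p (m + 1) n - f p m (n + 1))"

lemma d_diff: "dxy (f - g) = dxy f - dxy g" "dxz (f - g) = dxz f - dxz g" "dyz (f - g) = dyz f - dyz g"
  by (simp_all add: dxy_def dxz_def dyz_def fun_eq_iff)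

lemma d_comm: "dxy (dxz f) = dxz (dxy f)" "dxy (dyz f) = dyz (dxy f)" "dxz (dyz f) = dyz (dxz f)"
  by (simp_all add: dxy_def dxz_def dyz_def fun_eq_iff)

lemma dyz_eq: "dyz f = dxz f - dxy f"
  by (simp add: dxy_def dxz_def dyz_def fun_eq_iff)

lemma funpow_commute: "(\<And>x. f (g x) = g (f x)) \<Longrightarrow> (f ^^ i) ((g ^^ j) x) = (g ^^ j) ((f ^^ i) x)"
proof (induction i)
  case (Suc i)
  have "f ((g ^^ j) y) = (g ^^ j) (f y)" for y by (induction j) (simp_all add: Suc.prems)
  with Suc show ?case by simp
qed simp

lemma dyz_pow_slice: "(dyz ^^ L) f p = (nabla ^^ L) (f p)"
  by (induction L) (simp_all add: dyz_def nabla_def fun_eq_iff)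

lemma d_swap:
  "(dxz ^^ L) (\<lambda>p m n. f m p n) = (\<lambda>p m n. (dyz ^^ L) f m p n)"
  "(dyz ^^ L) (\<lambda>p m n. f m p n) = (\<lambda>p m n. (dxz ^^ L) f m p n)"
  by (induction L) (simp_all add: dyz_def dxz_def fun_eq_iff)

lemma nabla_zero: "(nabla ^^ L) (\<lambda>p m. 0) = (\<lambda>p m. 0)"
  by (induction L) (simp_all add: nabla_def)

lemma d_zero: "(dxz ^^ L) 0 = 0" "(dyz ^^ L) 0 = 0"
  by (induction L) (simp_all add: dxz_def dyz_def fun_eq_iff)

context field_space
begin

definition field :: "(int \<Rightarrow> 'v \<Rightarrow> 'v) \<Rightarrow> bool" where
  "field a \<longleftrightarrow> (\<forall>n. lin (a n)) \<and> (\<forall>v\<in>U. \<exists>n0. \<forall>n\<ge>n0. a n v = 0)"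

lemma fieldD: "field a \<Longrightarrow> lin (a n)" "field a \<Longrightarrow> v \<in> U \<Longrightarrow> \<exists>n0. \<forall>n\<ge>n0. a n v = 0"
  by (auto simp: field_def)

lemma field_in_U [simp]: "field a \<Longrightarrow> v \<in> U \<Longrightarrow> a n v \<in> U"
  using fieldD linD by blast

lemma field_0 [simp]: "field a \<Longrightarrow> a n 0 = 0"
  using fieldD lin_0 by blast

text \<open>\<open>E a b k\<close> is the product of the fields in the order \<open>a(x) b(y)\<close>, multiplied by \<open>(x - y)\<^sup>k\<close>
  expanded for \<open>\<bar>x\<bar> > \<bar>y\<bar>\<close>.\<close>

definition E :: "(int \<Rightarrow> 'v \<Rightarrow> 'v) \<Rightarrow> (int \<Rightarrow> 'v \<Rightarrow> 'v) \<Rightarrow> int \<Rightarrow> int \<Rightarrow> int \<Rightarrow> 'v \<Rightarrow> 'v" where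
  "E a b k p m v = expand (-1) (\<lambda>i j. a i (b j v)) k p m"

lemma comp_trunc: "field a \<Longrightarrow> field b \<Longrightarrow> v \<in> U \<Longrightarrow> \<exists>j0. \<forall>i. \<forall>j\<ge>j0. a i (b j v) = 0"
  using fieldD(2)[of b v] by (metis field_0)

lemma E_0 [simp]: "E a b 0 p m v = a p (b m v)"
  by (simp add: E_def)

lemma E_Suc:
  "field a \<Longrightarrow> field b \<Longrightarrow> v \<in> U \<Longrightarrow> E a b (k + 1) p m v = E a b k (p + 1) m v - E a b k p (m + 1) v"
  unfolding E_def by (subst expand_Suc) (simp_all add: comp_trunc)

lemma E_in_U [simp]: "field a \<Longrightarrow> field b \<Longrightarrow> v \<in> U \<Longrightarrow> E a b k p m v \<in> U"
  unfolding E_def by (intro expand_in_U) (simp_all add: comp_trunc)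

lemma E_trunc: "field a \<Longrightarrow> field b \<Longrightarrow> v \<in> U \<Longrightarrow> \<exists>m0. \<forall>k p. \<forall>m\<ge>m0. E a b k p m v = 0"
  unfolding E_def using comp_trunc[of a b v] expand_trunc by meson

lemma ex_common_bound:
  fixes Q :: "int \<Rightarrow> nat \<Rightarrow> bool"
  assumes "\<And>s. \<exists>r0. \<forall>r\<ge>r0. Q r s"
  shows "\<exists>r0. \<forall>r\<ge>r0. \<forall>s<S. Q r s"
proof (induction S)
  case (Suc S)
  obtain r0 r1 where "\<forall>r\<ge>r0. \<forall>s<S. Q r s" "\<forall>r\<ge>r1. Q r S" using Suc assms by metis
  then show ?case by (intro exI[of _ "max r0 r1"]) (auto simp: less_Suc_eq)
qed simp

lemma E_trunc_left:
  assumes "field a" "field b" "v \<in> U"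
  shows "\<exists>p0. \<forall>p\<ge>p0. E a b k p m v = 0"
proof -
  obtain j0 where j0: "\<forall>i. \<forall>j\<ge>j0. a i (b j v) = 0" using comp_trunc assms by blast
  have "\<exists>p0. \<forall>p\<ge>p0. a (p + k - int s) (b (m + int s) v) = 0" for s
  proof -
    obtain n0 where "\<forall>n\<ge>n0. a n (b (m + int s) v) = 0"
      using fieldD(2)[OF assms(1)] assms by (meson field_in_U)
    then show ?thesis by (intro exI[of _ "n0 - k + int s"]) simp
  qed
  then have "\<exists>p0. \<forall>p\<ge>p0. \<forall>s<nat (j0 - m). a (p + k - int s) (b (m + int s) v) = 0"
    by (rule ex_common_bound)
  then show ?thesis unfolding E_def expand_eq_sum_ge[OF j0 order_refl] by (metis (no_types, lifting) lessThan_iff scale_zero_right sum.neutral)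
qed

lemma E_lin: assumes "field a" "field b" shows "lin (E a b k p m)"
  unfolding lin_def
proof (intro conjI ballI allI)
  fix v assume "v \<in> U" then show "E a b k p m v \<in> U" using assms by simp
next
  fix u v assume uv: "u \<in> U" "v \<in> U"
  have "a i (b j (u + v)) = a i (b j u) + a i (b j v)" for i j
    using uv assms linD(2)[OF fieldD(1)] by simp
  then show "E a b k p m (u + v) = E a b k p m u + E a b k p m v"
    using uv assms by (simp add: E_def expand_add comp_trunc)
next
  fix c v assume v: "v \<in> U"
  have "a i (b j (scale c v)) = scale c (a i (b j v))" for i j
    using v assms linD(3)[OF fieldD(1)] by simp
  then show "E a b k p m (scale c v) = scale c (E a b k p m v)"
    using v assms by (simp add: E_def expand_scale comp_trunc)
qed

lemma field_E:
  assumes "field a" "field b"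
  shows "field (\<lambda>m. E a b k p m)" "field (\<lambda>p. E a b k p m)"
proof -
  have "\<exists>n0. \<forall>n\<ge>n0. E a b k p n v = 0" if "v \<in> U" for v
    using E_trunc[OF assms that] by meson
  then show "field (\<lambda>m. E a b k p m)" by (simp add: field_def E_lin[OF assms])
  show "field (\<lambda>p. E a b k p m)" by (simp add: field_def E_lin[OF assms] E_trunc_left[OF assms])
qed

lemma lin_comb: "lin f \<Longrightarrow> lin g \<Longrightarrow> lin (\<lambda>v. f v - scale c (g v))"
  unfolding lin_def by (auto simp: algebra_simps)

text \<open>The distribution \<open>(x - y)\<^sup>k a(x) b(y) - \<sigma> (x - y)\<^sup>k b(y) a(x)\<close>, the first power expanded for
  \<open>\<bar>x\<bar> > \<bar>y\<bar>\<close>, the second for \<open>\<bar>y\<bar> > \<bar>x\<bar>\<close>.  It vanishes iff \<open>a\<close> and \<open>b\<close> are local of order \<open>k\<close>, and its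
  coefficients with \<open>p = 0\<close> form the \<open>k\<close>-th product of \<open>a\<close> and \<open>b\<close>.\<close>

definition R :: "'k \<Rightarrow> (int \<Rightarrow> 'v \<Rightarrow> 'v) \<Rightarrow> (int \<Rightarrow> 'v \<Rightarrow> 'v) \<Rightarrow> int \<Rightarrow> int \<Rightarrow> int \<Rightarrow> 'v \<Rightarrow> 'v" where
  "R \<sigma> a b k p m v = E a b k p m v - scale (\<sigma> * (-1) powi k) (E b a k m p v)"

lemma R_0: "R \<sigma> a b 0 p m v = a p (b m v) - scale \<sigma> (b m (a p v))"
  by (simp add: R_def)

lemma minus_one_powi_Suc: "(-1 :: 'k) powi (k + 1) = - ((-1) powi k)"
  by (subst power_int_add) simp_all

lemma R_Suc:
  assumes "field a" "field b" "v \<in> U"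
  shows "R \<sigma> a b (k + 1) p m v = R \<sigma> a b k (p + 1) m v - R \<sigma> a b k p (m + 1) v"
  using assms by (simp add: R_def E_Suc minus_one_powi_Suc scale_right_diff_distrib)

lemma R_in_U [simp]: "field a \<Longrightarrow> field b \<Longrightarrow> v \<in> U \<Longrightarrow> R \<sigma> a b k p m v \<in> U"
  by (simp add: R_def)

lemma R_lin: "field a \<Longrightarrow> field b \<Longrightarrow> lin (R \<sigma> a b k p m)"
  unfolding R_def by (intro lin_comb E_lin)

lemma R_nabla:
  assumes "field a" "field b" "v \<in> U"
  shows "R \<sigma> a b (k + int K) p m v = (nabla ^^ K) (\<lambda>p m. R \<sigma> a b k p m v) p m"
proof (induction K arbitrary: p m)
  case (Suc K)
  have "R \<sigma> a b (k + int (Suc K)) p m v = R \<sigma> a b (k + int K) (p + 1) m v - R \<sigma> a b (k + int K) p (m + 1) v"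
    using R_Suc[OF assms, of \<sigma> "k + int K" p m] by (simp add: ac_simps)
  also have "\<dots> = (nabla ^^ Suc K) (\<lambda>p m. R \<sigma> a b k p m v) p m"
    by (simp add: Suc.IH nabla_def[of "(nabla ^^ K) f" for f])
  finally show ?case .
qed simp

definition local :: "'k \<Rightarrow> (int \<Rightarrow> 'v \<Rightarrow> 'v) \<Rightarrow> (int \<Rightarrow> 'v \<Rightarrow> 'v) \<Rightarrow> bool" where
  "local \<sigma> a b \<longleftrightarrow> (\<exists>K::nat. \<forall>p m. \<forall>v\<in>U. R \<sigma> a b (int K) p m v = 0)"

lemma R_zero_up:
  assumes "field a" "field b" "v \<in> U" "\<And>p m. R \<sigma> a b k p m v = 0" "k' \<ge> k"
  shows "R \<sigma> a b k' p m v = 0"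
  using R_nabla[OF assms(1-3), of \<sigma> k "nat (k' - k)"] assms(4,5) by (simp add: nabla_zero)

lemma localI:
  assumes "field a" "field b" "\<And>p m v. v \<in> U \<Longrightarrow> R \<sigma> a b k p m v = 0"
  shows "local \<sigma> a b"
proof -
  have "R \<sigma> a b (int (nat k)) p m v = 0" if "v \<in> U" for p m v
    by (rule R_zero_up[OF assms(1,2) that assms(3)[OF that]]) simp
  then show ?thesis unfolding local_def by blast
qed

lemma localE:
  assumes "local \<sigma> a b" "field a" "field b"
  obtains K :: nat where "\<And>k p m v. k \<ge> int K \<Longrightarrow> v \<in> U \<Longrightarrow> R \<sigma> a b k p m v = 0"
proof -
  obtain K where K: "\<forall>p m. \<forall>v\<in>U. R \<sigma> a b (int K) p m v = 0" using assms(1) unfolding local_def by blast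
  have "R \<sigma> a b k p m v = 0" if "k \<ge> int K" "v \<in> U" for k p m v
    by (rule R_zero_up[OF assms(2,3) that(2) _ that(1)]) (use K that(2) in simp)
  then show ?thesis using that by blast
qed

lemma R_swap:
  assumes "\<sigma> * \<sigma> = 1"
  shows "R \<sigma> b a k m p v = scale (- \<sigma> * (-1) powi k) (R \<sigma> a b k p m v)"
proof -
  have 1: "(-1 :: 'k) powi k * (-1) powi k = 1"
    by (simp add: power_int_mult_distrib[symmetric])
  have "\<sigma> * (-1) powi k * (\<sigma> * (-1) powi k) = (\<sigma> * \<sigma>) * ((-1) powi k * (-1) powi k)" by (simp add: ac_simps)
  then have "\<sigma> * (-1) powi k * (\<sigma> * (-1) powi k) = 1" using 1 assms by simp
  then show ?thesis by (simp add: R_def scale_right_diff_distrib)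
qed

lemma local_sym: "\<sigma> * \<sigma> = 1 \<Longrightarrow> local \<sigma> a b \<Longrightarrow> local \<sigma> b a"
  unfolding local_def by (metis R_swap scale_zero_right)

definition prd :: "'k \<Rightarrow> int \<Rightarrow> (int \<Rightarrow> 'v \<Rightarrow> 'v) \<Rightarrow> (int \<Rightarrow> 'v \<Rightarrow> 'v) \<Rightarrow> int \<Rightarrow> 'v \<Rightarrow> 'v" where
  "prd \<sigma> k a b = (\<lambda>m. R \<sigma> a b k 0 m)"

lemma field_comb:
  assumes "field a" "field b" shows "field (\<lambda>n v. a n v - scale c (b n v))"
  unfolding field_def
proof (intro conjI allI ballI)
  fix v assume "v \<in> U"
  then obtain n0 n1 where "\<forall>n\<ge>n0. a n v = 0" "\<forall>n\<ge>n1. b n v = 0" using fieldD assms by metis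
  then show "\<exists>n0. \<forall>n\<ge>n0. a n v - scale c (b n v) = 0"
    by (intro exI[of _ "max n0 n1"]) simp
qed (simp add: assms fieldD(1) lin_comb)

lemma field_R: "field a \<Longrightarrow> field b \<Longrightarrow> field (\<lambda>m. R \<sigma> a b k p m)"
  unfolding R_def by (rule field_comb; rule field_E; assumption)

lemma field_prd: "field a \<Longrightarrow> field b \<Longrightarrow> field (prd \<sigma> k a b)"
  unfolding prd_def by (rule field_R)

lemma dyz_lin:
  assumes "\<And>p. lin (a p)" "\<And>m n. h m n \<in> U"
  shows "(dyz ^^ L) (\<lambda>p m n. a p (h m n)) = (\<lambda>p m n. a p ((nabla ^^ L) h m n)) \<and> (\<forall>m n. (nabla ^^ L) h m n \<in> U)"
proof (induction L)
  case (Suc L)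
  then show ?case by (simp add: dyz_def nabla_def lin_diff[OF assms(1)])
qed (simp add: assms)

lemma dxz_scale:
  "(dxz ^^ L) (\<lambda>p m n. scale s (g m p n)) = (\<lambda>p m n. scale s ((nabla ^^ L) (g m) p n))"
  by (induction L) (simp_all add: dxz_def nabla_def scale_right_diff_distrib)

text \<open>The distribution \<open>(x - y)\<^sup>k [a(x) b(y), c(z)]\<close>, one of the two halves of the bracket of \<open>c\<close> with
  the products of \<open>a\<close> and \<open>b\<close>.\<close>

definition tri :: "'k \<Rightarrow> (int \<Rightarrow> 'v \<Rightarrow> 'v) \<Rightarrow> (int \<Rightarrow> 'v \<Rightarrow> 'v) \<Rightarrow> (int \<Rightarrow> 'v \<Rightarrow> 'v) \<Rightarrow> 'v \<Rightarrow> int \<Rightarrow> int \<Rightarrow> int \<Rightarrow> int \<Rightarrow> 'v" where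
  "tri \<tau> a b c v k p m n = E a b k p m (c n v) - scale \<tau> (c n (E a b k p m v))"

lemma tri_Suc:
  assumes "field a" "field b" "field c" "v \<in> U"
  shows "tri \<tau> a b c v (k + 1) = dxy (tri \<tau> a b c v k)"
  using assms by (simp add: fun_eq_iff tri_def dxy_def E_Suc lin_diff[OF fieldD(1)] scale_right_diff_distrib)

text \<open>Since \<open>[ab, c] = a[b, c] + [a, c]b\<close>, the factors \<open>(x - z)\<^sup>M\<close> and \<open>(y - z)\<^sup>M\<close> kill the case \<open>k = 0\<close>;
  they commute with multiplication by \<open>x - y\<close>, which carries this over to all \<open>k\<close>.\<close>

lemma tri_killed:
  assumes ab: "field a" "field b" and c: "field c" and v: "v \<in> U"
    and ac: "\<And>p n v. v \<in> U \<Longrightarrow> R \<sigma> a c (int M) p n v = 0"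
    and bc: "\<And>p n v. v \<in> U \<Longrightarrow> R \<sigma>' b c (int M) p n v = 0"
  shows "(dxz ^^ M) ((dyz ^^ M) (tri (\<sigma> * \<sigma>') a b c v k)) = 0"
proof -
  let ?T = "tri (\<sigma> * \<sigma>') a b c v"
  define L :: "(int \<Rightarrow> int \<Rightarrow> int \<Rightarrow> 'v) \<Rightarrow> _" where "L = (\<lambda>f. (dxz ^^ M) ((dyz ^^ M) f))"
  have Lxy: "L (dxy f) = dxy (L f)" for f
    using funpow_commute[of dxy dyz 1 M f] funpow_commute[of dxy dxz 1 M "(dyz ^^ M) f"]
    by (simp add: L_def d_comm)
  have Ldiff: "L (f - g) = L f - L g" for f g
    by (simp add: L_def funpow_diff d_diff)
  have Lyx: "L f = (dyz ^^ M) ((dxz ^^ M) f)" for f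
    unfolding L_def by (rule funpow_commute) (rule d_comm)
  let ?Tr = "\<lambda>f :: int \<Rightarrow> int \<Rightarrow> int \<Rightarrow> 'v. \<forall>n. \<exists>m0. \<forall>p. \<forall>m\<ge>m0. f p m n = 0"
  have Trz: "?Tr (dyz f) \<and> ?Tr (dxz f)" if tr: "?Tr f" for f
  proof (intro conjI allI)
    fix n
    obtain m0 m1 where m: "\<forall>p. \<forall>m\<ge>m0. f p m n = 0" "\<forall>p. \<forall>m\<ge>m1. f p m (n + 1) = 0"
      using tr by metis
    show "\<exists>m0. \<forall>p. \<forall>m\<ge>m0. dyz f p m n = 0"
      by (rule exI[of _ "max m0 m1"]) (use m in \<open>auto simp: dyz_def\<close>)
    show "\<exists>m0. \<forall>p. \<forall>m\<ge>m0. dxz f p m n = 0"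
      by (rule exI[of _ "max m0 m1"]) (use m in \<open>auto simp: dxz_def\<close>)
  qed
  have Trpow: "?Tr ((dyz ^^ i) f) \<and> ?Tr ((dxz ^^ i) f)" if "?Tr f" for i f
  proof (induction i)
    case 0
    then show ?case using that by simp
  next
    case (Suc i)
    note a = Trz[OF conjunct1[OF Suc.IH]] and b = Trz[OF conjunct2[OF Suc.IH]]
    show ?case unfolding funpow.simps o_apply using conjunct1[OF a] conjunct2[OF b] by (rule conjI)
  qed
  have TrL: "?Tr (L f)" if "?Tr f" for f
    unfolding L_def using Trpow that by blast
  have TrT: "?Tr (?T k)" for k
  proof
    fix n
    obtain m0 where m0: "\<forall>k p. \<forall>m\<ge>m0. E a b k p m (c n v) = 0" using E_trunc[OF ab] c v by (meson field_in_U)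
    obtain m1 where m1: "\<forall>k p. \<forall>m\<ge>m1. E a b k p m v = 0" using E_trunc[OF ab v] by blast
    show "\<exists>m0. \<forall>p. \<forall>m\<ge>m0. ?T k p m n = 0"
      by (rule exI[of _ "max m0 m1"]) (use m0 m1 c in \<open>auto simp: tri_def\<close>)
  qed
  have base: "L (?T 0) = 0"
  proof -
    define A where "A = (\<lambda>p m n. a p (R \<sigma>' b c 0 m n v))"
    define B where "B = (\<lambda>p m n. scale (- \<sigma>') (R \<sigma> a c 0 p n (b m v)))"
    have T0: "?T 0 = A - B"
      using ab c v by (simp add: fun_eq_iff A_def B_def tri_def R_0 lin_diff[OF fieldD(1)] linD(3)[OF fieldD(1)]
          scale_right_diff_distrib mult.commute)
    have n1: "(nabla ^^ M) (\<lambda>m n. R \<sigma>' b c 0 m n v) m n = 0" for m n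
      using R_nabla[OF ab(2) c v, of \<sigma>' 0 M m n] bc v by simp
    have n2: "(nabla ^^ M) (\<lambda>p n. R \<sigma> a c 0 p n (b m v)) p n = 0" for p m n
      using R_nabla[OF ab(1) c, of "b m v" \<sigma> 0 M p n] ac ab v by simp
    have "(dyz ^^ M) A = 0"
      unfolding A_def using dyz_lin[of a "\<lambda>m n. R \<sigma>' b c 0 m n v" M] n1 ab c v
      by (simp add: fieldD fun_eq_iff)
    then have LA: "L A = 0" by (simp add: L_def d_zero)
    have "(dxz ^^ M) B = 0"
      unfolding B_def using dxz_scale[of M "- \<sigma>'" "\<lambda>m p n. R \<sigma> a c 0 p n (b m v)"] n2
      by (simp add: fun_eq_iff)
    then have LB: "L B = 0" by (simp add: Lyx d_zero)
    show ?thesis by (simp only: T0 Ldiff LA LB) simp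
  qed
  have "L (?T k) p m n = 0" for p m n
  proof (rule expand_unique[where e="-1" and H="\<lambda>k p m. L (?T k) p m n"])
    fix k p m
    show "L (?T (k + 1)) p m n = L (?T k) (p + 1) m n + scale (- 1) (L (?T k) p (m + 1) n)"
      by (simp add: tri_Suc[OF ab c v] Lxy) (simp add: dxy_def)
  next
    fix k
    show "\<exists>m0. \<forall>p. \<forall>m\<ge>m0. L (?T k) p m n = 0" using TrL[OF TrT] by blast
  qed (simp add: base)
  then show ?thesis by (simp add: L_def fun_eq_iff)
qed

text \<open>Dong's lemma.  On three-variable distributions \<open>y - z\<close> is the difference of \<open>x - z\<close> and
  \<open>x - y\<close>; once multiplied by \<open>(y - z)\<^sup>M\<close>, the bracket of
  \<open>(x - y)\<^sup>k [a(x), b(y)]\<close> with \<open>c(z)\<close> is annihilated by powers of both, and these two operators commute.\<close>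

lemma dong:
  assumes ab: "field a" "field b" and c: "field c"
    and loc: "local \<sigma>ab a b" "local \<sigma>ac a c" "local \<sigma>bc b c"
  shows "local (\<sigma>ac * \<sigma>bc) (prd \<sigma>ab k a b) c"
proof -
  obtain K where K: "\<And>k p m v. k \<ge> int K \<Longrightarrow> v \<in> U \<Longrightarrow> R \<sigma>ab a b k p m v = 0"
    using localE[OF loc(1) ab] by blast
  obtain M1 M2 where "\<And>k p m v. k \<ge> int M1 \<Longrightarrow> v \<in> U \<Longrightarrow> R \<sigma>ac a c k p m v = 0"
    "\<And>k p m v. k \<ge> int M2 \<Longrightarrow> v \<in> U \<Longrightarrow> R \<sigma>bc b c k p m v = 0"
    using localE[OF loc(2) ab(1) c] localE[OF loc(3) ab(2) c] by metis
  then obtain M where ac: "\<And>p m v. v \<in> U \<Longrightarrow> R \<sigma>ac a c (int M) p m v = 0"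
    and bc: "\<And>p m v. v \<in> U \<Longrightarrow> R \<sigma>bc b c (int M) p m v = 0"
    by (metis max.cobounded1 max.cobounded2 of_nat_le_iff)
  define j where "j = nat (int K - k)"
  let ?\<tau> = "\<sigma>ac * \<sigma>bc"
  have "R ?\<tau> (prd \<sigma>ab k a b) c (int (M + j + M)) m n v = 0" if v: "v \<in> U" for m n v
  proof -
    define T where "T = (\<lambda>k p m n. R \<sigma>ab a b k p m (c n v) - scale ?\<tau> (c n (R \<sigma>ab a b k p m v)))"
    have T_Suc: "T (k + 1) = dxy (T k)" for k
      using ab c v by (simp add: T_def fun_eq_iff dxy_def R_Suc lin_diff[OF fieldD(1)] scale_right_diff_distrib)
    have T_pow: "(dxy ^^ i) (T k) = T (k + int i)" for i
    proof (induction i)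
      case (Suc i)
      then show ?case using T_Suc[of "k + int i"] by (simp add: ac_simps)
    qed simp
    have "T (k + int j) = 0"
      using K ab c v by (simp add: T_def fun_eq_iff j_def)
    then have xy: "(dxy ^^ j) ((dyz ^^ M) (T k)) = 0"
      using funpow_commute[of dxy dyz j M "T k"] by (simp add: d_comm T_pow d_zero)
    have xz: "(dxz ^^ M) ((dyz ^^ M) (T k)) = 0"
    proof -
      define s where "s = \<sigma>ab * (-1) powi k"
      define V where "V = (\<lambda>p m n. scale s (tri ?\<tau> b a c v k p m n))"
      have TV: "T k = tri ?\<tau> a b c v k - (\<lambda>p m n. V m p n)"
        using ab c v by (simp add: T_def fun_eq_iff V_def tri_def R_def s_def lin_diff[OF fieldD(1)]
          linD(3)[OF fieldD(1)] scale_right_diff_distrib mult.commute)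
      have dV: "(dxz ^^ i) (\<lambda>p m n. scale s (f p m n)) = (\<lambda>p m n. scale s ((dxz ^^ i) f p m n))"
        "(dyz ^^ i) (\<lambda>p m n. scale s (f p m n)) = (\<lambda>p m n. scale s ((dyz ^^ i) f p m n))" for i f
        by (induction i) (simp_all add: dxz_def dyz_def scale_right_diff_distrib)
      have "(dxz ^^ M) ((dyz ^^ M) (tri (\<sigma>bc * \<sigma>ac) b a c v k)) = 0"
        by (rule tri_killed[OF ab(2) ab(1) c v bc ac])
      then have "(dxz ^^ M) ((dyz ^^ M) V) = 0"
        by (simp add: V_def dV mult.commute fun_eq_iff)
      then have "(dyz ^^ M) ((dxz ^^ M) V) = 0"
        using funpow_commute[of dxz dyz M M V] by (simp add: d_comm)
      then have "(dxz ^^ M) ((dyz ^^ M) (\<lambda>p m n. V m p n)) = 0"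
        by (simp only: d_swap(2)[of M V] d_swap(1)[of M "(dxz ^^ M) V"]) (simp add: fun_eq_iff)
      then show ?thesis
        unfolding TV using tri_killed[OF ab c v ac bc, of k] by (simp add: funpow_diff d_diff)
    qed
    have "((\<lambda>f. dxz f - dxy f) ^^ (M + j)) ((dyz ^^ M) (T k)) = 0"
      by (rule funpow_diff_nilpotent[OF _ _ _ xz xy]) (simp_all add: d_diff d_comm)
    then have "(dyz ^^ (M + j + M)) (T k) = 0"
      by (simp add: funpow_add dyz_eq[abs_def, symmetric])
    then have "(nabla ^^ (M + j + M)) (T k 0) m n = 0"
      using dyz_pow_slice[of "M + j + M" "T k" 0] by simp
    moreover have "T k 0 = (\<lambda>m n. R ?\<tau> (prd \<sigma>ab k a b) c 0 m n v)"
      by (simp add: T_def R_0 prd_def fun_eq_iff)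
    ultimately show ?thesis
      using R_nabla[OF field_prd[OF ab] c v, of ?\<tau> \<sigma>ab k 0 "M + j + M" m n] by simp
  qed
  then show ?thesis unfolding local_def by blast
qed

end

section \<open>Derivatives, and locality of the products of fields\<close>

context field_space
begin

definition deriv :: "(int \<Rightarrow> 'v \<Rightarrow> 'v) \<Rightarrow> int \<Rightarrow> 'v \<Rightarrow> 'v" where
  "deriv a = (\<lambda>n v. scale (- of_int n) (a (n - 1) v))"

lemma field_deriv: assumes "field a" shows "field (deriv a)"
  unfolding field_def
proof (intro conjI allI ballI)
  fix n show "lin (deriv a n)"
    using fieldD(1)[OF assms, of "n - 1"] unfolding lin_def deriv_def
    by (simp add: scale_right_distrib mult.commute)
next
  fix v assume "v \<in> U"
  then obtain n0 where "\<forall>n\<ge>n0. a n v = 0" using fieldD(2)[OF assms] by blast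
  then show "\<exists>n0. \<forall>n\<ge>n0. deriv a n v = 0"
    by (intro exI[of _ "n0 + 1"]) (simp add: deriv_def)
qed

text \<open>The two product rules \<open>(x - y)\<^sup>k a'(x) = \<partial>\<^sub>x ((x - y)\<^sup>k a(x)) - k (x - y)\<^bsup>k-1\<^esup> a(x)\<close> and its analogue in \<open>y\<close>.\<close>

lemma E_deriv_left:
  assumes ab: "field a" "field b" and v: "v \<in> U"
  shows "E (deriv a) b k p m v =
    - scale (of_int k) (E a b (k - 1) p m v) - scale (of_int p) (E a b k (p - 1) m v)"
proof -
  let ?H = "\<lambda>k p m. E (deriv a) b k p m v + scale (of_int k) (E a b (k - 1) p m v)
    + scale (of_int p) (E a b k (p - 1) m v)"
  note da = field_deriv[OF ab(1)]
  have "?H k p m = 0"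
  proof (rule expand_unique[where e="-1" and H="?H"])
    fix k p m
    have e1: "E a b (k - 1) (p + 1) m v = E a b k p m v + E a b (k - 1) p (m + 1) v"
      using E_Suc[OF ab v, of "k - 1" p m] by simp
    have e2: "E a b (k + 1) (p - 1) m v = E a b k p m v - E a b k (p - 1) (m + 1) v"
      using E_Suc[OF ab v, of k "p - 1" m] by simp
    show "?H (k + 1) p m = ?H k (p + 1) m + scale (- 1) (?H k p (m + 1))"
      by (simp add: E_Suc[OF da ab(2) v] e1 e2 scale_left_distrib scale_right_distrib scale_right_diff_distrib)
  next
    fix k
    obtain m0 m1 where "\<forall>k p. \<forall>m\<ge>m0. E (deriv a) b k p m v = 0" "\<forall>k p. \<forall>m\<ge>m1. E a b k p m v = 0"
      using E_trunc[OF ab v] E_trunc[OF da ab(2) v] by metis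
    then show "\<exists>m0. \<forall>p. \<forall>m\<ge>m0. ?H k p m = 0" by (intro exI[of _ "max m0 m1"]) simp
  qed (simp add: deriv_def)
  then show ?thesis by (simp add: eq_neg_iff_add_eq_0 eq_diff_eq add.assoc add.commute add.left_commute)
qed

lemma E_deriv_right:
  assumes ab: "field a" "field b" and v: "v \<in> U"
  shows "E a (deriv b) k p m v =
    scale (of_int k) (E a b (k - 1) p m v) - scale (of_int m) (E a b k p (m - 1) v)"
proof -
  let ?H = "\<lambda>k p m. E a (deriv b) k p m v - scale (of_int k) (E a b (k - 1) p m v)
    + scale (of_int m) (E a b k p (m - 1) v)"
  note db = field_deriv[OF ab(2)]
  have "?H k p m = 0"
  proof (rule expand_unique[where e="-1" and H="?H"])
    fix k p m
    have e1: "E a b (k - 1) (p + 1) m v = E a b k p m v + E a b (k - 1) p (m + 1) v"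
      using E_Suc[OF ab v, of "k - 1" p m] by simp
    have e2: "E a b (k + 1) p (m - 1) v = E a b k (p + 1) (m - 1) v - E a b k p m v"
      using E_Suc[OF ab v, of k p "m - 1"] by simp
    show "?H (k + 1) p m = ?H k (p + 1) m + scale (- 1) (?H k p (m + 1))"
      by (simp add: E_Suc[OF ab(1) db v] e1 e2 scale_left_distrib scale_right_distrib scale_right_diff_distrib)
  next
    fix k
    obtain m0 m1 where "\<forall>k p. \<forall>m\<ge>m0. E a (deriv b) k p m v = 0" "\<forall>k p. \<forall>m\<ge>m1. E a b k p m v = 0"
      using E_trunc[OF ab v] E_trunc[OF ab(1) db v] by metis
    then show "\<exists>m0. \<forall>p. \<forall>m\<ge>m0. ?H k p m = 0" by (intro exI[of _ "max m0 (m1 + 1)"]) simp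
  next
    fix p m
    show "?H 0 p m = 0" using linD(3)[OF fieldD(1)[OF ab(1)] field_in_U[OF ab(2) v]] by (simp add: deriv_def lin_minus[OF fieldD(1)[OF ab(1)]] v ab(2))
  qed
  then show ?thesis by (simp add: algebra_simps)
qed

lemma powi_minus_one: "(-1 :: 'k) powi k = - ((-1) powi (k - 1))"
  using minus_one_powi_Suc[of "k - 1"] by simp

lemma R_deriv_left:
  assumes "field a" "field b" "v \<in> U"
  shows "R \<sigma> (deriv a) b k p m v =
    - scale (of_int k) (R \<sigma> a b (k - 1) p m v) - scale (of_int p) (R \<sigma> a b k (p - 1) m v)"
  unfolding R_def using assms
  by (simp add: E_deriv_left E_deriv_right powi_minus_one[of k] scale_right_diff_distrib scale_right_distrib
      mult.commute mult.left_commute)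

lemma R_deriv_right:
  assumes "field a" "field b" "v \<in> U"
  shows "R \<sigma> a (deriv b) k p m v =
    scale (of_int k) (R \<sigma> a b (k - 1) p m v) - scale (of_int m) (R \<sigma> a b k p (m - 1) v)"
  unfolding R_def using assms
  by (simp add: E_deriv_left E_deriv_right powi_minus_one[of k] scale_right_diff_distrib scale_right_distrib
      mult.commute mult.left_commute)

text \<open>If \<open>T\<close> acts on \<open>a\<close> and \<open>b\<close> by differentiation, it does so on all their products: the
  derivation \<open>\<partial>\<^sub>x + \<partial>\<^sub>y\<close> kills \<open>(x - y)\<^sup>k\<close>.\<close>

lemma R_covariant:
  assumes ab: "field a" "field b" and v: "v \<in> U" and T: "lin T"
    and Da: "\<And>n v. v \<in> U \<Longrightarrow> T (a n v) = a n (T v) + deriv a n v"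
    and Db: "\<And>n v. v \<in> U \<Longrightarrow> T (b n v) = b n (T v) + deriv b n v"
  shows "T (R \<sigma> a b k p m v) = R \<sigma> a b k p m (T v)
    - scale (of_int p) (R \<sigma> a b k (p - 1) m v) - scale (of_int m) (R \<sigma> a b k p (m - 1) v)"
proof -
  have Dv: "T v \<in> U" using linD(1)[OF T v] .
  have E: "T (E a b k p m v) = E a b k p m (T v)
    - scale (of_int p) (E a b k (p - 1) m v) - scale (of_int m) (E a b k p (m - 1) v)"
    if ab: "field a" "field b"
    and Da: "\<forall>n. \<forall>v\<in>U. T (a n v) = a n (T v) + deriv a n v"
    and Db: "\<forall>n. \<forall>v\<in>U. T (b n v) = b n (T v) + deriv b n v" for a b k p m
  proof -
    note da = field_deriv[OF ab(1)] and db = field_deriv[OF ab(2)]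
    have "T (E a b k p m v) = expand (-1) (\<lambda>i j. T (a i (b j v))) k p m"
      unfolding E_def by (rule expand_lin[OF T]) (simp_all add: ab v comp_trunc)
    also have "\<dots> = expand (-1) (\<lambda>i j. a i (b j (T v)) + (a i (deriv b j v) + deriv a i (b j v))) k p m"
      using ab v Dv db by (simp add: Da Db linD(2)[OF fieldD(1)] add.assoc)
    also have "\<dots> = E a b k p m (T v) + (E a (deriv b) k p m v + E (deriv a) b k p m v)"
    proof -
      note t = comp_trunc[OF ab Dv] comp_trunc[OF ab(1) db v] comp_trunc[OF da ab(2) v]
      have t2: "\<exists>j0. \<forall>i. \<forall>j\<ge>j0. a i (deriv b j v) + deriv a i (b j v) = 0"
      proof -
        obtain j0 j1 where "\<forall>i. \<forall>j\<ge>j0. a i (deriv b j v) = 0" "\<forall>i. \<forall>j\<ge>j1. deriv a i (b j v) = 0"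
          using t by metis
        then show ?thesis by (intro exI[of _ "max j0 j1"]) simp
      qed
      show ?thesis unfolding E_def
        by (simp add: expand_add t t2)
    qed
    finally show ?thesis using ab v by (simp add: E_deriv_left E_deriv_right)
  qed
  have Da': "\<forall>n. \<forall>v\<in>U. T (a n v) = a n (T v) + deriv a n v"
    and Db': "\<forall>n. \<forall>v\<in>U. T (b n v) = b n (T v) + deriv b n v"
    using Da Db by blast+
  have TR: "T (R \<sigma> a b k p m v) = T (E a b k p m v) - scale (\<sigma> * (-1) powi k) (T (E b a k m p v))"
    unfolding R_def using ab v by (simp add: lin_diff[OF T] linD(3)[OF T])
  show ?thesis
    unfolding TR E[OF ab Da' Db'] E[OF ab(2,1) Db' Da'] unfolding R_def
    by (simp add: algebra_simps)
qed

lemma expand_cong_field: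
  "(\<And>n. f n v = g n v) \<Longrightarrow> E x f k p m v = E x g k p m v"
  by (simp add: E_def)

lemma E_comb_right:
  assumes "field x" "field f" "field g" "v \<in> U"
  shows "E x (\<lambda>n v. f n v - scale c (g n v)) k p m v = E x f k p m v - scale c (E x g k p m v)"
proof -
  have "E x (\<lambda>n v. f n v - scale c (g n v)) k p m v
     = expand (-1) (\<lambda>i j. x i (f j v) + scale (- c) (x i (g j v))) k p m"
    using assms by (simp add: E_def lin_diff[OF fieldD(1)] linD(3)[OF fieldD(1)])
  also have "\<dots> = E x f k p m v + scale (- c) (E x g k p m v)"
  proof -
    have "\<exists>j0. \<forall>i. \<forall>j\<ge>j0. scale (- c) (x i (g j v)) = 0"
      using comp_trunc[OF assms(1,3,4)] by (metis scale_zero_right)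
    then show ?thesis unfolding E_def using assms by (subst expand_add) (simp_all only: expand_scale comp_trunc)
  qed
  finally show ?thesis by simp
qed

lemma E_comb_left:
  assumes "field x" "field f" "field g" "v \<in> U"
  shows "E (\<lambda>n v. f n v - scale c (g n v)) x k p m v = E f x k p m v - scale c (E g x k p m v)"
proof -
  have "E (\<lambda>n v. f n v - scale c (g n v)) x k p m v
     = expand (-1) (\<lambda>i j. f i (x j v) + scale (- c) (g i (x j v))) k p m"
    using assms by (simp add: E_def)
  also have "\<dots> = E f x k p m v + scale (- c) (E g x k p m v)"
  proof -
    have "\<exists>j0. \<forall>i. \<forall>j\<ge>j0. scale (- c) (g i (x j v)) = 0"
      using comp_trunc[OF assms(3,1,4)] by (metis scale_zero_right)
    then show ?thesis unfolding E_def using assms by (subst expand_add) (simp_all only: expand_scale comp_trunc)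
  qed
  finally show ?thesis by simp
qed

lemma E_shift_right: "E x (\<lambda>n. f (n + 1)) k p m v = E x f k p (m + 1) v"
  by (simp add: E_def expand_def ac_simps)

lemma E_shift_left: "E (\<lambda>n. f (n + 1)) x k p m v = E f x k (p + 1) m v"
  by (simp add: E_def expand_def algebra_simps)

lemma field_shift: "field f \<Longrightarrow> field (\<lambda>n. f (n + 1))"
  unfolding field_def by (metis add.commute add_increasing zero_le_one)

text \<open>Both sides are the triple product in the order \<open>x c y\<close>, with \<open>(x - z)\<^sup>p\<close> and \<open>(z - y)\<^sup>m\<close>.\<close>

lemma E_assoc:
  assumes f: "field x" "field c" "field y" and v: "v \<in> U"
  shows "E x (\<lambda>n. E c y m n j) p i n v = E (\<lambda>n. E x c p i n) y m n j v"
proof -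
  let ?H = "\<lambda>m n j. E x (\<lambda>n. E c y m n j) p i n v - E (\<lambda>n. E x c p i n) y m n j v"
  note cy = field_E(2)[OF f(2,3)] and xc = field_E(1)[OF f(1,2)]
  have "?H m n j = 0"
  proof (rule expand_unique[where e="-1" and H="?H"])
    fix m n j
    have "E x (\<lambda>n. E c y (m + 1) n j) p i n v
      = E x (\<lambda>n v. E c y m (n + 1) j v - scale 1 (E c y m n (j + 1) v)) p i n v"
      by (rule expand_cong_field) (simp add: E_Suc f v)
    also have "\<dots> = E x (\<lambda>n. E c y m n j) p i (n + 1) v - E x (\<lambda>n. E c y m n (j + 1)) p i n v"
      using E_comb_right[OF f(1) field_shift[OF cy] cy v, of m j 1 m "j + 1" p i n]
        E_shift_right[of x "\<lambda>n. E c y m n j" p i n v] by simp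
    finally show "?H (m + 1) n j = ?H m (n + 1) j + scale (- 1) (?H m n (j + 1))"
      by (simp add: E_Suc[OF xc f(3) v])
  next
    fix n j show "?H 0 n j = 0" by (simp add: E_def)
  next
    fix m
    obtain j0 where j0: "\<forall>k p. \<forall>j\<ge>j0. E c y k p j v = 0" using E_trunc[OF f(2,3) v] by blast
    obtain j1 where j1: "\<forall>k n. \<forall>j\<ge>j1. E (\<lambda>n. E x c p i n) y k n j v = 0" using E_trunc[OF xc f(3) v] by blast
    have "E x (\<lambda>n. E c y m n j) p i n v = 0" if "j \<ge> j0" for n j
      using j0 that f(1) by (simp add: E_def[of x] expand_def)
    then show "\<exists>j0. \<forall>n. \<forall>j\<ge>j0. ?H m n j = 0"
      using j1 by (intro exI[of _ "max j0 j1"]) simp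
  qed
  then show ?thesis by simp
qed


lemma nabla_pow_comb:
  "(nabla ^^ K) (\<lambda>i j. f i j - scale c (g i j)) = (\<lambda>i j. (nabla ^^ K) f i j - scale c ((nabla ^^ K) g i j))"
  by (induction K) (auto simp: nabla_def fun_eq_iff scale_right_diff_distrib)

lemma nabla_pow_shift:
  "(nabla ^^ K) (\<lambda>i j. f (i + 1) j) i j = (nabla ^^ K) f (i + 1) j"
  "(nabla ^^ K) (\<lambda>i j. f i (j + 1)) i j = (nabla ^^ K) f i (j + 1)"
  by (induction K arbitrary: i j) (simp_all add: nabla_def)

lemma nabla_pow_trunc:
  assumes "\<And>i. \<exists>j0::int. \<forall>j\<ge>j0. \<forall>n. f n i j = 0"
  shows "\<exists>j0. \<forall>j\<ge>j0. \<forall>n. (nabla ^^ K) (f n) i j = 0"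
proof (induction K arbitrary: i)
  case (Suc K)
  obtain j0 j1 where "\<forall>j\<ge>j0. \<forall>n. (nabla ^^ K) (f n) i j = 0" "\<forall>j\<ge>j1. \<forall>n. (nabla ^^ K) (f n) (i + 1) j = 0"
    using Suc by metis
  then show ?case by (intro exI[of _ "max j0 j1"]) (simp add: nabla_def[of "(nabla ^^ K) (f n)" for n])
qed (simp add: assms)

lemma nabla_pow_trunc':
  assumes "\<And>j. \<exists>i0::int. \<forall>i\<ge>i0. \<forall>n. f n i j = 0"
  shows "\<exists>i0. \<forall>i\<ge>i0. \<forall>n. (nabla ^^ K) (f n) i j = 0"
proof (induction K arbitrary: j)
  case (Suc K)
  obtain j0 j1 where "\<forall>i\<ge>j0. \<forall>n. (nabla ^^ K) (f n) i j = 0" "\<forall>i\<ge>j1. \<forall>n. (nabla ^^ K) (f n) i (j + 1) = 0"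
    using Suc by metis
  then show ?case by (intro exI[of _ "max j0 j1"]) (simp add: nabla_def[of "(nabla ^^ K) (f n)" for n])
qed (simp add: assms)

lemma nabla_pow_trunc2:
  assumes "\<forall>n\<ge>n0. \<forall>i j. f n i j = 0" "n \<ge> (n0::int)"
  shows "(nabla ^^ K) (f n) i j = 0"
proof -
  have "f n = (\<lambda>i j. 0)" using assms by (simp add: fun_eq_iff)
  then show ?thesis by (simp add: nabla_zero)
qed

text \<open>Triple products with \<open>c\<close> innermost, respectively outermost.\<close>

definition xyc where
  "xyc x y c p m i j n v = E x (\<lambda>n. E y c m j n) p i n v"

definition cyx where
  "cyx x y c p m i j n v = E (\<lambda>n. E c y m n j) x p n i v"

lemma xyc_Suc:
  assumes f: "field x" "field y" "field c" and v: "v \<in> U"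
  shows "xyc x y c (p + 1) m i j n v = xyc x y c p m (i + 1) j n v - xyc x y c p m i j (n + 1) v"
    and "xyc x y c p (m + 1) i j n v = xyc x y c p m i (j + 1) n v - xyc x y c p m i j (n + 1) v"
proof -
  note yc = field_E(1)[OF f(2,3)]
  show "xyc x y c (p + 1) m i j n v = xyc x y c p m (i + 1) j n v - xyc x y c p m i j (n + 1) v"
    unfolding xyc_def by (simp add: E_Suc f yc v)
  have "xyc x y c p (m + 1) i j n v = E x (\<lambda>n v. E y c m (j + 1) n v - scale 1 (E y c m j (n + 1) v)) p i n v"
    unfolding xyc_def by (rule expand_cong_field) (simp add: E_Suc f v)
  then show "xyc x y c p (m + 1) i j n v = xyc x y c p m i (j + 1) n v - xyc x y c p m i j (n + 1) v"
    using E_comb_right[OF f(1) yc field_shift[OF yc] v, of m "j + 1" 1 m j p i n]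
      E_shift_right[of x "\<lambda>n. E y c m j n" p i n v] by (simp add: xyc_def)
qed

lemma cyx_Suc:
  assumes f: "field x" "field y" "field c" and v: "v \<in> U"
  shows "cyx x y c (p + 1) m i j n v = cyx x y c p m i j (n + 1) v - cyx x y c p m (i + 1) j n v"
    and "cyx x y c p (m + 1) i j n v = cyx x y c p m i j (n + 1) v - cyx x y c p m i (j + 1) n v"
proof -
  note cy = field_E(2)[OF f(3,2)]
  show "cyx x y c (p + 1) m i j n v = cyx x y c p m i j (n + 1) v - cyx x y c p m (i + 1) j n v"
    unfolding cyx_def by (simp add: E_Suc f cy v)
  have "cyx x y c p (m + 1) i j n v = E (\<lambda>n v. E c y m (n + 1) j v - scale 1 (E c y m n (j + 1) v)) x p n i v"
    unfolding cyx_def E_def[of _ x] by (simp add: E_Suc f v)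
  then show "cyx x y c p (m + 1) i j n v = cyx x y c p m i j (n + 1) v - cyx x y c p m i (j + 1) n v"
    using E_comb_left[OF f(1) field_shift[OF cy] cy v, of m j 1 m "j + 1" p n i]
      E_shift_left[of "\<lambda>n. E c y m n j" x p n i v] by (simp add: cyx_def)
qed

text \<open>For trivial exponents this is the locality of \<open>x\<close> and \<open>y\<close> applied to \<open>c\<^sub>(\<^sub>n\<^sub>) v\<close>; the powers
  \<open>(x - z)\<^sup>p (y - z)\<^sup>m\<close> are brought in one after the other by uniqueness.\<close>

lemma xyc_local:
  assumes f: "field x" "field y" "field c" and v: "v \<in> U"
    and K: "\<And>p m v. v \<in> U \<Longrightarrow> R \<sigma> x y (int K) p m v = 0"
  shows "(nabla ^^ K) (\<lambda>i j. xyc x y c p m i j n v - scale \<sigma> (xyc y x c m p j i n v)) i j = 0"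
proof -
  define W where "W = (\<lambda>p m n i j. xyc x y c p m i j n v - scale \<sigma> (xyc y x c m p j i n v))"
  have rec_p: "W (p + 1) m n = (\<lambda>i j. W p m n (i + 1) j - scale 1 (W p m (n + 1) i j))" for p m n
    by (simp add: W_def fun_eq_iff xyc_Suc f v) (simp add: algebra_simps)
  have rec_m: "W p (m + 1) n = (\<lambda>i j. W p m n i (j + 1) - scale 1 (W p m (n + 1) i j))" for p m n
    by (simp add: W_def fun_eq_iff xyc_Suc f v) (simp add: algebra_simps)
  have tr: "\<exists>n0. \<forall>n\<ge>n0. \<forall>i j. W p m n i j = 0" for p m
  proof -
    obtain n0 where n0: "\<forall>k p. \<forall>n\<ge>n0. E y c k p n v = 0" using E_trunc[OF f(2,3) v] by blast
    obtain n1 where n1: "\<forall>k p. \<forall>n\<ge>n1. E x c k p n v = 0" using E_trunc[OF f(1,3) v] by blast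
    have "xyc x y c p m i j n v = 0" if "n \<ge> n0" for i j n
      unfolding xyc_def E_def[of x] by (rule expand_trunc[of n0]) (use n0 that f in auto)
    moreover have "xyc y x c m p j i n v = 0" if "n \<ge> n1" for i j n
      unfolding xyc_def E_def[of y] by (rule expand_trunc[of n1]) (use n1 that f in auto)
    ultimately show ?thesis by (intro exI[of _ "max n0 n1"]) (simp add: W_def)
  qed
  have trN: "\<exists>n0. \<forall>i. \<forall>n\<ge>n0. (nabla ^^ K) (W p m n) i j = 0"
    "\<exists>n0. \<forall>j. \<forall>n\<ge>n0. (nabla ^^ K) (W p m n) i j = 0" for p m i j
    using tr[of p m] nabla_pow_trunc2[of _ "W p m"] by metis+
  have b0: "(nabla ^^ K) (W 0 0 n) i j = 0" for n i j
    using R_nabla[OF f(1,2) field_in_U[OF f(3) v], of \<sigma> 0 K i j] K v f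
    by (simp add: W_def xyc_def R_0)
  have b1: "(nabla ^^ K) (W 0 m n) i j = 0" for m n i j
  proof (rule expand_unique[where e="-1" and H="\<lambda>m j n. (nabla ^^ K) (W 0 m n) i j"])
    fix m j n
    show "(nabla ^^ K) (W 0 (m + 1) n) i j = (nabla ^^ K) (W 0 m n) i (j + 1) + scale (- 1) ((nabla ^^ K) (W 0 m (n + 1)) i j)"
      unfolding rec_m nabla_pow_comb nabla_pow_shift by simp
  qed (simp_all add: b0 trN)
  have "(nabla ^^ K) (W p m n) i j = 0" for i
  proof (rule expand_unique[where e="-1" and H="\<lambda>p i n. (nabla ^^ K) (W p m n) i j"])
    fix p i n
    show "(nabla ^^ K) (W (p + 1) m n) i j = (nabla ^^ K) (W p m n) (i + 1) j + scale (- 1) ((nabla ^^ K) (W p m (n + 1)) i j)"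
      unfolding rec_p nabla_pow_comb nabla_pow_shift by simp
  qed (simp_all add: b1 trN)
  then show ?thesis by (simp add: W_def)
qed

text \<open>The same with \<open>c\<close> applied last.  Here the truncation in \<open>i\<close> depends on \<open>j\<close>, and conversely; it
  suffices that finitely many values of the other index occur at a time.\<close>

lemma cyx_local:
  assumes f: "field x" "field y" "field c" and v: "v \<in> U"
    and K: "\<And>p m v. v \<in> U \<Longrightarrow> R \<sigma> x y (int K) p m v = 0"
  shows "(nabla ^^ K) (\<lambda>i j. cyx y x c m p j i n v - scale \<sigma> (cyx x y c p m i j n v)) i j = 0"
proof -
  define W where "W = (\<lambda>p m n i j. cyx y x c m p j i n v - scale \<sigma> (cyx x y c p m i j n v))"
  have rec_p: "W (p + 1) m n = (\<lambda>i j. W p m (n + 1) i j - scale 1 (W p m n (i + 1) j))" for p m n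
    by (simp add: W_def fun_eq_iff cyx_Suc f v) (simp add: algebra_simps)
  have rec_m: "W p (m + 1) n = (\<lambda>i j. W p m (n + 1) i j - scale 1 (W p m n i (j + 1)))" for p m n
    by (simp add: W_def fun_eq_iff cyx_Suc f v) (simp add: algebra_simps)
  note cy = field_E(2)[OF f(3,2)] and cx = field_E(2)[OF f(3,1)]
  have cyx_trunc: "\<exists>i0. \<forall>i\<ge>i0. \<forall>n. cyx x y c p m i j n v = 0"
    if xy: "field x" "field y" for x y p m j
  proof -
    obtain i0 where "\<forall>i\<ge>i0. x i v = 0" using fieldD(2) xy v by blast
    then have i0: "\<forall>n. \<forall>i\<ge>i0. E c y m n j (x i v) = 0"
      using lin_0[OF E_lin[OF f(3) xy(2)]] by simp
    have "cyx x y c p m i j n v = 0" if "i \<ge> i0" for i n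
      unfolding cyx_def E_def[of _ x] by (rule expand_trunc[OF i0 that])
    then show ?thesis by blast
  qed
  have cyx_trunc': "\<exists>j0. \<forall>j\<ge>j0. \<forall>n. cyx x y c p m i j n v = 0"
    if xy: "field x" "field y" for x y p m i
  proof -
    define g where "g = (\<lambda>j n i. E c y m n j (x i v))"
    obtain i0 where "\<forall>i\<ge>i0. x i v = 0" using fieldD(2) xy v by blast
    then have i0: "\<forall>n. \<forall>i\<ge>i0. g j n i = 0" for j
      using lin_0[OF E_lin[OF f(3) xy(2)]] by (simp add: g_def)
    have "\<exists>r0. \<forall>r\<ge>r0. \<forall>n. g r n (i + int s) = 0" for s
      using E_trunc[OF f(3) xy(2) field_in_U[OF xy(1) v], of "i + int s"] unfolding g_def by blast
    then have "\<exists>r0. \<forall>r\<ge>r0. \<forall>s<nat (i0 - i). \<forall>n. g r n (i + int s) = 0"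
      by (rule ex_common_bound)
    then obtain J where J: "\<And>j s n. j \<ge> J \<Longrightarrow> s < nat (i0 - i) \<Longrightarrow> g j n (i + int s) = 0" by blast
    have "cyx x y c p m i j n v = 0" if "j \<ge> J" for j n
    proof -
      have "cyx x y c p m i j n v = expand (-1) (g j) p n i"
        by (simp add: cyx_def E_def[of _ x] g_def)
      also have "\<dots> = (\<Sum>s<nat (i0 - i). scale ((-1) ^ s * (of_int p gchoose s)) (g j (n + p - int s) (i + int s)))"
        by (rule expand_eq_sum_ge[OF i0 order_refl])
      also have "\<dots> = 0" using J[OF that] by simp
      finally show ?thesis .
    qed
    then show ?thesis by blast
  qed
  have trN_i: "\<exists>i0. \<forall>n. \<forall>i\<ge>i0. (nabla ^^ K) (W p m n) i j = 0"
    and trN_j: "\<exists>j0. \<forall>n. \<forall>j\<ge>j0. (nabla ^^ K) (W p m n) i j = 0" for p m i j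
  proof -
    have "\<exists>i0. \<forall>i\<ge>i0. \<forall>n. W p m n i j = 0" for j
    proof -
      obtain i0 i1 where "\<forall>i\<ge>i0. \<forall>n. cyx x y c p m i j n v = 0" "\<forall>i\<ge>i1. \<forall>n. cyx y x c m p j i n v = 0"
        using cyx_trunc[OF f(1,2)] cyx_trunc'[OF f(2,1)] by metis
      then show ?thesis by (intro exI[of _ "max i0 i1"]) (simp add: W_def)
    qed
    then have "\<exists>i0. \<forall>i\<ge>i0. \<forall>n. (nabla ^^ K) (W p m n) i j = 0" by (rule nabla_pow_trunc')
    then show "\<exists>i0. \<forall>n. \<forall>i\<ge>i0. (nabla ^^ K) (W p m n) i j = 0" by blast
    have "\<exists>j0. \<forall>j\<ge>j0. \<forall>n. W p m n i j = 0" for i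
    proof -
      obtain i0 i1 where "\<forall>j\<ge>i0. \<forall>n. cyx x y c p m i j n v = 0" "\<forall>j\<ge>i1. \<forall>n. cyx y x c m p j i n v = 0"
        using cyx_trunc[OF f(2,1)] cyx_trunc'[OF f(1,2)] by metis
      then show ?thesis by (intro exI[of _ "max i0 i1"]) (simp add: W_def)
    qed
    then have "\<exists>j0. \<forall>j\<ge>j0. \<forall>n. (nabla ^^ K) (W p m n) i j = 0" by (rule nabla_pow_trunc)
    then show "\<exists>j0. \<forall>n. \<forall>j\<ge>j0. (nabla ^^ K) (W p m n) i j = 0" by blast
  qed
  have b0: "(nabla ^^ K) (W 0 0 n) i j = 0" for n i j
  proof -
    have "W 0 0 n = (\<lambda>i j. c n (R \<sigma> x y 0 i j v))"
      using f v by (simp add: W_def cyx_def R_0 fun_eq_iff lin_diff[OF fieldD(1)] linD(3)[OF fieldD(1)])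
    moreover have "(nabla ^^ L) (\<lambda>i j. c n (h i j)) = (\<lambda>i j. c n ((nabla ^^ L) h i j)) \<and> (\<forall>i j. (nabla ^^ L) h i j \<in> U)"
      if "\<And>i j. h i j \<in> U" for h L
      by (induction L) (simp_all add: that nabla_def lin_diff[OF fieldD(1)[OF f(3)]])
    ultimately show ?thesis
      using R_nabla[OF f(1,2) v, of \<sigma> 0 K i j] K v f by simp
  qed
  have b1: "(nabla ^^ K) (W 0 m n) i j = 0" for m n i j
  proof (rule expand_unique[where e="-1" and H="\<lambda>m n j. (nabla ^^ K) (W 0 m n) i j"])
    fix m n j
    show "(nabla ^^ K) (W 0 (m + 1) n) i j = (nabla ^^ K) (W 0 m (n + 1)) i j + scale (- 1) ((nabla ^^ K) (W 0 m n) i (j + 1))"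
      unfolding rec_m nabla_pow_comb nabla_pow_shift by simp
  qed (simp_all add: b0 trN_j)
  have "(nabla ^^ K) (W p m n) i j = 0" for i
  proof (rule expand_unique[where e="-1" and H="\<lambda>p n i. (nabla ^^ K) (W p m n) i j"])
    fix p n i
    show "(nabla ^^ K) (W (p + 1) m n) i j = (nabla ^^ K) (W p m (n + 1)) i j + scale (- 1) ((nabla ^^ K) (W p m n) (i + 1) j)"
      unfolding rec_p nabla_pow_comb nabla_pow_shift by simp
  qed (simp_all add: b1 trN_i)
  then show ?thesis by (simp add: W_def)
qed

lemma R_comb_right:
  assumes "field x" "field f" "field g" "v \<in> U"
  shows "R s x (\<lambda>n v. f n v - scale c (g n v)) k p m v = R s x f k p m v - scale c (R s x g k p m v)"
  unfolding R_def E_comb_left[OF assms] E_comb_right[OF assms] by (simp add: algebra_simps)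

lemma R_comb_left:
  assumes "field x" "field f" "field g" "v \<in> U"
  shows "R s (\<lambda>n v. f n v - scale c (g n v)) x k p m v = R s f x k p m v - scale c (R s g x k p m v)"
  unfolding R_def E_comb_left[OF assms] E_comb_right[OF assms] by (simp add: algebra_simps)

lemma R_shift_right: "R s x (\<lambda>n. f (n + 1)) k p m v = R s x f k p (m + 1) v"
  by (simp only: R_def E_shift_left E_shift_right)

lemma R_cong_right: "(\<And>n v. v \<in> U \<Longrightarrow> f n v = g n v) \<Longrightarrow> field x \<Longrightarrow> v \<in> U \<Longrightarrow> R s x f k p m v = R s x g k p m v"
  by (simp add: R_def E_def)

text \<open>Locality of two fields passes to their left multiplications on the algebra of fields.  By the
  Jacobi identity \<open>[x, [y, c]] - \<sigma> [y, [x, c]]\<close> only contains \<open>[x, y]\<close> to the left or to the right of \<open>c\<close>: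
  with the exponents present, the terms in the orders \<open>x c y\<close> and \<open>y c x\<close> cancel by \<open>E_assoc\<close>.\<close>

lemma prd_local:
  assumes f: "field x" "field y" "field c" and v: "v \<in> U"
    and s: "\<sigma> * \<sigma> = 1"
    and K: "\<And>p m v. v \<in> U \<Longrightarrow> R \<sigma> x y (int K) p m v = 0"
  shows "(nabla ^^ K) (\<lambda>p m. prd (\<sigma> * \<sigma>x) p x (prd \<sigma>y m y c) n v
     - scale \<sigma> (prd (\<sigma> * \<sigma>y) m y (prd \<sigma>x p x c) n v)) p m = 0"
proof -
  define G where "G = (\<lambda>p m i j n. R (\<sigma> * \<sigma>x) x (\<lambda>n. R \<sigma>y y c m j n) p i n v
     - scale \<sigma> (R (\<sigma> * \<sigma>y) y (\<lambda>n. R \<sigma>x x c p i n) m j n v))"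
  have F: "R s x (\<lambda>n. R t y c m j n) p i n v =
      xyc x y c p m i j n v - scale (t * (-1) powi m) (E x (\<lambda>n. E c y m n j) p i n v)
      - scale (s * (-1) powi p) (E (\<lambda>n. E y c m j n) x p n i v
          - scale (t * (-1) powi m) (cyx x y c p m i j n v))"
    if xy: "field x" "field y" for s t x y p m i j n
  proof -
    note yc = field_E(1)[OF xy(2) f(3), of m j] and cy = field_E(2)[OF f(3) xy(2), of m j]
    show ?thesis
      unfolding R_def[of s] unfolding R_def[of t, abs_def]
      by (simp only: E_comb_left[OF xy(1) yc cy v] E_comb_right[OF xy(1) yc cy v] xyc_def cyx_def)
  qed
  have decomp: "G p m i j n = (xyc x y c p m i j n v - scale \<sigma> (xyc y x c m p j i n v))
      - scale (\<sigma>x * \<sigma>y * (-1) powi p * (-1) powi m) (cyx y x c m p j i n v - scale \<sigma> (cyx x y c p m i j n v))"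
    for p m i j n
  proof -
    have gen: "(X - scale ty A - scale sx (B - scale ty C1)) - scale \<sigma> (X' - scale tx B - scale sy (A - scale tx C2))
        = (X - scale \<sigma> X') - scale \<kappa> (C2 - scale \<sigma> C1)"
      if "\<sigma> * tx = sx" "\<sigma> * sy = ty" "sx * ty = \<kappa> * \<sigma>" "\<sigma> * (sy * tx) = \<kappa>"
      for X X' A B C1 C2 tx ty sx sy \<kappa>
      by (simp only: scale_right_diff_distrib scale_scale that) simp
    have a1: "E x (\<lambda>n. E c y m n j) p i n v = E (\<lambda>n. E x c p i n) y m n j v"
      by (rule E_assoc[OF f(1,3,2) v])
    have a2: "E y (\<lambda>n. E c x p n i) m j n v = E (\<lambda>n. E y c m j n) x p n i v"
      by (rule E_assoc[OF f(2,3,1) v])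
    show ?thesis
      unfolding G_def F[OF f(1,2)] F[OF f(2,1)] a1 a2
    proof (rule gen)
      show "\<sigma> * (\<sigma>x * (- 1) powi p) = \<sigma> * \<sigma>x * (- 1) powi p" by simp
      have s2: "\<sigma> * (\<sigma> * z) = z" for z using s by (simp add: mult.assoc[symmetric])
      show "\<sigma> * (\<sigma> * \<sigma>y * (- 1) powi m) = \<sigma>y * (- 1) powi m" by (simp add: mult.assoc s2)
      show "\<sigma> * \<sigma>x * (- 1) powi p * (\<sigma>y * (- 1) powi m) = \<sigma>x * \<sigma>y * (- 1) powi p * (- 1) powi m * \<sigma>"
        by (simp add: ac_simps)
      have "\<sigma> * (\<sigma> * \<sigma>y * (- 1) powi m * (\<sigma>x * (- 1) powi p)) = \<sigma> * (\<sigma> * (\<sigma>y * (- 1) powi m * (\<sigma>x * (- 1) powi p)))"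
        by (simp only: mult.assoc)
      then show "\<sigma> * (\<sigma> * \<sigma>y * (- 1) powi m * (\<sigma>x * (- 1) powi p)) = \<sigma>x * \<sigma>y * (- 1) powi p * (- 1) powi m"
        by (simp only: s2) (simp add: ac_simps)
    qed
  qed
  have nG: "(nabla ^^ K) (\<lambda>i j. G p m i j n) i j = 0" for p m i j n
    unfolding decomp nabla_pow_comb using xyc_local[OF f v K] cyx_local[OF f v K]
    by (simp add: nabla_pow_comb)
  have RR: "R s x (\<lambda>n. R t y c m j n) (p + 1) i n v = R s x (\<lambda>n. R t y c m j n) p (i + 1) n v
        - R s x (\<lambda>n. R t y c m j n) p i (n + 1) v"
      "R s x (\<lambda>n. R t y c (m + 1) j n) p i n v = R s x (\<lambda>n. R t y c m (j + 1) n) p i n v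
        - R s x (\<lambda>n. R t y c m j n) p i (n + 1) v"
    if xy: "field x" "field y" for s t x y p m i j n
  proof -
    note yc = field_R[OF xy(2) f(3)]
    show "R s x (\<lambda>n. R t y c m j n) (p + 1) i n v = R s x (\<lambda>n. R t y c m j n) p (i + 1) n v
        - R s x (\<lambda>n. R t y c m j n) p i (n + 1) v"
      by (rule R_Suc[OF xy(1) yc v])
    have "R s x (\<lambda>n. R t y c (m + 1) j n) p i n v
      = R s x (\<lambda>n v. R t y c m (j + 1) n v - scale 1 (R t y c m j (n + 1) v)) p i n v"
      by (rule R_cong_right) (simp_all add: R_Suc xy f v)
    then show "R s x (\<lambda>n. R t y c (m + 1) j n) p i n v = R s x (\<lambda>n. R t y c m (j + 1) n) p i n v
        - R s x (\<lambda>n. R t y c m j n) p i (n + 1) v"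
      using R_comb_right[OF xy(1) yc field_shift[OF yc] v, of s t m "j + 1" 1 t m j p i n]
        R_shift_right[of s x "\<lambda>n. R t y c m j n" p i n v] by simp
  qed
  have step: "G (p + 1) m i j n - G p (m + 1) i j n = G p m (i + 1) j n - scale 1 (G p m i (j + 1) n)" for p m i j n
    unfolding G_def by (simp only: RR f) (simp add: algebra_simps)
  \<comment> \<open>As \<open>(x - z) - (y - z) = x - y\<close>, a difference in the exponents is a difference in the indices.\<close>
  have swap: "(nabla ^^ L) (\<lambda>p m. G p m i j n) p m = (nabla ^^ L) (\<lambda>i j. G p m i j n) i j" for L p m i j
  proof (induction L arbitrary: p m i j)
    case (Suc L)
    have "(nabla ^^ Suc L) (\<lambda>p m. G p m i j n) = (nabla ^^ L) (nabla (\<lambda>p m. G p m i j n))"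
      by (simp only: funpow_Suc_right o_apply)
    also have "nabla (\<lambda>p m. G p m i j n) = (\<lambda>p m. G p m (i + 1) j n - scale 1 (G p m i (j + 1) n))"
      by (simp add: nabla_def step)
    finally have "(nabla ^^ Suc L) (\<lambda>p m. G p m i j n) p m
      = (nabla ^^ L) (\<lambda>i j. G p m i j n) (i + 1) j - (nabla ^^ L) (\<lambda>i j. G p m i j n) i (j + 1)"
      by (simp only: nabla_pow_comb Suc.IH) simp
    then show ?case by (simp add: nabla_def[of "(nabla ^^ L) f" for f])
  qed simp
  show ?thesis using swap[of K 0 0 p m] nG[of p m n 0 0] by (simp add: G_def prd_def)
qed

lemma locality_coeff_iff:
  assumes sc: "vscale A = scale" and f: "field (\<lambda>n. vprod A n a)" "field (\<lambda>n. vprod A n b)" and c: "c \<in> U"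
  shows "locality_coeff_wz A M a b m n c = vscale A \<sigma> (locality_coeff_zw A M a b m n c) \<longleftrightarrow>
    R \<sigma> (\<lambda>n. vprod A n a) (\<lambda>n. vprod A n b) M m n c = 0"
proof -
  have wz: "locality_coeff_wz A M a b m n c = E (\<lambda>n. vprod A n a) (\<lambda>n. vprod A n b) M m n c"
    by (simp add: locality_coeff_wz_def E_def expand_def mult.commute sc)
  have pw: "(-1 :: 'k) powi (M - int s) = (-1) ^ s * (-1) powi M" for s
    by (simp add: power_int_diff) (simp add: divide_inverse power_inverse[symmetric] mult.commute)
  have "locality_coeff_zw A M a b m n c
      = expand (-1) (\<lambda>i j. scale ((-1) powi M) (vprod A i b (vprod A j a c))) M n m"
    by (simp add: locality_coeff_zw_def expand_def pw ac_simps sc)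
  also have "\<dots> = scale ((-1) powi M) (E (\<lambda>n. vprod A n b) (\<lambda>n. vprod A n a) M n m c)"
    unfolding E_def by (rule expand_scale) (rule comp_trunc[OF f(2,1) c])
  finally show ?thesis by (simp add: R_def wz sc)
qed

end

section \<open>The associativity formula in a vertex algebra\<close>

lemma koszul_commute: "koszul_sign p q = koszul_sign q p"
  by (auto simp: koszul_sign_def)

lemma koszul_sq [simp]: "koszul_sign p q * koszul_sign p q = (1 :: 'k::field_char_0)"
  by (simp add: koszul_sign_def)

lemma koszul_add_left: "koszul_sign (p + q) r = (koszul_sign p r * koszul_sign q r :: 'k::field_char_0)"
  by (cases p; cases q; cases r) (auto simp: koszul_sign_def)

context vertex_algebra
begin

lemma part_0: "0 \<in> vpart A p"
  using subspace_0[OF subspace_part] .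

lemma part_carrier: "x \<in> vpart A p \<Longrightarrow> x \<in> carrier A"
  unfolding carrier_def using part_0[of 0] part_0[of 1] by (cases p) force+

lemma carrierE:
  assumes "x \<in> carrier A"
  obtains x0 x1 where "x0 \<in> vpart A 0" "x1 \<in> vpart A 1" "x = x0 + x1"
  using assms unfolding carrier_def by blast

lemma subspace_carrier: "subspace (carrier A)"
  unfolding carrier_def using subspace_sums[OF subspace_part subspace_part] by simp

end

sublocale vertex_algebra \<subseteq> field_space "vscale A" "carrier A"
  by unfold_locales (rule subspace_carrier)

context vertex_algebra
begin

abbreviation Y :: "'v \<Rightarrow> int \<Rightarrow> 'v \<Rightarrow> 'v" where
  "Y a \<equiv> \<lambda>n. vprod A n a"

lemma vac_carrier [simp]: "vac A \<in> carrier A"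
  using vac_even part_carrier by blast

lemma prod_carrier [simp]: "a \<in> carrier A \<Longrightarrow> b \<in> carrier A \<Longrightarrow> vprod A n a b \<in> carrier A"
proof -
  assume a: "a \<in> carrier A" and b: "b \<in> carrier A"
  obtain a0 a1 where a': "a0 \<in> vpart A 0" "a1 \<in> vpart A 1" "a = a0 + a1" using a by (rule carrierE)
  obtain b0 b1 where b': "b0 \<in> vpart A 0" "b1 \<in> vpart A 1" "b = b0 + b1" using b by (rule carrierE)
  note c = a'(1,2)[THEN part_carrier] b'(1,2)[THEN part_carrier]
  have "vprod A n a b = vprod A n a0 b0 + vprod A n a1 b0 + (vprod A n a0 b1 + vprod A n a1 b1)"
    unfolding a'(3) b'(3) using c by (simp add: prod_add_left prod_add_right)
  moreover have "vprod A n a0 b0 \<in> carrier A" "vprod A n a1 b0 \<in> carrier A" "vprod A n a0 b1 \<in> carrier A" "vprod A n a1 b1 \<in> carrier A"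
    using prod_parity[OF a'(1) b'(1)] prod_parity[OF a'(2) b'(1)] prod_parity[OF a'(1) b'(2)] prod_parity[OF a'(2) b'(2)]
      part_carrier by blast+
  ultimately show ?thesis by simp
qed

lemma field_Y: "a \<in> carrier A \<Longrightarrow> field (Y a)"
  unfolding field_def lin_def by (simp add: prod_add_right prod_scale_right truncation)

lemma local_Y:
  assumes "a \<in> vpart A p" "b \<in> vpart A q"
  shows "local (koszul_sign p q) (Y a) (Y b)"
proof -
  obtain M where M: "\<And>m n c. c \<in> carrier A \<Longrightarrow>
      locality_coeff_wz A M a b m n c = vscale A (koszul_sign p q) (locality_coeff_zw A M a b m n c)"
    using locality[OF assms] by blast
  note f = field_Y[OF part_carrier[OF assms(1)]] field_Y[OF part_carrier[OF assms(2)]]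
  have "R (koszul_sign p q) (Y a) (Y b) M m n c = 0" if c: "c \<in> carrier A" for m n c
    using locality_coeff_iff[OF refl f c] M[OF c] by blast
  then show ?thesis using localI[OF f] by blast
qed

lemma D_lin: "lin (D A)"
  unfolding lin_def D_def by (simp add: prod_add_left prod_scale_left)

lemma D_vac: "D A (vac A) = 0"
  by (simp add: D_def vac_left)

lemma Y_covariant: "a \<in> carrier A \<Longrightarrow> v \<in> carrier A \<Longrightarrow> D A (Y a n v) = Y a n (D A v) + deriv (Y a) n v"
  by (simp add: D_right deriv_def)

lemma vac_right_m1: "a \<in> carrier A \<Longrightarrow> vprod A (-1) a (vac A) = a"
  by (simp add: vac_right_neg divided_D_def)

lemma divided_D_Suc:
  assumes "x \<in> carrier A"
  shows "divided_D (Suc j) A x = vscale A (1 / of_nat (Suc j)) (D A (divided_D j A x))"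
proof -
  have "(D A ^^ j) x \<in> carrier A" for j
    by (induction j) (simp_all add: assms linD(1)[OF D_lin])
  then show ?thesis by (simp add: divided_D_def linD(3)[OF D_lin] del: of_nat_Suc)
qed

lemma E_vac:
  assumes "field f" "c \<in> carrier A"
  shows "E f (Y c) k p (-1) (vac A) = f (p + k) c"
proof -
  have "E f (Y c) k p (-1) (vac A) = (\<Sum>s<1. vscale A ((-1) ^ s * (of_int k gchoose s)) (f (p + k - int s) (vprod A (-1 + int s) c (vac A))))"
    unfolding E_def by (rule expand_eq_sum) (use assms in \<open>simp add: vac_right_nonneg\<close>)
  then show ?thesis by (simp add: vac_right_m1 assms)
qed

text \<open>For \<open>m = -1\<close> a single term of the product survives on the vacuum.  Covariance under \<open>D\<close> relates the
  values at \<open>m\<close> and \<open>m - 1\<close>, in the same way as for the field of \<open>a\<^sub>(\<^sub>k\<^sub>)b\<close>.\<close>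

lemma prd_creation:
  assumes a: "a \<in> carrier A" and b: "b \<in> carrier A"
  shows "prd \<sigma> k (Y a) (Y b) m (vac A) = vprod A m (vprod A k a b) (vac A)"
proof -
  note f = field_Y[OF a] field_Y[OF b]
  have ba: "E (Y b) (Y a) k m 0 (vac A) = 0" for m
    unfolding E_def by (rule expand_trunc[of 0]) (use a b lin_0[OF fieldD(1)[OF f(2)]] in \<open>auto simp: vac_right_nonneg\<close>)
  then have eq: "prd \<sigma> k (Y a) (Y b) m (vac A) = E (Y a) (Y b) k 0 m (vac A)" for m
    by (simp add: prd_def R_def)
  have ab: "vprod A k a b \<in> carrier A" using a b by simp
  show ?thesis
  proof (cases "m \<ge> 0")
    case True
    then have "E (Y a) (Y b) k 0 m (vac A) = 0"
      unfolding E_def by (intro expand_trunc[of 0]) (use a b lin_0[OF fieldD(1)[OF f(1)]] in \<open>auto simp: vac_right_nonneg\<close>)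
    then show ?thesis using True eq ab by (simp add: vac_right_nonneg)
  next
    case False
    have "prd \<sigma> k (Y a) (Y b) (- 1 - int j) (vac A) = divided_D j A (vprod A k a b)" for j
    proof (induction j)
      case 0
      show ?case using E_vac[OF f(1) b, of k 0] by (simp add: eq divided_D_def)
    next
      case (Suc j)
      let ?m = "- 1 - int j"
      have "D A (R \<sigma> (Y a) (Y b) k 0 ?m (vac A)) = - vscale A (of_int ?m) (R \<sigma> (Y a) (Y b) k 0 (?m - 1) (vac A))"
        using R_covariant[OF f vac_carrier D_lin, of \<sigma> k 0 ?m] Y_covariant a b
          lin_0[OF R_lin[OF f]] by (simp add: D_vac)
      then have d: "D A (divided_D j A (vprod A k a b)) = vscale A (of_nat (Suc j)) (prd \<sigma> k (Y a) (Y b) (?m - 1) (vac A))"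
        using Suc by (simp add: prd_def scale_minus_left[symmetric] del: scale_minus_left)
      have m: "?m - 1 = - 1 - int (Suc j)" by simp
      show ?case unfolding divided_D_Suc[OF ab] d m by (simp del: of_nat_Suc)
    qed
    from this[of "nat (- m - 1)"] show ?thesis using False ab by (simp add: vac_right_neg)
  qed
qed

text \<open>Goddard's uniqueness argument: the field \<open>a\<^sub>(\<^sub>k\<^sub>)b\<close> and the \<open>k\<close>-th product of the fields of \<open>a\<close>
  and \<open>b\<close> create the same vectors from the vacuum, and by Dong's lemma their difference is local
  with every field of the algebra, so it vanishes on every vector.\<close>

lemma associativity:
  assumes a: "a \<in> vpart A p" and b: "b \<in> vpart A q" and c: "c \<in> carrier A"
  shows "vprod A m (vprod A k a b) c = R (koszul_sign p q) (Y a) (Y b) k 0 m c"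
proof -
  note ca = part_carrier[OF a] and cb = part_carrier[OF b]
  note f = field_Y[OF ca] field_Y[OF cb]
  let ?\<sigma> = "koszul_sign p q :: 'k"
  have cab: "vprod A k a b \<in> carrier A" using ca cb by simp
  define Z where "Z = (\<lambda>n v. prd ?\<sigma> k (Y a) (Y b) n v - vscale A 1 (Y (vprod A k a b) n v))"
  note fZ1 = field_prd[OF f, of ?\<sigma> k] and fZ2 = field_Y[OF cab]
  have fZ: "field Z" unfolding Z_def by (rule field_comb[OF fZ1 fZ2])
  have Zvac: "Z n (vac A) = 0" for n
    by (simp add: Z_def prd_creation[OF ca cb])
  have Zhom: "Z n d = 0" if d: "d \<in> vpart A r" for n d r
  proof -
    note cd = part_carrier[OF d] and fd = field_Y[OF part_carrier[OF d]]
    let ?\<tau> = "koszul_sign (p + q) r :: 'k"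
    have l1: "local ?\<tau> (prd ?\<sigma> k (Y a) (Y b)) (Y d)"
      using dong[OF f fd local_Y[OF a b] local_Y[OF a d] local_Y[OF b d], of k] by (simp only: koszul_add_left)
    have l2: "local ?\<tau> (Y (vprod A k a b)) (Y d)"
      by (rule local_Y[OF prod_parity[OF a b] d])
    obtain K1 where K1: "\<And>l i j v. l \<ge> int K1 \<Longrightarrow> v \<in> carrier A \<Longrightarrow> R ?\<tau> (prd ?\<sigma> k (Y a) (Y b)) (Y d) l i j v = 0"
      using localE[OF l1 fZ1 fd] by blast
    obtain K2 where K2: "\<And>l i j v. l \<ge> int K2 \<Longrightarrow> v \<in> carrier A \<Longrightarrow> R ?\<tau> (Y (vprod A k a b)) (Y d) l i j v = 0"
      using localE[OF l2 fZ2 fd] by blast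
    define K where "K = int (max K1 K2)"
    have RZ: "R ?\<tau> Z (Y d) K i j (vac A) = 0" for i j
    proof -
      have "R ?\<tau> (prd ?\<sigma> k (Y a) (Y b)) (Y d) K i j (vac A) = 0" by (rule K1) (simp_all add: K_def)
      moreover have "R ?\<tau> (Y (vprod A k a b)) (Y d) K i j (vac A) = 0" by (rule K2) (simp_all add: K_def)
      ultimately show ?thesis
        unfolding Z_def R_comb_left[OF fd fZ1 fZ2 vac_carrier] by (simp only: scale_zero_right diff_zero)
    qed
    have "E (Y d) Z K j i (vac A) = 0" for i j
      unfolding E_def by (rule expand_trunc[of i]) (simp_all add: Zvac lin_0[OF fieldD(1)[OF fd]])
    then have "E Z (Y d) K (n - K) (-1) (vac A) = 0"
      using RZ[of "n - K" "-1"] by (simp add: R_def)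
    then show ?thesis using E_vac[OF fZ cd, of K "n - K"] by simp
  qed
  obtain c0 c1 where "c0 \<in> vpart A 0" "c1 \<in> vpart A 1" "c = c0 + c1" using c by (rule carrierE)
  then have "Z m c = 0" using Zhom linD(2)[OF fieldD(1)[OF fZ]] part_carrier by simp
  then show ?thesis by (simp add: Z_def prd_def)
qed


text \<open>The bound \<open>a\<^sub>(\<^sub>n\<^sub>)b = 0\<close> for \<open>n \<ge> L\<close> forces locality of that very order \<open>L\<close>, which may be negative:
  the defects \<open>R L\<close> with \<open>p = 0\<close> vanish by associativity, the others by the recursion in \<open>p\<close>.\<close>

lemma bound_imp_local:
  assumes a: "a \<in> vpart A p" and b: "b \<in> vpart A q" and c: "c \<in> carrier A"
    and L: "\<And>n. n \<ge> L \<Longrightarrow> vprod A n a b = 0"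
  shows "k \<ge> L \<Longrightarrow> R (koszul_sign p q) (Y a) (Y b) k i j c = 0"
proof -
  note ca = part_carrier[OF a] and cb = part_carrier[OF b]
  note f = field_Y[OF ca] field_Y[OF cb]
  let ?\<sigma> = "koszul_sign p q :: 'k"
  have R0: "R ?\<sigma> (Y a) (Y b) k 0 j c = 0" if "k \<ge> L" for k j
    using associativity[OF a b c, of j k] L[OF that] c prod_scale_left[of 0 c j 0] by simp
  have pos: "k \<ge> L \<Longrightarrow> R ?\<sigma> (Y a) (Y b) k (int i) j c = 0" for i k j
  proof (induction i arbitrary: k j)
    case (Suc i)
    then show ?case using R_Suc[OF f c, of ?\<sigma> k "int i" j] by (simp add: add.commute)
  qed (simp add: R0)
  obtain K where K: "\<And>l i j v. l \<ge> int K \<Longrightarrow> v \<in> carrier A \<Longrightarrow> R ?\<sigma> (Y a) (Y b) l i j v = 0"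
    using localE[OF local_Y[OF a b] f] by blast
  have neg: "k \<ge> L \<Longrightarrow> R ?\<sigma> (Y a) (Y b) k (- int i) j c = 0" for i k j
  proof (induction i arbitrary: k j)
    case (Suc i)
    have "k \<ge> L \<Longrightarrow> R ?\<sigma> (Y a) (Y b) k (- int (Suc i)) j c = 0" for k j
    proof (induction "nat (int K - k)" arbitrary: k j)
      case 0
      then show ?case using K c by simp
    next
      case (Suc n)
      have "R ?\<sigma> (Y a) (Y b) k (- int i) (j - 1) c = 0" by (rule Suc.prems(1)[THEN \<open>\<And>k j. L \<le> k \<Longrightarrow> R ?\<sigma> (Y a) (Y b) k (- int i) j c = 0\<close>])
      moreover have "R ?\<sigma> (Y a) (Y b) (k + 1) (- int (Suc i)) (j - 1) c = 0"
        by (rule Suc.hyps(1)) (use Suc.hyps(2) Suc.prems in auto)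
      ultimately show ?case
        using R_Suc[OF f c, of ?\<sigma> k "- int (Suc i)" "j - 1"] by simp
    qed
    then show ?case using Suc.prems by blast
  qed (simp add: R0)
  assume "k \<ge> L"
  then show ?thesis using pos[of k "nat i" j] neg[of k "nat (- i)" j] by (cases "i \<ge> 0") auto
qed

lemma expand_in_subspace:
  assumes W: "subspace W" and g: "\<And>i j. g i j \<in> W" "\<exists>j0. \<forall>i. \<forall>j\<ge>j0. g i j = 0"
  shows "expand e g k p m \<in> W"
proof -
  obtain j0 where j0: "\<forall>i. \<forall>j\<ge>j0. g i j = 0" using g by blast
  show ?thesis
    by (subst expand_eq_sum_ge[OF j0 order_refl]) (auto intro!: subspace_sum[OF W] subspace_scale[OF W] g)
qed

lemma lin_span:
  assumes f: "\<And>x y. x \<in> carrier A \<Longrightarrow> y \<in> carrier A \<Longrightarrow> f (x + y) = f x + f y"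
    "\<And>r x. x \<in> carrier A \<Longrightarrow> f (vscale A r x) = vscale A r (f x)"
    and X: "X \<subseteq> carrier A" and W: "subspace W" and fX: "\<And>x. x \<in> X \<Longrightarrow> f x \<in> W" and x: "x \<in> span X"
  shows "f x \<in> W"
proof -
  have f0: "f 0 = 0" using f(2)[of 0 0] by simp
  have "x \<in> carrier A \<and> f x \<in> W" using x
  proof (induction rule: span_induct_alt)
    case base
    then show ?case by (simp add: f0 subspace_0[OF W])
  next
    case (step c x y)
    then have "x \<in> carrier A" using X by blast
    then show ?case using step fX f by (auto intro!: subspace_add[OF W] subspace_scale[OF W])
  qed
  then show ?thesis by blast
qed

end

section \<open>Right-normed monomials span\<close>

lemma monomial_Nil: "monomial A \<iota> [] = vac A"
  by (simp add: monomial_def)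

lemma monomial_Cons: "monomial A \<iota> ((a, m) # w) = vprod A m (\<iota> a) (monomial A \<iota> w)"
  by (simp add: monomial_def)

definition words :: "'b set \<Rightarrow> ('b \<times> int) list set" where
  "words B = {w. fst ` set w \<subseteq> B}"

context vertex_algebra
begin

context
  fixes B :: "'c set" and \<iota> :: "'c \<Rightarrow> 'v" and par :: "'c \<Rightarrow> bit"
  assumes gens: "\<And>a. a \<in> B \<Longrightarrow> \<iota> a \<in> vpart A (par a)"
begin

lemma gens_carrier: "a \<in> B \<Longrightarrow> \<iota> a \<in> carrier A"
  using gens part_carrier by blast

lemma monomial_homogeneous: "w \<in> words B \<Longrightarrow> \<exists>q. monomial A \<iota> w \<in> vpart A q"
proof (induction w)
  case Nil
  then show ?case using vac_even by (auto simp: monomial_Nil)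
next
  case (Cons x w)
  obtain a m where x: "x = (a, m)" by (cases x)
  from Cons obtain q where "monomial A \<iota> w \<in> vpart A q" by (auto simp: words_def)
  moreover have "\<iota> a \<in> vpart A (par a)" using Cons.prems gens by (simp add: words_def x)
  ultimately have "monomial A \<iota> (x # w) \<in> vpart A (par a + q)"
    unfolding x monomial_Cons by (intro prod_parity)
  then show ?case by blast
qed

lemma monomial_carrier: "w \<in> words B \<Longrightarrow> monomial A \<iota> w \<in> carrier A"
  using monomial_homogeneous part_carrier by blast

text \<open>By induction on the left factor: associativity expresses the action of \<open>a\<^sub>(\<^sub>m\<^sub>)x\<close> by those of the
  generator \<open>a\<close> and of the shorter monomial \<open>x\<close>.\<close>

lemma span_monomials_subalgebra: "vertex_subalgebra A (span (monomial A \<iota> ` words B))"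
proof -
  let ?S = "span (monomial A \<iota> ` words B)"
  have mc: "monomial A \<iota> ` words B \<subseteq> carrier A" using monomial_carrier by blast
  then have Sc: "?S \<subseteq> carrier A" by (rule span_minimal[OF _ subspace_carrier])
  have gen: "vprod A n (\<iota> a) x \<in> ?S" if a: "a \<in> B" and x: "x \<in> ?S" for n a x
  proof (rule lin_span[OF _ _ mc subspace_span _ x])
    fix y assume "y \<in> monomial A \<iota> ` words B"
    then obtain w where w: "w \<in> words B" "y = monomial A \<iota> w" by blast
    then have "(a, n) # w \<in> words B" using a by (simp add: words_def)
    then have "monomial A \<iota> ((a, n) # w) \<in> monomial A \<iota> ` words B" by blast
    then show "vprod A n (\<iota> a) y \<in> ?S" using w by (simp add: monomial_Cons span_base)
  qed (simp_all add: prod_add_right prod_scale_right gens_carrier[OF a])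
  have mon: "vprod A n (monomial A \<iota> w) y \<in> ?S" if "w \<in> words B" "y \<in> ?S" for n w y
    using that
  proof (induction w arbitrary: n y)
    case Nil
    then show ?case using Sc by (auto simp: monomial_Nil vac_left span_zero)
  next
    case (Cons x w)
    obtain a m where x: "x = (a, m)" by (cases x)
    have a: "a \<in> B" and w: "w \<in> words B" using Cons.prems by (auto simp: x words_def)
    obtain q where q: "monomial A \<iota> w \<in> vpart A q" using monomial_homogeneous[OF w] by blast
    have y: "y \<in> carrier A" using Cons.prems Sc by blast
    note f = field_Y[OF gens_carrier[OF a]] field_Y[OF monomial_carrier[OF w]]
    have "E (Y (\<iota> a)) (Y (monomial A \<iota> w)) m 0 n y \<in> ?S" "E (Y (monomial A \<iota> w)) (Y (\<iota> a)) m n 0 y \<in> ?S"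
      unfolding E_def
      by (rule expand_in_subspace[OF subspace_span],
          use Cons.IH[OF w] gen[OF a] Cons.prems(2) comp_trunc[OF f y] comp_trunc[OF f(2,1) y] in auto)+
    then show ?case
      unfolding x monomial_Cons associativity[OF gens[OF a] q y] R_def
      by (intro span_diff span_scale)
  qed
  have "vprod A n x y \<in> ?S" if x: "x \<in> ?S" and y: "y \<in> ?S" for n x y
  proof (rule lin_span[OF _ _ mc subspace_span _ x, of "\<lambda>x. vprod A n x y"])
    have "y \<in> carrier A" using y Sc by blast
    then show "vprod A n (u + v) y = vprod A n u y + vprod A n v y" "vprod A n (vscale A r u) y = vscale A r (vprod A n u y)"
      if "u \<in> carrier A" "v \<in> carrier A" for u v r
      using that by (simp_all add: prod_add_left prod_scale_left)
  qed (use mon y in auto)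
  moreover have "vac A \<in> ?S"
  proof (rule span_base)
    have "[] \<in> words B" by (simp add: words_def)
    then show "vac A \<in> monomial A \<iota> ` words B" using monomial_Nil by (metis image_eqI)
  qed
  ultimately show ?thesis
    unfolding vertex_subalgebra_def using Sc subspace_span by blast
qed


end

end

section \<open>Straightening\<close>

text \<open>The sum runs over the letters to the right, so the exponents of a tail are the tail of the exponents;
  this makes the condition on words recursive.\<close>

fun expos :: "('b \<Rightarrow> 'b \<Rightarrow> int) \<Rightarrow> ('b \<times> int) list \<Rightarrow> int list" where
  "expos N [] = []"
| "expos N ((a, m) # w) = (- m - 1 + (\<Sum>b\<in>#mset (map fst w). N a b)) # expos N w"

fun straight :: "('b::linorder \<Rightarrow> 'b \<Rightarrow> int) \<Rightarrow> ('b \<times> int) list \<Rightarrow> bool" where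
  "straight N [] = True"
| "straight N [(a, m)] = (m < 0)"
| "straight N ((a, m) # (b, m') # w) \<longleftrightarrow> straight N ((b, m') # w) \<and>
     (let n = hd (expos N ((a, m) # (b, m') # w)); n' = hd (expos N ((b, m') # w))
      in if a \<le> b then n' \<le> n else n' < n)"

lemma expos_length [simp]: "length (expos N w) = length w"
  by (induction N w rule: expos.induct) auto

lemma sum_nth_drop: "(\<Sum>j\<in>{i..<length w}. f (w ! j)) = sum_list (map f (drop i w))"
proof -
  have "sum_list (map f (drop i w)) = (\<Sum>j = 0..<length w - i. f (w ! (i + j)))"
    by (simp add: sum_list_sum_nth)
  also have "\<dots> = (\<Sum>j\<in>{i..<length w}. f (w ! j))"
    by (rule sum.reindex_bij_witness[of _ "\<lambda>j. j - i" "\<lambda>j. i + j"]) auto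
  finally show ?thesis by simp
qed

lemma sum_mset_map_fst: "(\<Sum>b\<in>#mset (map fst w). f b) = (\<Sum>y\<leftarrow>w. f (fst y))"
  by (induction w) auto

lemma basis_words_iff: "w \<in> basis_words B N \<longleftrightarrow> fst ` set w \<subseteq> B \<and> straight N w"
proof -
  define C where "C = (\<lambda>(N :: 'a \<Rightarrow> 'a \<Rightarrow> int) w i. snd (w ! i) - snd (w ! (i + 1)) \<le>
     (if fst (w ! i) \<le> fst (w ! (i + 1))
      then (\<Sum>y\<leftarrow>drop (i + 1) w. N (fst (w ! i)) (fst y)) - (\<Sum>y\<leftarrow>drop (i + 2) w. N (fst (w ! (i + 1))) (fst y))
      else (\<Sum>y\<leftarrow>drop (i + 1) w. N (fst (w ! i)) (fst y)) - (\<Sum>y\<leftarrow>drop (i + 2) w. N (fst (w ! (i + 1))) (fst y)) - 1))"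
  have eq: "w \<in> basis_words B N \<longleftrightarrow> (\<forall>i<length w. fst (w ! i) \<in> B) \<and> (length w > 0 \<longrightarrow> snd (w ! (length w - 1)) < 0) \<and>
      (\<forall>i. i + 1 < length w \<longrightarrow> C N w i)"
    unfolding basis_words_def mem_Collect_eq Let_def C_def
      sum_nth_drop[of "\<lambda>y. N a (fst y)" for a] ..
  have str: "straight N w \<longleftrightarrow> (length w > 0 \<longrightarrow> snd (w ! (length w - 1)) < 0) \<and> (\<forall>i. i + 1 < length w \<longrightarrow> C N w i)"
  proof (induction N w rule: straight.induct)
    case (3 N a m b m' w)
    have C0: "C N ((a, m) # (b, m') # w) 0 \<longleftrightarrow> (let n = hd (expos N ((a, m) # (b, m') # w)); n' = hd (expos N ((b, m') # w))
      in if a \<le> b then n' \<le> n else n' < n)"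
      by (auto simp: C_def Let_def sum_mset_map_fst simp del: mset_map)
    have CS: "C N (x # w) (Suc i) \<longleftrightarrow> C N w i" for x w i
      by (simp add: C_def)
    have split: "(\<forall>i. i + 1 < length ((a, m) # (b, m') # w) \<longrightarrow> C N ((a, m) # (b, m') # w) i) \<longleftrightarrow>
        C N ((a, m) # (b, m') # w) 0 \<and> (\<forall>i. i + 1 < length ((b, m') # w) \<longrightarrow> C N ((b, m') # w) i)"
      (is "?L \<longleftrightarrow> ?R")
    proof
      assume L: ?L
      show ?R using L[rule_format, of 0] L[rule_format, of "Suc i" for i] by (simp add: CS)
    next
      assume R: ?R
      show ?L
      proof (intro allI impI)
        fix i assume "i + 1 < length ((a, m) # (b, m') # w)"
        then show "C N ((a, m) # (b, m') # w) i" using R by (cases i) (simp_all add: CS)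
      qed
    qed
    show ?case unfolding split C0 straight.simps(3) 3 by auto
  qed auto
  have "(\<forall>i<length w. fst (w ! i) \<in> B) \<longleftrightarrow> fst ` set w \<subseteq> B"
    by (auto simp: set_conv_nth)
  then show ?thesis using eq str by blast
qed

lemma straight_expos_nonneg:
  fixes w :: "('b::linorder \<times> int) list"
  shows "straight N w \<Longrightarrow> \<forall>e\<in>set (expos N w). 0 \<le> e"
proof (induction N w rule: straight.induct)
  case (3 N a m b m' w)
  then have "0 \<le> hd (expos N ((b, m') # w))" by simp
  moreover have "hd (expos N ((b, m') # w)) \<le> hd (expos N ((a, m) # (b, m') # w))"
    using 3(2) by (auto simp: Let_def split: if_splits)
  ultimately show ?case using 3 by simp
qed auto

text \<open>Fixing the letters \<open>C\<close> and the total exponent \<open>T\<close> makes the straightening finite.\<close>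

definition straight_span where
  "straight_span A B N \<iota> C T = module.span (vscale A) (monomial A \<iota> `
     {w. fst ` set w \<subseteq> B \<and> straight N w \<and> mset (map fst w) = C \<and> sum_list (expos N w) = T})"

context vertex_algebra
begin

context
  fixes B :: "'c::linorder set" and \<iota> :: "'c \<Rightarrow> 'v" and N :: "'c \<Rightarrow> 'c \<Rightarrow> int"
  assumes bound: "respects_bound B N A \<iota>" and sym: "\<And>a b. a \<in> B \<Longrightarrow> b \<in> B \<Longrightarrow> N a b = N b a"
begin

lemma gen_part: "a \<in> B \<Longrightarrow> \<iota> a \<in> vpart A (of_int (N a a))"
  using bound by (auto simp: respects_bound_def)

lemma gen_carrier: "a \<in> B \<Longrightarrow> \<iota> a \<in> carrier A"
  using gen_part part_carrier by blast

lemma words_carrier: "fst ` set w \<subseteq> B \<Longrightarrow> monomial A \<iota> w \<in> carrier A"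
  using monomial_carrier[of B \<iota> "\<lambda>a. of_int (N a a)" w, OF gen_part] by (auto simp: words_def)

abbreviation W where "W C T \<equiv> straight_span A B N \<iota> C T"

lemma W_subspace: "subspace (W C T)"
  unfolding straight_span_def by (rule subspace_span)

lemma W_base: "fst ` set w \<subseteq> B \<Longrightarrow> straight N w \<Longrightarrow> mset (map fst w) = C \<Longrightarrow> sum_list (expos N w) = T \<Longrightarrow> monomial A \<iota> w \<in> W C T"
  unfolding straight_span_def by (rule span_base) blast

lemma W_neg: assumes "T < 0" shows "W C T = {0}"
proof -
  have "{w. fst ` set w \<subseteq> B \<and> straight N w \<and> mset (map fst w) = C \<and> sum_list (expos N w) = T} = {}"
  proof -
    have "0 \<le> sum_list (expos N w)" if "straight N w" for w :: "('c \<times> int) list"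
      using straight_expos_nonneg[OF that] by (intro sum_list_nonneg) auto
    then show ?thesis using assms by force
  qed
  then show ?thesis by (simp only: straight_span_def image_empty span_empty)
qed

text \<open>Locality of order \<open>N a b\<close>, solved for the leading term of its left-hand side.\<close>

lemma swap_step:
  assumes a: "a \<in> B" and b: "b \<in> B" and v: "v \<in> carrier A" and X: "subspace X"
    and X1: "\<And>s. s > 0 \<Longrightarrow> vprod A (m - int s) (\<iota> a) (vprod A (m' + int s) (\<iota> b) v) \<in> X"
    and X2: "\<And>s. vprod A (m' + N a b - int s) (\<iota> b) (vprod A (m - N a b + int s) (\<iota> a) v) \<in> X"
  shows "vprod A m (\<iota> a) (vprod A m' (\<iota> b) v) \<in> X"
proof -
  let ?N = "N a b"
  note f = field_Y[OF gen_carrier[OF a]] field_Y[OF gen_carrier[OF b]]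
  let ?\<sigma> = "koszul_sign (of_int (N a a)) (of_int (N b b)) :: 'k"
  have "R ?\<sigma> (Y (\<iota> a)) (Y (\<iota> b)) ?N (m - ?N) m' v = 0"
    by (rule bound_imp_local[OF gen_part[OF a] gen_part[OF b] v])
       (use bound a b in \<open>auto simp: respects_bound_def\<close>)
  then have eq: "E (Y (\<iota> a)) (Y (\<iota> b)) ?N (m - ?N) m' v
      = vscale A (?\<sigma> * (-1) powi ?N) (E (Y (\<iota> b)) (Y (\<iota> a)) ?N m' (m - ?N) v)"
    by (simp only: R_def right_minus_eq)
  obtain j0 where j0: "\<forall>i. \<forall>j\<ge>j0. vprod A i (\<iota> a) (vprod A j (\<iota> b) v) = 0"
    using comp_trunc[OF f v] by blast
  obtain j1 where j1: "\<forall>i. \<forall>j\<ge>j1. vprod A i (\<iota> b) (vprod A j (\<iota> a) v) = 0"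
    using comp_trunc[OF f(2,1) v] by blast
  have "E (Y (\<iota> b)) (Y (\<iota> a)) ?N m' (m - ?N) v \<in> X"
    unfolding E_def
    by (subst expand_eq_sum_ge[OF j1 order_refl])
       (auto intro!: subspace_sum[OF X] subspace_scale[OF X] X2)
  then have E2: "E (Y (\<iota> a)) (Y (\<iota> b)) ?N (m - ?N) m' v \<in> X"
    unfolding eq by (rule subspace_scale[OF X])
  define n where "n = nat (j0 - m')"
  define rest where "rest = (\<Sum>s<n. vscale A ((-1) ^ Suc s * (of_int ?N gchoose Suc s))
      (vprod A (m - int (Suc s)) (\<iota> a) (vprod A (m' + int (Suc s)) (\<iota> b) v)))"
  have "E (Y (\<iota> a)) (Y (\<iota> b)) ?N (m - ?N) m' v
     = (\<Sum>s<Suc n. vscale A ((-1) ^ s * (of_int ?N gchoose s))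
      (vprod A (m - ?N + ?N - int s) (\<iota> a) (vprod A (m' + int s) (\<iota> b) v)))"
    unfolding E_def by (rule expand_eq_sum_ge[OF j0]) (simp add: n_def)
  also have "\<dots> = vprod A m (\<iota> a) (vprod A m' (\<iota> b) v) + rest"
    unfolding rest_def by (simp only: sum.lessThan_Suc_shift) simp
  finally have "vprod A m (\<iota> a) (vprod A m' (\<iota> b) v) = E (Y (\<iota> a)) (Y (\<iota> b)) ?N (m - ?N) m' v - rest"
    by simp
  moreover have "rest \<in> X"
    unfolding rest_def by (intro subspace_sum[OF X] subspace_scale[OF X] X1) simp
  ultimately show ?thesis using E2 subspace_diff[OF X] by simp
qed

text \<open>Let \<open>n\<close> be the exponent of the new first letter.  The induction is on the exponent \<open>T\<close> left for the
  tail, which is the constant total minus \<open>n\<close>, and then on the rank of \<open>a\<close> among the letters.  If \<open>a\<close>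
  stands wrongly before the first letter \<open>b\<close> of a straight tail, commuting them yields terms with first
  letter \<open>a\<close> and exponent \<open>n + s\<close>, \<open>s > 0\<close>, and terms with first letter \<open>b\<close> and exponent \<open>n' + s\<close>, where
  \<open>n' > n\<close>, or \<open>n' = n\<close> and \<open>b < a\<close>.  Their tails are shorter words, straight by induction on the length.\<close>

lemma straighten_step:
  assumes IH: "\<And>w. length w \<le> k \<Longrightarrow> fst ` set w \<subseteq> B \<Longrightarrow> monomial A \<iota> w \<in> W (mset (map fst w)) (sum_list (expos N w))"
    and a: "a \<in> B" and C: "size C = k" and x: "x \<in> W C T"
  shows "vprod A m (\<iota> a) x \<in> W (add_mset a C) (T - m - 1 + (\<Sum>b\<in>#C. N a b))"
  using a C x
proof (induction "(nat T, card {c \<in> set_mset (add_mset a C). c < a})" arbitrary: a C T m x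
    rule: wf_induct_rule[OF wf_lex_prod[OF wf_less_than wf_less_than]])
  case 1
  note less = 1(1) and a = 1(2) and C = 1(3) and x = 1(4)
  let ?n = "- m - 1 + (\<Sum>b\<in>#C. N a b)"
  have goal_eq: "T - m - 1 + (\<Sum>b\<in>#C. N a b) = T + ?n" by simp
  show ?case
  proof (cases "T < 0")
    case True
    then have "x = 0" using x W_neg by simp
    then show ?thesis using lin_0[OF fieldD(1)[OF field_Y[OF gen_carrier[OF a]]]] subspace_0[OF W_subspace] by simp
  next
    case T: False
    let ?X = "W (add_mset a C) (T + ?n)"
    show ?thesis unfolding goal_eq
    proof (rule lin_span[OF _ _ _ W_subspace _ x[unfolded straight_span_def]])
      fix y assume "y \<in> monomial A \<iota> ` {w. fst ` set w \<subseteq> B \<and> straight N w \<and> mset (map fst w) = C \<and> sum_list (expos N w) = T}"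
      then obtain w where w: "fst ` set w \<subseteq> B" "straight N w" "mset (map fst w) = C" "sum_list (expos N w) = T"
        and y: "y = monomial A \<iota> w" by blast
      have good: "vprod A m (\<iota> a) y \<in> ?X" if "straight N ((a, m) # w)"
        unfolding y monomial_Cons[symmetric] by (rule W_base) (use w a that in \<open>auto\<close>)
      show "vprod A m (\<iota> a) y \<in> ?X"
      proof (cases w)
        case Nil
        then show ?thesis using good a subspace_0[OF W_subspace]
          by (cases "m < 0") (auto simp: y monomial_def vac_right_nonneg gen_carrier)
      next
        case (Cons bm w')
        obtain b m' where bm: "bm = (b, m')" by (cases bm)
        have b: "b \<in> B" and w': "fst ` set w' \<subseteq> B" using w(1) Cons bm by auto
        define C' where "C' = mset (map fst w')"
        have CC': "C = add_mset b C'" using w(3) Cons bm by (simp add: C'_def)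
        let ?n' = "- m' - 1 + (\<Sum>c\<in>#C'. N b c)"
        have hd': "hd (expos N w) = ?n'" by (simp add: Cons bm C'_def)
        have hd: "hd (expos N ((a, m) # w)) = ?n" using w(3) by simp
        have Tw: "T = ?n' + sum_list (expos N w')" using w(4) by (simp add: Cons bm C'_def)
        have len: "length w \<le> k" using w(3) C by auto
        show ?thesis
        proof (cases "straight N ((a, m) # w)")
          case True
          then show ?thesis by (rule good)
        next
          case False
          then have bad: "?n < ?n' \<or> ?n = ?n' \<and> b < a"
            using w(2) hd hd' unfolding Cons bm by (auto simp: Let_def split: if_splits)
          define v where "v = monomial A \<iota> w'"
          have v: "v \<in> carrier A" unfolding v_def by (rule words_carrier[OF w'])
          have yv: "y = vprod A m' (\<iota> b) v" by (simp add: y Cons bm monomial_Cons v_def)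
          show ?thesis unfolding yv
          proof (rule swap_step[OF a b v W_subspace])
            fix s :: nat assume s: "s > 0"
            have "monomial A \<iota> ((b, m' + int s) # w') \<in> W C (T - int s)"
              using IH[of "(b, m' + int s) # w'"] len b w' by (simp add: Cons bm CC' C'_def Tw algebra_simps)
            then have z: "vprod A (m' + int s) (\<iota> b) v \<in> W C (T - int s)"
              by (simp add: monomial_Cons v_def)
            show "vprod A (m - int s) (\<iota> a) (vprod A (m' + int s) (\<iota> b) v) \<in> ?X"
            proof (cases "T - int s < 0")
              case True
              then have "vprod A (m' + int s) (\<iota> b) v = 0" using z W_neg by simp
              then show ?thesis using lin_0[OF fieldD(1)[OF field_Y[OF gen_carrier[OF a]]]] subspace_0[OF W_subspace] by simp
            next
              case False
              have "vprod A (m - int s) (\<iota> a) (vprod A (m' + int s) (\<iota> b) v)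
                  \<in> W (add_mset a C) (T - int s - (m - int s) - 1 + (\<Sum>b\<in>#C. N a b))"
                by (rule less[OF _ a C z]) (use False s T in auto)
              then show ?thesis by (simp add: algebra_simps)
            qed
          next
            fix s :: nat
            let ?p = "m - N a b + int s"
            define T' where "T' = sum_list (expos N w') + ?n - int s"
            have nC: "?n = - m - 1 + N a b + (\<Sum>c\<in>#C'. N a c)" by (simp add: CC')
            have "monomial A \<iota> ((a, ?p) # w') \<in> W (add_mset a C') T'"
              using IH[of "(a, ?p) # w'"] len a w' by (simp add: Cons bm C'_def T'_def CC' algebra_simps)
            then have z: "vprod A ?p (\<iota> a) v \<in> W (add_mset a C') T'"
              by (simp add: monomial_Cons v_def)
            have tot: "T' - (m' + N a b - int s) - 1 + (\<Sum>c\<in>#add_mset a C'. N b c) = T + ?n"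
              using sym[OF a b] by (simp add: T'_def Tw)
            have mm: "add_mset b (add_mset a C') = add_mset a C" by (simp add: CC' add_mset_commute)
            show "vprod A (m' + N a b - int s) (\<iota> b) (vprod A ?p (\<iota> a) v) \<in> ?X"
            proof (cases "T' < 0")
              case True
              then have "vprod A ?p (\<iota> a) v = 0" using z W_neg by simp
              then show ?thesis using lin_0[OF fieldD(1)[OF field_Y[OF gen_carrier[OF b]]]] subspace_0[OF W_subspace] by simp
            next
              case False
              have sz: "size (add_mset a C') = k" using C CC' by simp
              have "vprod A (m' + N a b - int s) (\<iota> b) (vprod A ?p (\<iota> a) v)
                  \<in> W (add_mset b (add_mset a C')) (T' - (m' + N a b - int s) - 1 + (\<Sum>c\<in>#add_mset a C'. N b c))"
              proof (rule less[OF _ b sz z])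
                show "((nat T', card {c \<in> set_mset (add_mset b (add_mset a C')). c < b}),
                    (nat T, card {c \<in> set_mset (add_mset a C). c < a})) \<in> less_than <*lex*> less_than"
                proof (cases "T' < T")
                  case True
                  then show ?thesis using False by simp
                next
                  case nl: False
                  then have "s = 0" "?n = ?n'" "b < a" using bad by (auto simp: T'_def Tw)
                  then have "T' = T" by (simp add: T'_def Tw)
                  moreover have "{c \<in> set_mset (add_mset a C). c < b} \<subset> {c \<in> set_mset (add_mset a C). c < a}"
                    using \<open>b < a\<close> by (auto simp: CC')
                  then have "card {c \<in> set_mset (add_mset a C). c < b} < card {c \<in> set_mset (add_mset a C). c < a}"
                    by (rule psubset_card_mono[rotated]) simp
                  ultimately show ?thesis by (simp only: mm) simp
                qed
              qed
              then show ?thesis by (simp only: tot mm)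
            qed
          qed
        qed
      qed
    qed (use words_carrier in \<open>auto simp: prod_add_right prod_scale_right gen_carrier[OF a]\<close>)
  qed
qed

lemma monomial_straight_span:
  "fst ` set w \<subseteq> B \<Longrightarrow> monomial A \<iota> w \<in> W (mset (map fst w)) (sum_list (expos N w))"
proof (induction "length w" arbitrary: w rule: less_induct)
  case less
  show ?case
  proof (cases w)
    case Nil
    have "monomial A \<iota> [] \<in> W {#} 0" by (rule W_base) auto
    then show ?thesis by (simp add: Nil)
  next
    case (Cons am w')
    obtain a m where am: "am = (a, m)" by (cases am)
    have a: "a \<in> B" and w': "fst ` set w' \<subseteq> B" using less.prems by (auto simp: Cons am)
    have "vprod A m (\<iota> a) (monomial A \<iota> w') \<in> W (add_mset a (mset (map fst w')))
        (sum_list (expos N w') - m - 1 + (\<Sum>b\<in>#mset (map fst w'). N a b))"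
    proof (rule straighten_step[of "length w'"])
      show "monomial A \<iota> w'' \<in> W (mset (map fst w'')) (sum_list (expos N w''))"
        if "length w'' \<le> length w'" "fst ` set w'' \<subseteq> B" for w''
        by (rule less.hyps) (use that Cons in auto)
      then show "monomial A \<iota> w' \<in> W (mset (map fst w')) (sum_list (expos N w'))" using w' by blast
    qed (use a in auto)
    then show ?thesis by (simp add: Cons am monomial_Cons algebra_simps)
  qed
qed

theorem span_basis_words:
  assumes gen: "generated_by A (\<iota> ` B)"
  shows "span (monomial A \<iota> ` basis_words B N) = carrier A"
proof -
  let ?S = "span (monomial A \<iota> ` words B)"
  have "\<iota> ` B \<subseteq> ?S"
  proof
    fix x assume "x \<in> \<iota> ` B"
    then obtain a where a: "a \<in> B" "x = \<iota> a" by blast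
    then have "x = monomial A \<iota> [(a, -1)]" by (simp add: monomial_def vac_right_m1 gen_carrier)
    moreover have "[(a, -1)] \<in> words B" using a by (simp add: words_def)
    ultimately show "x \<in> ?S" by (simp add: span_base)
  qed
  moreover have "vertex_subalgebra A ?S"
    by (rule span_monomials_subalgebra[of B \<iota> "\<lambda>a. of_int (N a a)"]) (rule gen_part)
  ultimately have S: "?S = carrier A" using gen unfolding generated_by_def by blast
  have "W C T \<subseteq> span (monomial A \<iota> ` basis_words B N)" for C T
    unfolding straight_span_def by (rule span_mono) (auto simp: basis_words_iff)
  then have "monomial A \<iota> ` words B \<subseteq> span (monomial A \<iota> ` basis_words B N)"
    using monomial_straight_span by (auto simp: words_def)
  then have "?S \<subseteq> span (monomial A \<iota> ` basis_words B N)"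
    by (rule span_minimal) (rule subspace_span)
  moreover have "span (monomial A \<iota> ` basis_words B N) \<subseteq> ?S"
    by (rule span_mono) (auto simp: basis_words_iff words_def)
  ultimately show ?thesis using S by blast
qed

end

end

section \<open>The vertex algebra generated by mutually local fields\<close>

locale field_algebra = field_space scale UNIV
  for scale :: "'k::field_char_0 \<Rightarrow> 'v::ab_group_add \<Rightarrow> 'v" +
  fixes Gen :: "bit \<Rightarrow> (int \<Rightarrow> 'v \<Rightarrow> 'v) \<Rightarrow> bool"
  assumes gen_field: "Gen p a \<Longrightarrow> field a"
    and gen_local: "Gen p a \<Longrightarrow> Gen q b \<Longrightarrow> local (koszul_sign p q) a b"
begin

definition idf :: "int \<Rightarrow> 'v \<Rightarrow> 'v" where
  "idf = (\<lambda>n v. if n = -1 then v else 0)"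

text \<open>The index counts the operations used; the locality of a product with a third field needs that of
  its two factors with each other, so locality is proved by induction on the sum of two indices.\<close>

inductive FldN :: "nat \<Rightarrow> bit \<Rightarrow> (int \<Rightarrow> 'v \<Rightarrow> 'v) \<Rightarrow> bool" where
  N_id: "FldN 0 0 idf"
| N_gen: "Gen p a \<Longrightarrow> FldN 0 p a"
| N_zero: "FldN 0 p (\<lambda>n v. 0)"
| N_comb: "FldN i p a \<Longrightarrow> FldN j p b \<Longrightarrow> FldN (Suc (i + j)) p (\<lambda>n v. a n v - scale c (b n v))"
| N_prd: "FldN i p a \<Longrightarrow> FldN j q b \<Longrightarrow> FldN (Suc (i + j)) (p + q) (prd (koszul_sign p q) k a b)"

definition Fld :: "bit \<Rightarrow> (int \<Rightarrow> 'v \<Rightarrow> 'v) \<Rightarrow> bool" where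
  "Fld p a \<longleftrightarrow> (\<exists>i. FldN i p a)"

lemma Fld_intros:
  shows Fld_id: "Fld 0 idf"
    and Fld_gen: "Gen p a \<Longrightarrow> Fld p a"
    and Fld_zero: "Fld p (\<lambda>n v. 0)"
    and Fld_comb: "Fld p a \<Longrightarrow> Fld p b \<Longrightarrow> Fld p (\<lambda>n v. a n v - scale c (b n v))"
    and Fld_prd: "Fld p a \<Longrightarrow> Fld q b \<Longrightarrow> Fld (p + q) (prd (koszul_sign p q) k a b)"
  unfolding Fld_def using N_id N_gen N_zero N_comb N_prd by blast+

lemma field_idf: "field idf"
proof -
  have "\<exists>n0::int. \<forall>n\<ge>n0. (if n = -1 then v else 0) = 0" for v :: 'v
    by (rule exI[of _ 0]) auto
  then show ?thesis unfolding field_def lin_def idf_def by auto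
qed

lemma field_zero: "field (\<lambda>n v. 0)"
  unfolding field_def lin_def by auto

lemma FldN_field: "FldN i p a \<Longrightarrow> field a"
  by (induction rule: FldN.induct) (simp_all add: field_idf gen_field field_zero field_comb field_prd)

lemma Fld_field: "Fld p a \<Longrightarrow> field a"
  unfolding Fld_def using FldN_field by blast

lemma R_zero [simp]: "field a \<Longrightarrow> R s a (\<lambda>n v. 0) k p m v = 0" "field a \<Longrightarrow> R s (\<lambda>n v. 0) a k p m v = 0"
  by (simp_all add: R_def E_def expand_def)

lemma local_zero: "field a \<Longrightarrow> local \<sigma> (\<lambda>n v. 0) a" "field a \<Longrightarrow> local \<sigma> a (\<lambda>n v. 0)"
  by (simp_all add: local_def)

lemma local_idf: "field a \<Longrightarrow> local 1 idf a" "field a \<Longrightarrow> local 1 a idf"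
  unfolding local_def by (auto intro!: exI[of _ 0] simp: R_0 idf_def)

lemma local_comb:
  assumes "field a" "field b" "field c" "local \<sigma> a c" "local \<sigma> b c"
  shows "local \<sigma> (\<lambda>n v. a n v - scale s (b n v)) c"
proof -
  obtain K1 where K1: "\<And>l i j v. l \<ge> int K1 \<Longrightarrow> v \<in> UNIV \<Longrightarrow> R \<sigma> a c l i j v = 0"
    using localE[OF assms(4,1,3)] by blast
  obtain K2 where K2: "\<And>l i j v. l \<ge> int K2 \<Longrightarrow> v \<in> UNIV \<Longrightarrow> R \<sigma> b c l i j v = 0"
    using localE[OF assms(5,2,3)] by blast
  show ?thesis unfolding local_def
    by (rule exI[of _ "max K1 K2"]) (simp add: R_comb_left assms K1 K2)
qed

lemma local_FldN: "FldN i p a \<Longrightarrow> FldN j q b \<Longrightarrow> local (koszul_sign p q) a b"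
proof (induction "i + j" arbitrary: i j p q a b rule: less_induct)
  case less
  note fa = FldN_field[OF less.prems(1)] and fb = FldN_field[OF less.prems(2)]
  have closure: "local (koszul_sign p q) a b"
    if H: "FldN i p a" "FldN j q b" "field b"
      and gen: "Gen p a \<Longrightarrow> local (koszul_sign p q) a b"
      and IH: "\<And>i' j' p q a b. i' + j' < i + j \<Longrightarrow> FldN i' p a \<Longrightarrow> FldN j' q b \<Longrightarrow> local (koszul_sign p q) a b"
    for i j p q a b
    using H(1)
  proof cases
    case N_id
    then show ?thesis using local_idf[OF H(3)] by (simp add: koszul_sign_def)
  next
    case N_gen
    then show ?thesis using gen by blast
  next
    case N_zero
    then show ?thesis using local_zero[OF H(3)] by simp
  next
    case (N_comb i1 a1 i2 a2 c)
    then show ?thesis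
      using local_comb[OF FldN_field FldN_field H(3) IH[OF _ _ H(2), of i1 p a1] IH[OF _ _ H(2), of i2 p a2]] by simp
  next
    case (N_prd i1 p1 a1 i2 p2 a2 k)
    have "local (koszul_sign p1 p2) a1 a2" "local (koszul_sign p1 q) a1 b" "local (koszul_sign p2 q) a2 b"
      using IH[of i1 i2 p1 a1 p2 a2] IH[OF _ _ H(2), of i1 p1 a1] IH[OF _ _ H(2), of i2 p2 a2] N_prd by simp_all
    then show ?thesis unfolding N_prd(2,3) koszul_add_left
      by (rule dong[OF FldN_field[OF N_prd(4)] FldN_field[OF N_prd(5)] H(3)])
  qed
  have gen_any: "local (koszul_sign p q) a b" if g: "Gen p a"
  proof -
    have "local (koszul_sign q p) b a"
    proof (rule closure[OF less.prems(2,1) fa])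
      show "Gen q b \<Longrightarrow> local (koszul_sign q p) b a" using g gen_local by blast
    qed (use less.hyps in \<open>simp add: add.commute\<close>)
    then show ?thesis using local_sym[OF koszul_sq] by (metis koszul_commute)
  qed
  show ?case by (rule closure[OF less.prems fb gen_any less.hyps])
qed

lemma local_Fld: "Fld p a \<Longrightarrow> Fld q b \<Longrightarrow> local (koszul_sign p q) a b"
  unfolding Fld_def using local_FldN by blast

lemma prd_zero [simp]: "field a \<Longrightarrow> prd s k a (\<lambda>n v. 0) = (\<lambda>n v. 0)" "field a \<Longrightarrow> prd s k (\<lambda>n v. 0) a = (\<lambda>n v. 0)"
  by (simp_all add: prd_def fun_eq_iff)

lemma prd_comb_left:
  "field a \<Longrightarrow> field b \<Longrightarrow> field c \<Longrightarrow> prd s k (\<lambda>n v. a n v - scale r (b n v)) c = (\<lambda>n v. prd s k a c n v - scale r (prd s k b c n v))"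
  by (simp add: prd_def fun_eq_iff R_comb_left)

lemma prd_comb_right:
  "field a \<Longrightarrow> field b \<Longrightarrow> field c \<Longrightarrow> prd s k c (\<lambda>n v. a n v - scale r (b n v)) = (\<lambda>n v. prd s k c a n v - scale r (prd s k c b n v))"
  by (simp add: prd_def fun_eq_iff R_comb_right)

lemma prd_idf_left: assumes b: "field b" shows "prd 1 k idf b = (if k = -1 then b else (\<lambda>n v. 0))"
proof (intro ext)
  fix m v
  show "prd 1 k idf b m v = (if k = -1 then b else (\<lambda>n v. 0)) m v"
  proof (cases "k \<ge> 0")
    case True
    have "R 1 idf b 0 p m v = 0" for p m by (simp add: R_0 idf_def b)
    then have "R 1 idf b k 0 m v = 0" using R_zero_up[OF field_idf b _ _ True] by blast
    then show ?thesis using True by (simp add: prd_def)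
  next
    case False
    have "E b idf k m 0 v = 0"
      unfolding E_def by (rule expand_trunc[of 0]) (use b in \<open>auto simp: idf_def\<close>)
    moreover have "E idf b k 0 m v = (\<Sum>s\<in>{0}. scale ((- 1) ^ s * (of_int k gchoose s)) (idf (0 + k - int s) (b (m + int s) v)))"
      unfolding E_def expand_def
      by (rule Sum_any.expand_superset) (use False in \<open>auto simp: idf_def split: if_splits\<close>)
    ultimately show ?thesis by (simp add: prd_def R_def idf_def)
  qed
qed

lemma prd_idf_right_nonneg: assumes a: "field a" and k: "k \<ge> 0" shows "prd 1 k a idf = (\<lambda>n v. 0)"
proof (intro ext)
  fix m v
  have "R 1 a idf 0 p m v = 0" for p m by (simp add: R_0 idf_def a)
  then have "R 1 a idf k 0 m v = 0" using R_zero_up[OF a field_idf _ _ k] by blast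
  then show "prd 1 k a idf m v = 0" by (simp add: prd_def)
qed

text \<open>As \<open>[a(x), 1] = 0\<close>, multiplication by \<open>x - y\<close> kills the distribution \<open>R\<close> of exponent \<open>-1\<close>; hence its
  coefficients depend on the sum of the indices, and one where a single term survives can be chosen.\<close>

lemma prd_idf_right_m1: assumes a: "field a" shows "prd 1 (-1) a idf = a"
proof (intro ext)
  fix m v
  define h where "h = (\<lambda>t. R 1 a idf (-1) t (m - t) v)"
  have step: "h (t + 1) = h t" for t
  proof -
    have "R 1 a idf 0 t (m - (t + 1)) v = R 1 a idf (-1) (t + 1) (m - (t + 1)) v - R 1 a idf (-1) t (m - t) v"
      using R_Suc[OF a field_idf, of v 1 "-1" t "m - (t + 1)"] by (simp add: algebra_simps)
    moreover have "R 1 a idf 0 t (m - (t + 1)) v = 0" by (simp add: R_0 idf_def a)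
    ultimately show ?thesis by (simp add: h_def)
  qed
  have "h t = h 0" for t
  proof (induction t rule: int_induct[where k=0])
    case (step1 i) then show ?case using step by simp
  next
    case (step2 i) then show ?case using step[of "i - 1"] by simp
  qed simp
  then have "prd 1 (-1) a idf m v = h (m + 1)" by (simp add: h_def prd_def)
  also have "\<dots> = E a idf (-1) (m + 1) (-1) v + E idf a (-1) (-1) (m + 1) v"
    by (simp add: h_def R_def)
  also have "E idf a (-1) (-1) (m + 1) v = 0"
    by (simp add: E_def expand_def idf_def)
  also have "E a idf (-1) (m + 1) (-1) v = (\<Sum>s<1. scale ((- 1) ^ s * (of_int (-1) gchoose s)) (a (m + 1 + (-1) - int s) (idf (-1 + int s) v)))"
    unfolding E_def by (rule expand_eq_sum) (use a in \<open>auto simp: idf_def\<close>)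
  also have "\<dots> = a m v" by (simp add: idf_def)
  finally show "prd 1 (-1) a idf m v = a m v" by simp
qed

lemma prd_deriv_left: "field a \<Longrightarrow> field b \<Longrightarrow> prd s k (deriv a) b = (\<lambda>n v. scale (- of_int k) (prd s (k - 1) a b n v))"
  by (simp add: prd_def fun_eq_iff R_deriv_left)

lemma prd_deriv_right:
  "field a \<Longrightarrow> field b \<Longrightarrow> prd s k a (deriv b) = (\<lambda>n v. scale (of_int k) (prd s (k - 1) a b n v) + deriv (prd s k a b) n v)"
  unfolding prd_def by (simp add: fun_eq_iff R_deriv_right) (simp add: deriv_def)

lemma prd_idf_deriv: "field a \<Longrightarrow> prd 1 (- 2) a idf = deriv a"
  using prd_deriv_left[of a idf 1 "-1"] prd_idf_right_m1[OF field_deriv[of a]] field_idf by simp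

lemma prd_idf_right_neg: "field a \<Longrightarrow> prd 1 (- 1 - int j) a idf = (\<lambda>n v. scale (1 / fact j) ((deriv ^^ j) a n v))"
proof (induction j arbitrary: a)
  case 0
  then show ?case by (simp add: prd_idf_right_m1)
next
  case (Suc j)
  have "prd 1 (- 1 - int j) (deriv a) idf = (\<lambda>n v. scale (of_nat (Suc j)) (prd 1 (- 1 - int (Suc j)) a idf n v))"
    using prd_deriv_left[OF Suc.prems field_idf, of 1 "- 1 - int j"] by (simp add: algebra_simps)
  then have "scale (of_nat (Suc j)) (prd 1 (- 1 - int (Suc j)) a idf n v) = scale (1 / fact j) ((deriv ^^ Suc j) a n v)" for n v
    using Suc.IH[OF field_deriv[OF Suc.prems]] by (simp add: funpow_swap1 fun_eq_iff)
  then have "scale (1 / of_nat (Suc j)) (scale (of_nat (Suc j)) (prd 1 (- 1 - int (Suc j)) a idf n v))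
      = scale (1 / of_nat (Suc j)) (scale (1 / fact j) ((deriv ^^ Suc j) a n v))" for n v by simp
  then show ?case by (simp add: fun_eq_iff field_simps del: of_nat_Suc funpow.simps)
qed

text \<open>Parities are attached formally: an element is a pair of fields indexed by the parity, and the space
  on which they act is not graded.  The signs enter through the products only.\<close>

definition fscale :: "'k \<Rightarrow> (bit \<Rightarrow> int \<Rightarrow> 'v \<Rightarrow> 'v) \<Rightarrow> bit \<Rightarrow> int \<Rightarrow> 'v \<Rightarrow> 'v" where
  "fscale r x = (\<lambda>p n v. scale r (x p n v))"

definition fprd :: "int \<Rightarrow> (bit \<Rightarrow> int \<Rightarrow> 'v \<Rightarrow> 'v) \<Rightarrow> (bit \<Rightarrow> int \<Rightarrow> 'v \<Rightarrow> 'v) \<Rightarrow> bit \<Rightarrow> int \<Rightarrow> 'v \<Rightarrow> 'v" where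
  "fprd k x y = (\<lambda>r n v. prd 1 k (x 0) (y r) n v + prd (koszul_sign 1 (r + 1)) k (x 1) (y (r + 1)) n v)"

definition pure :: "bit \<Rightarrow> (int \<Rightarrow> 'v \<Rightarrow> 'v) \<Rightarrow> bit \<Rightarrow> int \<Rightarrow> 'v \<Rightarrow> 'v" where
  "pure p a = (\<lambda>q. if q = p then a else (\<lambda>n v. 0))"

definition field_struct :: "('k, bit \<Rightarrow> int \<Rightarrow> 'v \<Rightarrow> 'v) vertex_struct" where
  "field_struct = \<lparr>vscale = fscale, vpart = (\<lambda>p. {pure p a | a. Fld p a}), vac = pure 0 idf, vprod = fprd\<rparr>"

lemma field_struct_simps [simp]:
  "vscale field_struct = fscale" "vpart field_struct p = {pure p a | a. Fld p a}"
  "vac field_struct = pure 0 idf" "vprod field_struct = fprd"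
  by (simp_all add: field_struct_def)

lemma bit_all: "(\<forall>p::bit. P p) \<longleftrightarrow> P 0 \<and> P 1"
  by (metis bit.exhaust)

lemma Fld_add: "Fld p a \<Longrightarrow> Fld p b \<Longrightarrow> Fld p (\<lambda>n v. a n v + b n v)"
  using Fld_comb[of p a b "-1"] by simp

lemma Fld_scale: "Fld p a \<Longrightarrow> Fld p (\<lambda>n v. scale r (a n v))"
  using Fld_comb[OF Fld_zero[of p], of a "-r"] by simp

lemma carrier_field_struct: "carrier field_struct = {x. \<forall>p. Fld p (x p)}"
proof (intro equalityI subsetI)
  fix x assume "x \<in> carrier field_struct"
  then obtain a b where "Fld 0 a" "Fld 1 b" "x = pure 0 a + pure 1 b" by (auto simp: carrier_def)
  then show "x \<in> {x. \<forall>p. Fld p (x p)}" by (simp add: bit_all pure_def plus_fun_def)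
next
  fix x assume x: "x \<in> {x. \<forall>p. Fld p (x p)}"
  have "x = pure 0 (x 0) + pure 1 (x 1)"
  proof
    fix p show "x p = (pure 0 (x 0) + pure 1 (x 1)) p" by (cases p) (simp_all add: pure_def plus_fun_def)
  qed
  then show "x \<in> carrier field_struct" using x by (auto simp: carrier_def)
qed

lemma fprd_vac_right:
  assumes "\<forall>p. Fld p (x p)"
  shows "fprd k x (pure 0 idf) = (\<lambda>r. prd 1 k (x r) idf)"
proof (intro ext)
  fix r n v
  have f: "field (x p)" for p using assms Fld_field by blast
  show "fprd k x (pure 0 idf) r n v = prd 1 k (x r) idf n v"
    by (cases r) (simp_all add: fprd_def pure_def f koszul_sign_def)
qed

lemma fprd_pure_left:
  assumes a: "Fld p a" and y: "\<forall>p. Fld p (y p)"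
  shows "fprd k (pure p a) y = (\<lambda>r. prd (koszul_sign p (r + p)) k a (y (r + p)))"
proof (intro ext)
  fix r n v
  have f: "field (y p)" for p using y Fld_field by blast
  show "fprd k (pure p a) y r n v = prd (koszul_sign p (r + p)) k a (y (r + p)) n v"
    using Fld_field[OF a] by (cases p) (simp_all add: fprd_def pure_def f koszul_sign_def)
qed

lemma fprd_pure_pure:
  assumes a: "Fld p a" and b: "Fld q b"
  shows "fprd n (pure p a) (pure q b) = pure (p + q) (prd (koszul_sign p q) n a b)"
proof
  fix r
  have pb: "\<forall>r. Fld r (pure q b r)" using b by (simp add: pure_def Fld_zero)
  have pure_eq: "pure s X s = X" and pure_neq: "r \<noteq> s \<Longrightarrow> pure s X r = (\<lambda>n v. 0)" for s r X
    by (simp_all add: pure_def)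
  show "fprd n (pure p a) (pure q b) r = pure (p + q) (prd (koszul_sign p q) n a b) r"
  proof (cases "r = p + q")
    case True
    then have rp: "r + p = q" by (cases p; cases q) simp_all
    show ?thesis unfolding fprd_pure_left[OF a pb] rp by (simp only: True pure_eq)
  next
    case False
    then have rp: "r + p \<noteq> q" by (cases p; cases q; cases r) simp_all
    show ?thesis unfolding fprd_pure_left[OF a pb]
      by (simp only: pure_neq[OF False] pure_neq[OF rp] prd_zero(1)[OF Fld_field[OF a]])
  qed
qed

lemma fprd_carrier: "(\<forall>p. Fld p (x p)) \<Longrightarrow> (\<forall>p. Fld p (y p)) \<Longrightarrow> \<forall>p. Fld p (fprd k x y p)"
proof
  fix r :: bit
  assume x: "\<forall>p. Fld p (x p)" and y: "\<forall>p. Fld p (y p)"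
  have "Fld (0 + r) (prd (koszul_sign 0 r) k (x 0) (y r))" "Fld (1 + (r + 1)) (prd (koszul_sign 1 (r + 1)) k (x 1) (y (r + 1)))"
    using Fld_prd x y by blast+
  moreover have "koszul_sign 0 r = (1 :: 'k)" "0 + r = r" "1 + (r + 1) = r"
    by (cases r; simp add: koszul_sign_def)+
  ultimately show "Fld r (fprd k x y r)" unfolding fprd_def by (intro Fld_add) simp_all
qed

lemma fields: "\<forall>p. Fld p (x p) \<Longrightarrow> field (x p)"
  using Fld_field by blast

lemma prd_add_left:
  "field a \<Longrightarrow> field b \<Longrightarrow> field c \<Longrightarrow> prd s k (\<lambda>n v. a n v + b n v) c n v = prd s k a c n v + prd s k b c n v"
  using prd_comb_left[of a b c s k "-1"] by simp

lemma prd_add_right: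
  "field a \<Longrightarrow> field b \<Longrightarrow> field c \<Longrightarrow> prd s k c (\<lambda>n v. a n v + b n v) n v = prd s k c a n v + prd s k c b n v"
  using prd_comb_right[of a b c s k "-1"] by simp

lemma prd_scale_left:
  "field a \<Longrightarrow> field c \<Longrightarrow> prd s k (\<lambda>n v. scale r (a n v)) c n v = scale r (prd s k a c n v)"
  using prd_comb_left[OF field_zero, of a c s k "-r"] by simp

lemma prd_scale_right:
  "field a \<Longrightarrow> field c \<Longrightarrow> prd s k c (\<lambda>n v. scale r (a n v)) n v = scale r (prd s k c a n v)"
  using prd_comb_right[OF field_zero, of a c s k "-r"] by simp

lemma vector_space_fscale: "vector_space fscale"
  by unfold_locales (simp_all add: fscale_def fun_eq_iff scale_right_distrib scale_left_distrib)

lemma D_field_struct: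
  assumes "\<forall>p. Fld p (x p)"
  shows "D field_struct x = (\<lambda>r. deriv (x r))"
  using assms fields[OF assms] by (simp add: D_def fprd_vac_right prd_idf_deriv)

lemma Fld_deriv: "Fld p a \<Longrightarrow> Fld p (deriv a)"
proof -
  assume a: "Fld p a"
  have "Fld (p + 0) (prd (koszul_sign p 0) (- 2) a idf)" by (rule Fld_prd[OF a Fld_id])
  then show ?thesis using prd_idf_deriv[OF Fld_field[OF a]] by (cases p) (simp_all add: koszul_sign_def)
qed

text \<open>Only locality is not immediate.  It is \<open>prd_local\<close>, read in the vector space of pairs of fields,
  where \<open>fprd\<close> makes every element a field.\<close>

theorem vertex_algebra_field_struct: "vertex_algebra field_struct"
proof -
  interpret VS: vector_space fscale by (rule vector_space_fscale)
  have car: "x \<in> carrier field_struct \<longleftrightarrow> (\<forall>p. Fld p (x p))" for x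
    by (simp add: carrier_field_struct)
  have zero: "(0 :: bit \<Rightarrow> int \<Rightarrow> 'v \<Rightarrow> 'v) = (\<lambda>p n v. 0)" by (simp add: fun_eq_iff)
  have add: "x + y = (\<lambda>p n v. x p n v + y p n v)" for x y :: "bit \<Rightarrow> int \<Rightarrow> 'v \<Rightarrow> 'v" by (simp add: fun_eq_iff)
  have sub: "VS.subspace (carrier field_struct)"
    by (simp add: VS.subspace_def car zero add Fld_zero Fld_add Fld_scale fscale_def)
  interpret FS: field_space fscale "carrier field_struct"
    by unfold_locales (rule sub)
  have trunc: "\<exists>n0. \<forall>n\<ge>n0. fprd n x y = 0" if x: "\<forall>p. Fld p (x p)" and y: "\<forall>p. Fld p (y p)" for x y
  proof -
    have "\<exists>K::nat. \<forall>k\<ge>int K. prd (koszul_sign p q) k (x p) (y q) = (\<lambda>n v. 0)" for p q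
    proof -
      obtain K where "\<And>k i j v. k \<ge> int K \<Longrightarrow> v \<in> UNIV \<Longrightarrow> R (koszul_sign p q) (x p) (y q) k i j v = 0"
        using localE[OF local_Fld fields[OF x] fields[OF y]] x y by metis
      then show ?thesis by (intro exI[of _ K]) (simp add: prd_def fun_eq_iff)
    qed
    then obtain K :: "bit \<Rightarrow> bit \<Rightarrow> nat" where K: "\<And>p q k. k \<ge> int (K p q) \<Longrightarrow> prd (koszul_sign p q) k (x p) (y q) = (\<lambda>n v. 0)"
      by metis
    define n0 where "n0 = int (K 0 0) + int (K 0 1) + int (K 1 0) + int (K 1 1)"
    have "fprd n x y r i v = 0" if "n \<ge> n0" for n r i v
    proof -
      have "int (K p q) \<le> n" for p q using that by (cases p; cases q) (simp_all add: n0_def)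
      then have "prd (koszul_sign p q) n (x p) (y q) = (\<lambda>n v. 0)" for p q using K by blast
      from this[of 0 r] this[of 1 "r + 1"] show ?thesis by (simp add: fprd_def koszul_sign_def)
    qed
    then show ?thesis by (intro exI[of _ n0]) (simp add: fun_eq_iff)
  qed
  have field: "FS.field (\<lambda>n. fprd n x)" if x: "\<forall>p. Fld p (x p)" for x
    unfolding FS.field_def FS.lin_def
    using trunc[OF x] fprd_carrier[OF x]
    by (auto simp: car fprd_def fscale_def fun_eq_iff add fields[OF x] fields prd_add_right prd_scale_right scale_right_distrib)
  have loc: "\<exists>M. \<forall>m n. \<forall>c\<in>carrier field_struct.
        locality_coeff_wz field_struct M (pure p a) (pure q b) m n c
        = fscale (koszul_sign p q) (locality_coeff_zw field_struct M (pure p a) (pure q b) m n c)"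
    if a: "Fld p a" and b: "Fld q b" for p q a b
  proof -
    have pa: "\<forall>r. Fld r (pure p a r)" and pb: "\<forall>r. Fld r (pure q b r)"
      using a b by (simp_all add: pure_def Fld_zero)
    let ?\<sigma> = "koszul_sign p q :: 'k"
    let ?x = "\<lambda>n. fprd n (pure p a)" and ?y = "\<lambda>n. fprd n (pure q b)"
    obtain K where K: "\<And>k i j v. k \<ge> int K \<Longrightarrow> v \<in> UNIV \<Longrightarrow> R ?\<sigma> a b k i j v = 0"
      using localE[OF local_Fld[OF a b] Fld_field[OF a] Fld_field[OF b]] by blast
    have "FS.R ?\<sigma> ?x ?y (int K) m n c r i v = 0" if c: "\<forall>p. Fld p (c p)" for m n c r i v
    proof -
      let ?s = "r + p + q"
      have 0: "FS.R ?\<sigma> ?x ?y 0 m n c r i v =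
          prd (?\<sigma> * koszul_sign p ?s) m a (prd (koszul_sign q ?s) n b (c ?s)) i v
          - scale ?\<sigma> (prd (?\<sigma> * koszul_sign q ?s) n b (prd (koszul_sign p ?s) m a (c ?s)) i v)" for m n
      proof -
        have k: "koszul_sign p (r + p) = (?\<sigma> * koszul_sign p ?s :: 'k)" "koszul_sign q (r + q) = (?\<sigma> * koszul_sign q ?s :: 'k)"
          by (cases p; cases q; cases r; simp add: koszul_sign_def)+
        have s: "r + q + p = ?s" by (cases p; cases q; cases r) simp_all
        show ?thesis
          unfolding FS.R_0 fprd_pure_left[OF b c] fprd_pure_left[OF a c]
            fprd_pure_left[OF a fprd_carrier[OF pb c], unfolded fprd_pure_left[OF b c]]
            fprd_pure_left[OF b fprd_carrier[OF pa c], unfolded fprd_pure_left[OF a c]]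
          by (simp only: fscale_def k s minus_apply)
      qed
      have ev: "(nabla ^^ L) f m n r i v = (nabla ^^ L) (\<lambda>m n. f m n r i v) m n"
        for f :: "int \<Rightarrow> int \<Rightarrow> bit \<Rightarrow> int \<Rightarrow> 'v \<Rightarrow> 'v" and L m n
        by (induction L arbitrary: m n) (simp_all add: nabla_def[of "(nabla ^^ L) g" for g L])
      have "FS.R ?\<sigma> ?x ?y (int K) m n c r i v = (nabla ^^ K) (\<lambda>m n. FS.R ?\<sigma> ?x ?y 0 m n c r i v) m n"
        using FS.R_nabla[OF field[OF pa] field[OF pb], of c ?\<sigma> 0 K m n] c car by (simp add: ev)
      also have "\<dots> = 0"
        unfolding 0
        by (rule prd_local[OF Fld_field[OF a] Fld_field[OF b] fields[OF c]]) (simp_all add: K)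
      finally show ?thesis .
    qed
    then have "FS.R ?\<sigma> ?x ?y (int K) m n c = 0" if "c \<in> carrier field_struct" for m n c
      using that by (simp add: car fun_eq_iff)
    then show ?thesis
      using FS.locality_coeff_iff[where A=field_struct and a="pure p a" and b="pure q b" and \<sigma>="?\<sigma>" and M="int K"] field[OF pa] field[OF pb]
      by (intro exI[of _ "int K"]) simp
  qed
  show ?thesis
  proof (intro vertex_algebra.intro vertex_algebra_axioms.intro, unfold field_struct_simps car)
    show "vector_space fscale" by (rule vector_space_fscale)
    show "VS.subspace {pure p a |a. Fld p a}" for p
      unfolding VS.subspace_def
    proof (intro conjI ballI allI)
      show "0 \<in> {pure p a |a. Fld p a}"
        using Fld_zero[of p] by (intro CollectI exI[of _ "\<lambda>n v. 0"]) (simp add: pure_def fun_eq_iff)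
    next
      fix x y assume "x \<in> {pure p a |a. Fld p a}" "y \<in> {pure p a |a. Fld p a}"
      then obtain a b where ab: "Fld p a" "Fld p b" "x = pure p a" "y = pure p b" by blast
      have "x + y = pure p (\<lambda>n v. a n v + b n v)" by (simp add: ab pure_def fun_eq_iff)
      then show "x + y \<in> {pure p a |a. Fld p a}" using Fld_add[OF ab(1,2)] by blast
    next
      fix x r assume "x \<in> {pure p a |a. Fld p a}"
      then obtain a where ab: "Fld p a" "x = pure p a" by blast
      have "fscale r x = pure p (\<lambda>n v. scale r (a n v))" by (simp add: ab pure_def fun_eq_iff fscale_def)
      then show "fscale r x \<in> {pure p a |a. Fld p a}" using Fld_scale[OF ab(1)] by blast
    qed
    show "{pure 0 a |a. Fld 0 a} \<inter> {pure 1 a |a. Fld 1 a} = {0}"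
    proof (intro equalityI subsetI)
      fix x assume "x \<in> {pure 0 a |a. Fld 0 a} \<inter> {pure 1 a |a. Fld 1 a}"
      then obtain a b where ab: "x = pure 0 a" "x = pure 1 b" by blast
      have "x 1 = (\<lambda>n v. 0)" unfolding ab(1) by (simp add: pure_def)
      moreover have "x 0 = (\<lambda>n v. 0)" unfolding ab(2) by (simp add: pure_def)
      ultimately have "x p = 0" for p by (cases p) (simp_all add: fun_eq_iff)
      then show "x \<in> {0}" by (simp add: fun_eq_iff)
    next
      fix x :: "bit \<Rightarrow> int \<Rightarrow> 'v \<Rightarrow> 'v" assume "x \<in> {0}"
      then have "x = pure p (\<lambda>n v. 0)" for p by (simp add: pure_def fun_eq_iff)
      then show "x \<in> {pure 0 a |a. Fld 0 a} \<inter> {pure 1 a |a. Fld 1 a}" using Fld_zero by blast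
    qed
    show "pure 0 idf \<in> {pure 0 a |a. Fld 0 a}" using Fld_id by blast
    show "fprd n x y \<in> {pure (p + q) a |a. Fld (p + q) a}"
      if xy: "x \<in> {pure p a |a. Fld p a}" "y \<in> {pure q a |a. Fld q a}" for x p y q n
    proof -
      obtain a b where ab: "Fld p a" "Fld q b" "x = pure p a" "y = pure q b" using xy by blast
      have "fprd n x y = pure (p + q) (prd (koszul_sign p q) n a b)"
        unfolding ab(3,4) by (rule fprd_pure_pure[OF ab(1,2)])
      then show ?thesis using Fld_prd[OF ab(1,2)] by blast
    qed
    show "fprd n (a + b) c = fprd n a c + fprd n b c"
      if "\<forall>p. Fld p (a p)" "\<forall>p. Fld p (b p)" "\<forall>p. Fld p (c p)" for a b c n
      using that by (simp add: fun_eq_iff fprd_def add fields prd_add_left)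
    show "fprd n a (b + c) = fprd n a b + fprd n a c"
      if "\<forall>p. Fld p (a p)" "\<forall>p. Fld p (b p)" "\<forall>p. Fld p (c p)" for a b c n
      using that by (simp add: fun_eq_iff fprd_def add fields prd_add_right)
    show "fprd n (fscale r a) b = fscale r (fprd n a b)"
      if "\<forall>p. Fld p (a p)" "\<forall>p. Fld p (b p)" for a b n r
      using that by (simp add: fun_eq_iff fprd_def fscale_def fields prd_scale_left scale_right_distrib)
    show "fprd n a (fscale r b) = fscale r (fprd n a b)"
      if "\<forall>p. Fld p (a p)" "\<forall>p. Fld p (b p)" for a b n r
      using that by (simp add: fun_eq_iff fprd_def fscale_def fields prd_scale_right scale_right_distrib)
    show "\<exists>n0. \<forall>n\<ge>n0. fprd n a b = 0" if "\<forall>p. Fld p (a p)" "\<forall>p. Fld p (b p)" for a b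
      using trunc that by blast
    show "fprd n (pure 0 idf) a = (if n = - 1 then a else 0)" if a: "\<forall>p. Fld p (a p)" for a n
      using a by (simp add: fprd_pure_left[OF Fld_id a] koszul_sign_def prd_idf_left fields[OF a] fun_eq_iff)
    show "fprd n a (pure 0 idf) = 0" if a: "\<forall>p. Fld p (a p)" and "0 \<le> n" for a n
      using that by (simp add: fprd_vac_right[OF a] prd_idf_right_nonneg fields[OF a] fun_eq_iff)
    have Dpow: "(D field_struct ^^ j) x = (\<lambda>r. (deriv ^^ j) (x r)) \<and> (\<forall>p. Fld p ((deriv ^^ j) (x p)))"
      if x: "\<forall>p. Fld p (x p)" for x j
    proof (induction j)
      case (Suc j)
      then show ?case by (simp add: D_field_struct Fld_deriv)
    qed (simp add: x)
    show "fprd n a (pure 0 idf) = divided_D (nat (- n - 1)) field_struct a"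
      if a: "\<forall>p. Fld p (a p)" and n: "n < 0" for a n
    proof -
      define j where "j = nat (- n - 1)"
      have "n = - 1 - int j" using n by (simp add: j_def)
      then show ?thesis
        using Dpow[OF a, of j]
        by (simp add: j_def[symmetric] divided_D_def fprd_vac_right[OF a] prd_idf_right_neg fields[OF a] fun_eq_iff fscale_def)
    qed
    show "fprd n (D field_struct a) b = fscale (- of_int n) (fprd (n - 1) a b)"
      if "\<forall>p. Fld p (a p)" "\<forall>p. Fld p (b p)" for a b n
      using that by (simp add: D_field_struct fun_eq_iff fprd_def prd_deriv_left fields fscale_def scale_right_distrib)
    show "fprd n a (D field_struct b) = fscale (of_int n) (fprd (n - 1) a b) + D field_struct (fprd n a b)"
      if a: "\<forall>p. Fld p (a p)" and b: "\<forall>p. Fld p (b p)" for a b n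
    proof -
      have "D field_struct (fprd n a b) = (\<lambda>r. deriv (fprd n a b r))"
        by (rule D_field_struct) (rule fprd_carrier[OF a b])
      then show ?thesis
        using a b by (simp add: D_field_struct fun_eq_iff fprd_def prd_deriv_right fields fscale_def scale_right_distrib deriv_def[of "\<lambda>n v. f n v + g n v" for f g])
          (simp add: deriv_def scale_right_distrib)
    qed
    show "\<exists>M. \<forall>m n. \<forall>c\<in>carrier field_struct.
        locality_coeff_wz field_struct M a b m n c = fscale (koszul_sign p q) (locality_coeff_zw field_struct M a b m n c)"
      if "a \<in> {pure p a |a. Fld p a}" "b \<in> {pure q a |a. Fld q a}" for a p b q
      using loc that by blast
  qed
qed

end

section \<open>Transport of structure\<close>

text \<open>The universal property quantifies over vertex algebras in one fixed function space, into which
  the vertex algebra of fields has to be moved.\<close>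

definition transport where
  "transport sc \<phi> A = \<lparr>vscale = sc, vpart = (\<lambda>p. \<phi> ` vpart A p), vac = \<phi> (vac A),
     vprod = (\<lambda>n x y. \<phi> (vprod A n (inv_into (carrier A) \<phi> x) (inv_into (carrier A) \<phi> y)))\<rparr>"

lemma transport_simps [simp]:
  "vscale (transport sc \<phi> A) = sc" "vpart (transport sc \<phi> A) p = \<phi> ` vpart A p"
  "vac (transport sc \<phi> A) = \<phi> (vac A)"
  by (simp_all add: transport_def)

context
  fixes A :: "('k::field_char_0, 'v::ab_group_add) vertex_struct"
    and sc :: "'k \<Rightarrow> 'u::ab_group_add \<Rightarrow> 'u" and \<phi> :: "'v \<Rightarrow> 'u"
  assumes A: "vertex_algebra A" and sc: "vector_space sc"
    and add: "\<And>x y. \<phi> (x + y) = \<phi> x + \<phi> y" and scale: "\<And>r x. \<phi> (vscale A r x) = sc r (\<phi> x)"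
    and inj: "inj_on \<phi> (carrier A)"
begin

interpretation A: vertex_algebra A by (rule A)
interpretation S: vector_space sc by (rule sc)

lemma phi_0: "\<phi> 0 = 0"
  using add[of 0 0] by simp

lemma phi_minus: "\<phi> (- x) = - \<phi> x"
  using add[of x "- x"] phi_0 by (simp add: eq_neg_iff_add_eq_0 add.commute)

lemma phi_sum: "\<phi> (sum f I) = (\<Sum>i\<in>I. \<phi> (f i))"
  by (induction I rule: infinite_finite_induct) (simp_all add: phi_0 add)

lemma phi_eq_iff: "x \<in> carrier A \<Longrightarrow> y \<in> carrier A \<Longrightarrow> \<phi> x = \<phi> y \<longleftrightarrow> x = y"
  using inj by (auto dest: inj_onD)

lemma transport_carrier: "carrier (transport sc \<phi> A) = \<phi> ` carrier A"
proof (intro equalityI subsetI)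
  fix z assume "z \<in> carrier (transport sc \<phi> A)"
  then obtain x y where "x \<in> vpart A 0" "y \<in> vpart A 1" "z = \<phi> x + \<phi> y" by (auto simp: carrier_def)
  then have "z = \<phi> (x + y)" "x + y \<in> carrier A" by (auto simp: add carrier_def)
  then show "z \<in> \<phi> ` carrier A" by blast
next
  fix z assume "z \<in> \<phi> ` carrier A"
  then obtain x y where "x \<in> vpart A 0" "y \<in> vpart A 1" "z = \<phi> x + \<phi> y" by (auto simp: carrier_def add)
  then show "z \<in> carrier (transport sc \<phi> A)" by (auto simp: carrier_def)
qed

lemma transport_prod [simp]:
  "x \<in> carrier A \<Longrightarrow> y \<in> carrier A \<Longrightarrow> vprod (transport sc \<phi> A) n (\<phi> x) (\<phi> y) = \<phi> (vprod A n x y)"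
  by (simp add: transport_def inv_into_f_f[OF inj])

lemma phi_Sum_any:
  assumes "\<And>s. f s \<in> carrier A" shows "Sum_any (\<lambda>s. \<phi> (f s)) = \<phi> (Sum_any f)"
proof -
  have "\<phi> (f s) = 0 \<longleftrightarrow> f s = 0" for s
    using phi_eq_iff[OF assms, of 0] phi_0 by simp
  then show ?thesis by (simp add: Sum_any.expand_set phi_sum)
qed

lemma transport_D: "x \<in> carrier A \<Longrightarrow> D (transport sc \<phi> A) (\<phi> x) = \<phi> (D A x)"
  by (simp add: D_def)

lemma transport_D_pow: "x \<in> carrier A \<Longrightarrow> (D (transport sc \<phi> A) ^^ j) (\<phi> x) = \<phi> ((D A ^^ j) x) \<and> (D A ^^ j) x \<in> carrier A"
  by (induction j) (simp_all add: transport_D A.linD(1)[OF A.D_lin])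

theorem vertex_algebra_transport: "vertex_algebra (transport sc \<phi> A)"
proof (intro vertex_algebra.intro vertex_algebra_axioms.intro, unfold transport_simps transport_carrier)
  let ?T = "transport sc \<phi> A"
  show "vector_space sc" by (rule sc)
  show "S.subspace (\<phi> ` vpart A p)" for p
    unfolding S.subspace_def
  proof (intro conjI ballI allI)
    show "0 \<in> \<phi> ` vpart A p" using phi_0 A.part_0 by (metis image_eqI)
    show "x + y \<in> \<phi> ` vpart A p" if "x \<in> \<phi> ` vpart A p" "y \<in> \<phi> ` vpart A p" for x y
      using that A.subspace_add[OF A.subspace_part] by (auto simp: add[symmetric])
    show "sc c x \<in> \<phi> ` vpart A p" if "x \<in> \<phi> ` vpart A p" for c x
      using that A.subspace_scale[OF A.subspace_part] by (auto simp: scale[symmetric])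
  qed
  show "\<phi> ` vpart A 0 \<inter> \<phi> ` vpart A 1 = {0}"
  proof -
    have "\<phi> ` (vpart A 0 \<inter> vpart A 1) = \<phi> ` vpart A 0 \<inter> \<phi> ` vpart A 1"
      by (rule inj_on_image_Int[OF inj]) (use A.part_carrier in blast)+
    then show ?thesis by (simp add: A.parts_disjoint phi_0)
  qed
  show "\<phi> (vac A) \<in> \<phi> ` vpart A 0" using A.vac_even by blast
  show "vprod ?T n a b \<in> \<phi> ` vpart A (p + q)" if prems: "a \<in> \<phi> ` vpart A p" "b \<in> \<phi> ` vpart A q" for a p b q n
  proof -
    obtain a' b' where ab: "a' \<in> vpart A p" "b' \<in> vpart A q" "a = \<phi> a'" "b = \<phi> b'" using prems by blast
    have "vprod ?T n a b = \<phi> (vprod A n a' b')" unfolding ab(3,4)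
      by (rule transport_prod) (use ab A.part_carrier in blast)+
    then show ?thesis using A.prod_parity[OF ab(1,2)] by blast
  qed
  show "vprod ?T n (a + b) c = vprod ?T n a c + vprod ?T n b c"
    if "a \<in> \<phi> ` carrier A" "b \<in> \<phi> ` carrier A" "c \<in> \<phi> ` carrier A" for a b c n
    using that by (auto simp: add[symmetric] A.prod_add_left)
  show "vprod ?T n a (b + c) = vprod ?T n a b + vprod ?T n a c"
    if "a \<in> \<phi> ` carrier A" "b \<in> \<phi> ` carrier A" "c \<in> \<phi> ` carrier A" for a b c n
    using that by (auto simp: add[symmetric] A.prod_add_right)
  show "vprod ?T n (sc r a) b = sc r (vprod ?T n a b)"
    if "a \<in> \<phi> ` carrier A" "b \<in> \<phi> ` carrier A" for a b n r
    using that by (auto simp: scale[symmetric] A.prod_scale_left)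
  show "vprod ?T n a (sc r b) = sc r (vprod ?T n a b)"
    if "a \<in> \<phi> ` carrier A" "b \<in> \<phi> ` carrier A" for a b n r
    using that by (auto simp: scale[symmetric] A.prod_scale_right)
  show "\<exists>n0. \<forall>n\<ge>n0. vprod ?T n a b = 0" if ab: "a \<in> \<phi> ` carrier A" "b \<in> \<phi> ` carrier A" for a b
  proof -
    obtain a' b' where ab': "a' \<in> carrier A" "b' \<in> carrier A" "a = \<phi> a'" "b = \<phi> b'" using ab by blast
    obtain n0 where "\<forall>n\<ge>n0. vprod A n a' b' = 0" using A.truncation[OF ab'(1,2)] by blast
    then show ?thesis by (intro exI[of _ n0]) (simp add: ab' phi_0)
  qed
  show "vprod ?T n (\<phi> (vac A)) a = (if n = - 1 then a else 0)" if "a \<in> \<phi> ` carrier A" for a n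
    using that by (auto simp: A.vac_left phi_0)
  show "vprod ?T n a (\<phi> (vac A)) = 0" if "a \<in> \<phi> ` carrier A" "0 \<le> n" for a n
    using that by (auto simp: A.vac_right_nonneg phi_0)
  show "vprod ?T n a (\<phi> (vac A)) = divided_D (nat (- n - 1)) ?T a" if a: "a \<in> \<phi> ` carrier A" and n: "n < 0" for a n
  proof -
    obtain a' where a': "a' \<in> carrier A" "a = \<phi> a'" using a by blast
    have "vprod ?T n a (\<phi> (vac A)) = \<phi> (divided_D (nat (- n - 1)) A a')"
      unfolding a'(2) using n by (simp add: a'(1) A.vac_right_neg)
    then show ?thesis
      using conjunct1[OF transport_D_pow[OF a'(1), of "nat (- n - 1)"]]
      by (simp only: divided_D_def scale a'(2) transport_simps)
  qed
  show "vprod ?T n (D ?T a) b = sc (- of_int n) (vprod ?T (n - 1) a b)"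
    if "a \<in> \<phi> ` carrier A" "b \<in> \<phi> ` carrier A" for a b n
    using that by (auto simp: transport_D A.linD(1)[OF A.D_lin] A.D_left scale phi_minus)
  show "vprod ?T n a (D ?T b) = sc (of_int n) (vprod ?T (n - 1) a b) + D ?T (vprod ?T n a b)"
    if "a \<in> \<phi> ` carrier A" "b \<in> \<phi> ` carrier A" for a b n
    using that by (auto simp: transport_D A.linD(1)[OF A.D_lin] A.D_right scale add)
  show "\<exists>M. \<forall>m n. \<forall>c\<in>\<phi> ` carrier A. locality_coeff_wz ?T M a b m n c = sc (koszul_sign p q) (locality_coeff_zw ?T M a b m n c)"
    if ab: "a \<in> \<phi> ` vpart A p" "b \<in> \<phi> ` vpart A q" for a p b q
  proof -
    obtain a' b' where ab': "a' \<in> vpart A p" "b' \<in> vpart A q" "a = \<phi> a'" "b = \<phi> b'" using ab by blast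
    note cab = A.part_carrier[OF ab'(1)] A.part_carrier[OF ab'(2)]
    obtain M where M: "\<And>m n c. c \<in> carrier A \<Longrightarrow> locality_coeff_wz A M a' b' m n c
        = vscale A (koszul_sign p q) (locality_coeff_zw A M a' b' m n c)"
      using A.locality[OF ab'(1,2)] by blast
    have "locality_coeff_wz ?T M a b m n (\<phi> c) = \<phi> (locality_coeff_wz A M a' b' m n c)"
      "locality_coeff_zw ?T M a b m n (\<phi> c) = \<phi> (locality_coeff_zw A M a' b' m n c)"
      if c: "c \<in> carrier A" for m n c
      using c cab unfolding locality_coeff_wz_def locality_coeff_zw_def ab'(3,4)
      by (simp_all add: phi_Sum_any[symmetric] scale)
    then show ?thesis using M by (intro exI[of _ M]) (auto simp: scale)
  qed
qed

end

section \<open>A model: the differential polynomial ring\<close>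

text \<open>The ring has the variables \<open>x\<^sub>b\<^sub>,\<^sub>n\<close>, standing for the divided derivatives of the generators \<open>b\<close>.\<close>

type_synonym ('b, 'k) dpoly = "('b \<times> nat) multiset \<Rightarrow>\<^sub>0 'k"

definition scl :: "'k::field_char_0 \<Rightarrow> ('b, 'k) dpoly \<Rightarrow> ('b, 'k) dpoly" where
  "scl c v = Poly_Mapping.single 0 c * v"

definition xv :: "'b \<Rightarrow> nat \<Rightarrow> ('b, 'k::field_char_0) dpoly" where
  "xv b n = Poly_Mapping.single {#(b, n)#} 1"

lemma vector_space_scl: "vector_space scl"
  by unfold_locales (simp_all add: scl_def algebra_simps single_add mult_single flip: mult.assoc)

interpretation dpoly: vector_space scl by (rule vector_space_scl)

lemma lookup_scl [simp]: "Poly_Mapping.lookup (scl c v) K = c * Poly_Mapping.lookup v K"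
proof -
  have "Poly_Mapping.lookup (Poly_Mapping.map ((*) c) v) K = c * Poly_Mapping.lookup v K"
    by (simp add: map.rep_eq when_def)
  then show ?thesis by (simp add: scl_def mult_map_scale_conv_mult)
qed

lemma scl_mult: "scl c (u * v) = u * scl c v" "scl c u * v = scl c (u * v)"
  by (simp_all add: scl_def ac_simps)

lemma dpoly_sum: "(v :: ('b, 'k::field_char_0) dpoly) = (\<Sum>M\<in>Poly_Mapping.keys v. Poly_Mapping.single M (Poly_Mapping.lookup v M))"
proof (rule poly_mapping_eqI)
  fix K
  have "(\<Sum>M\<in>Poly_Mapping.keys v. Poly_Mapping.lookup (Poly_Mapping.single M (Poly_Mapping.lookup v M)) K) = (\<Sum>M\<in>Poly_Mapping.keys v. if M = K then Poly_Mapping.lookup v K else 0)"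
    by (intro sum.cong) (auto simp: lookup_single when_def)
  also have "\<dots> = Poly_Mapping.lookup v K" by (simp add: in_keys_iff)
  finally show "Poly_Mapping.lookup v K = Poly_Mapping.lookup (\<Sum>M\<in>Poly_Mapping.keys v. Poly_Mapping.single M (Poly_Mapping.lookup v M)) K" by (simp add: lookup_sum)
qed

lemma dpoly_induct:
  fixes v :: "('b, 'k::field_char_0) dpoly"
  assumes single: "\<And>M c. P (Poly_Mapping.single M c)" and add: "\<And>u v. P u \<Longrightarrow> P v \<Longrightarrow> P (u + v)"
  shows "P v"
proof -
  have "P 0" using single[of 0 0] by simp
  then have "P (\<Sum>M\<in>S. Poly_Mapping.single M (Poly_Mapping.lookup v M))" for S
    by (induction S rule: infinite_finite_induct) (simp_all add: single add)
  then show ?thesis by (subst dpoly_sum)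
qed

lemma triangle_swap:
  fixes f :: "nat \<Rightarrow> nat \<Rightarrow> 'a::comm_monoid_add"
  shows "(\<Sum>s\<le>n. \<Sum>t\<le>n - s. f s t) = (\<Sum>t\<le>n. \<Sum>s\<le>n - t. f s t)"
proof -
  have eq: "(\<Sum>t\<le>n - s. g t) = (\<Sum>t\<le>n. if s + t \<le> n then g t else 0)" if "s \<le> n" for s and g :: "nat \<Rightarrow> 'a"
    by (rule sum.mono_neutral_cong_left) (use that in auto)
  have "(\<Sum>s\<le>n. \<Sum>t\<le>n - s. f s t) = (\<Sum>s\<le>n. \<Sum>t\<le>n. if s + t \<le> n then f s t else 0)"
    by (intro sum.cong refl eq) simp
  also have "\<dots> = (\<Sum>t\<le>n. \<Sum>s\<le>n. if t + s \<le> n then f s t else 0)"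
    by (subst sum.swap) (simp add: add.commute)
  also have "\<dots> = (\<Sum>t\<le>n. \<Sum>s\<le>n - t. f s t)"
    by (intro sum.cong refl eq[symmetric]) simp
  finally show ?thesis .
qed

locale locality_bound =
  fixes N :: "'b::linorder \<Rightarrow> 'b \<Rightarrow> int" and kt :: "'k::field_char_0 itself"
begin

text \<open>The cocycle on the generators, a sign with
  \<open>\<epsilon>(a, b) = (-1)\<^bsup>p(a)p(b) + N(a,b)\<^esup> \<epsilon>(b, a)\<close>, which corrects the sign \<open>(-1)\<^bsup>N(a,b)\<^esup>\<close> in
  \<open>(z - w)\<^bsup>-N(a,b)\<^esup> = (-1)\<^bsup>N(a,b)\<^esup> (w - z)\<^bsup>-N(a,b)\<^esup>\<close> to the one required by the parities.\<close>

definition eps :: "'b \<Rightarrow> 'b \<Rightarrow> 'k" where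
  "eps a b = (if a \<le> b then 1 else koszul_sign (of_int (N a a)) (of_int (N b b)) * (-1) powi (N a b))"

definition gam :: "'b \<Rightarrow> 'b \<Rightarrow> nat \<Rightarrow> 'k" where
  "gam a b s = eps a b * ((-1) ^ s * (of_int (- N a b) gchoose s))"

text \<open>The effect of multiplying \<open>v\<close> by the variable \<open>x = (b, n)\<close> on the coefficients \<open>h\<close> of \<open>\<Gamma>\<^sub>a(z) v\<close>.  These
  operators commute, so folding them over a monomial is well defined.\<close>

definition shift_op :: "'b \<Rightarrow> 'b \<times> nat \<Rightarrow> (int \<Rightarrow> ('b, 'k) dpoly) \<Rightarrow> int \<Rightarrow> ('b, 'k) dpoly" where
  "shift_op a x h = (\<lambda>j. \<Sum>s\<le>snd x. scl (gam a (fst x) s) (xv (fst x) (snd x - s) * h (j - N a (fst x) - int s)))"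

definition Gm :: "'b \<Rightarrow> ('b \<times> nat) multiset \<Rightarrow> int \<Rightarrow> ('b, 'k) dpoly" where
  "Gm a M = fold_mset (shift_op a) (\<lambda>j. if j = 0 then 1 else 0) M"

text \<open>\<open>Gam a j\<close> is the coefficient of \<open>z\<^bsup>-j\<^esup>\<close> of the ring homomorphism \<open>\<Gamma>\<^sub>a(z)\<close> with
  \<open>\<Gamma>\<^sub>a(z) b(w) = \<epsilon>(a,b) (z - w)\<^bsup>-N(a,b)\<^esup> b(w)\<close> for \<open>b(w) = \<Sum>\<^sub>n x\<^sub>b\<^sub>,\<^sub>n w\<^sup>n\<close>.\<close>

definition Gam :: "'b \<Rightarrow> int \<Rightarrow> ('b, 'k) dpoly \<Rightarrow> ('b, 'k) dpoly" where
  "Gam a j v = (\<Sum>M\<in>Poly_Mapping.keys v. scl (Poly_Mapping.lookup v M) (Gm a M j))"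

lemma shift_op_commute: "comp_fun_commute (shift_op a)"
proof
  fix x y
  show "shift_op a y \<circ> shift_op a x = shift_op a x \<circ> shift_op a y"
  proof (intro ext)
    fix h j
    show "(shift_op a y \<circ> shift_op a x) h j = (shift_op a x \<circ> shift_op a y) h j"
      unfolding shift_op_def o_apply
      by (simp add: dpoly.scale_sum_right sum_distrib_left scl_def, subst sum.swap)
         (simp add: mult.assoc mult.left_commute algebra_simps)
  qed
qed

lemma Gm_empty [simp]: "Gm a {#} j = (if j = 0 then 1 else 0)"
  by (simp add: Gm_def)

lemma Gm_add: "Gm a (add_mset x M) = shift_op a x (Gm a M)"
  unfolding Gm_def by (rule comp_fun_commute.fold_mset_add_mset[OF shift_op_commute])

lemma Gam_superset:
  assumes "finite S" "Poly_Mapping.keys v \<subseteq> S"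
  shows "Gam a j v = (\<Sum>M\<in>S. scl (Poly_Mapping.lookup v M) (Gm a M j))"
  unfolding Gam_def by (rule sum.mono_neutral_left) (use assms in \<open>auto simp: in_keys_iff\<close>)

lemma Gam_add: "Gam a j (u + v) = Gam a j u + Gam a j v"
proof -
  let ?S = "Poly_Mapping.keys u \<union> Poly_Mapping.keys v"
  have "Poly_Mapping.keys (u + v) \<subseteq> ?S" by (rule keys_add)
  then show ?thesis
    using Gam_superset[of ?S "u + v"] Gam_superset[of ?S u] Gam_superset[of ?S v]
    by (simp add: lookup_add dpoly.scale_left_distrib sum.distrib)
qed

lemma Gam_scl: "Gam a j (scl c v) = scl c (Gam a j v)"
proof -
  have "Poly_Mapping.keys (scl c v) \<subseteq> Poly_Mapping.keys v" by (auto simp: in_keys_iff)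
  then show ?thesis
    using Gam_superset[of "Poly_Mapping.keys v" "scl c v"] by (simp add: Gam_def dpoly.scale_sum_right)
qed

lemma Gam_0 [simp]: "Gam a j 0 = 0"
  by (simp add: Gam_def)

lemma Gam_sum: "Gam a j (sum f I) = (\<Sum>i\<in>I. Gam a j (f i))"
  by (induction I rule: infinite_finite_induct) (simp_all add: Gam_add)

lemma Gam_single: "Gam a j (Poly_Mapping.single M c) = scl c (Gm a M j)"
  using Gam_superset[of "{M}" "Poly_Mapping.single M c"] by simp

lemma Gam_one: "Gam a j 1 = (if j = 0 then 1 else 0)"
  using Gam_single[of a j 0 1] by (simp add: scl_def)

lemma Gam_xv: "Gam a j (xv b n * v) = (\<Sum>s\<le>n. scl (gam a b s) (xv b (n - s) * Gam a (j - N a b - int s) v))"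
proof (induction v rule: dpoly_induct)
  case (1 M c)
  have "xv b n * Poly_Mapping.single M c = Poly_Mapping.single (add_mset (b, n) M) c"
    by (simp add: xv_def mult_single)
  then show ?case
    by (simp add: Gam_single Gm_add shift_op_def dpoly.scale_sum_right scl_mult mult.commute)
next
  case (2 u v)
  then show ?case by (simp add: Gam_add distrib_left sum.distrib dpoly.scale_right_distrib)
qed

lemma Gam_finite: "\<exists>L::int. \<forall>j. \<bar>j\<bar> \<ge> L \<longrightarrow> Gam a j v = 0"
proof (induction v rule: dpoly_induct)
  case (1 M c)
  have "\<exists>L::int. \<forall>j. \<bar>j\<bar> \<ge> L \<longrightarrow> Gm a M j = 0"
  proof (induction M)
    case empty
    then show ?case by (intro exI[of _ 1]) auto
  next
    case (add x M)
    then obtain L :: int where L: "\<And>j. \<bar>j\<bar> \<ge> L \<Longrightarrow> Gm a M j = 0" by blast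
    have "Gm a (add_mset x M) j = 0" if "\<bar>j\<bar> \<ge> L + \<bar>N a (fst x)\<bar> + int (snd x)" for j
      unfolding Gm_add shift_op_def by (rule sum.neutral) (use that L in auto)
    then show ?case by blast
  qed
  then show ?case by (auto simp: Gam_single)
next
  case (2 u v)
  then obtain L1 L2 :: int where "\<forall>j. \<bar>j\<bar> \<ge> L1 \<longrightarrow> Gam a j u = 0" "\<forall>j. \<bar>j\<bar> \<ge> L2 \<longrightarrow> Gam a j v = 0" by blast
  then show ?case by (intro exI[of _ "max L1 L2"]) (simp add: Gam_add)
qed

lemma Gam_commute: "Gam a i (Gam b j v) = Gam b j (Gam a i v)"
proof (induction v rule: dpoly_induct)
  case (1 M c)
  have "Gam a i (Gam b j (Poly_Mapping.single M 1)) = Gam b j (Gam a i (Poly_Mapping.single M 1))"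
  proof (induction M arbitrary: i j)
    case empty
    then show ?case using Gam_one by simp
  next
    case (add x M)
    obtain d n where x: "x = (d, n)" by (cases x)
    let ?v = "Poly_Mapping.single M 1 :: ('b, 'k) dpoly"
    have v: "Poly_Mapping.single (add_mset x M) 1 = xv d n * ?v" by (simp add: xv_def mult_single x)
    have e: "Gam a i (Gam b j (xv d n * ?v)) = (\<Sum>s\<le>n. \<Sum>t\<le>n - s. scl (gam b d s * gam a d t)
        (xv d (n - s - t) * Gam a (i - N a d - int t) (Gam b (j - N b d - int s) ?v)))" for a b i j
      by (simp add: Gam_xv Gam_sum Gam_scl dpoly.scale_sum_right)
    show ?case unfolding v e
      by (subst triangle_swap) (intro sum.cong refl, simp add: add.IH mult.commute add.commute diff_commute)
  qed
  moreover have "Poly_Mapping.single M c = scl c (Poly_Mapping.single M 1)"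
    by (simp add: scl_def mult_single)
  ultimately show ?case by (simp add: Gam_scl)
next
  case (2 u v)
  then show ?case by (simp add: Gam_add)
qed

lemma Gam2_finite: "\<exists>L::int. \<forall>i j. i \<ge> L \<or> j \<ge> L \<longrightarrow> Gam a i (Gam b j v) = 0"
proof -
  obtain L1 :: int where L1: "\<forall>j. \<bar>j\<bar> \<ge> L1 \<longrightarrow> Gam b j v = 0" using Gam_finite by blast
  obtain L2 :: int where L2: "\<forall>j. \<bar>j\<bar> \<ge> L2 \<longrightarrow> Gam a j v = 0" using Gam_finite by blast
  have "Gam a i (Gam b j v) = 0" if "i \<ge> max L1 L2 \<or> j \<ge> max L1 L2" for i j
  proof (cases "j \<ge> max L1 L2")
    case True
    then have "\<bar>j\<bar> \<ge> L1" by linarith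
    then show ?thesis using L1 by simp
  next
    case False
    then have "\<bar>i\<bar> \<ge> L2" using that by linarith
    then have "Gam a i v = 0" using L2 by simp
    then show ?thesis unfolding Gam_commute[of a i b j v] by simp
  qed
  then show ?thesis by blast
qed

text \<open>The field of the generator \<open>a\<close> is \<open>a(z) \<Gamma>\<^sub>a(z)\<close>.\<close>

definition gen :: "'b \<Rightarrow> int \<Rightarrow> ('b, 'k) dpoly \<Rightarrow> ('b, 'k) dpoly" where
  "gen a m v = Sum_any (\<lambda>i::nat. xv a i * Gam a (int i + m + 1) v)"

lemma gen_eq_sum:
  assumes "\<And>j. j \<ge> int n + m + 1 \<Longrightarrow> Gam a j v = 0"
  shows "gen a m v = (\<Sum>i<n. xv a i * Gam a (int i + m + 1) v)"
  unfolding gen_def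
proof (rule Sum_any.expand_superset)
  show "{i. xv a i * Gam a (int i + m + 1) v \<noteq> 0} \<subseteq> {..<n}"
  proof
    fix i assume "i \<in> {i. xv a i * Gam a (int i + m + 1) v \<noteq> 0}"
    then have "Gam a (int i + m + 1) v \<noteq> 0" by auto
    then have "\<not> int i + m + 1 \<ge> int n + m + 1" using assms by blast
    then show "i \<in> {..<n}" by simp
  qed
qed simp

lemma Gam_bound: "\<exists>L::int. \<forall>j\<ge>L. Gam a j v = 0"
  using Gam_finite[of a v] by (metis abs_ge_self order_trans)

sublocale sp: field_space scl UNIV
  by unfold_locales (simp add: dpoly.subspace_def)

lemma field_gen: "sp.field (gen a)"
  unfolding sp.field_def sp.lin_def
proof (intro conjI allI ballI)
  fix n and u v :: "('b, 'k) dpoly"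
  obtain L1 L2 where L: "\<forall>j\<ge>L1. Gam a j u = 0" "\<forall>j\<ge>L2. Gam a j v = 0" using Gam_bound by metis
  define k where "k = nat (max L1 L2 - n - 1)"
  have k: "int k + n + 1 \<ge> max L1 L2" unfolding k_def by linarith
  have Lu: "Gam a j u = 0" and Lv: "Gam a j v = 0" if "j \<ge> int k + n + 1" for j
    using L that k by (meson max.boundedE order_trans)+
  show "gen a n (u + v) = gen a n u + gen a n v"
    using gen_eq_sum[OF Lu] gen_eq_sum[OF Lv] gen_eq_sum[of k n a "u + v"]
    by (simp add: Lu Lv Gam_add distrib_left sum.distrib)
  show "gen a n (scl c v) = scl c (gen a n v)" for c
    using gen_eq_sum[OF Lv] gen_eq_sum[of k n a "scl c v"]
    by (simp add: Lv Gam_scl scl_mult(1)[symmetric] dpoly.scale_sum_right)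
  show "\<exists>n0. \<forall>n\<ge>n0. gen a n v = 0"
  proof (intro exI[of _ L2] allI impI)
    fix n assume "n \<ge> L2"
    then show "gen a n v = 0" by (subst gen_eq_sum[of 0]) (use L in auto)
  qed
qed simp

text \<open>The coefficients of \<open>a(x) b(y) \<Gamma>\<^sub>a(x) \<Gamma>\<^sub>b(y) v\<close>, which is symmetric in \<open>(a, x)\<close> and \<open>(b, y)\<close>;
  the product \<open>a(x) \<Gamma>\<^sub>a(x) b(y) \<Gamma>\<^sub>b(y)\<close> is its multiple by \<open>\<epsilon>(a,b) (x - y)\<^bsup>-N(a,b)\<^esup>\<close>.\<close>

definition W :: "'b \<Rightarrow> 'b \<Rightarrow> ('b, 'k) dpoly \<Rightarrow> int \<Rightarrow> int \<Rightarrow> ('b, 'k) dpoly" where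
  "W a b v p m = Sum_any (\<lambda>i::nat. Sum_any (\<lambda>j::nat. xv a i * (xv b j * Gam a (int i + p + 1) (Gam b (int j + m + 1) v))))"

lemma W_eq_sum:
  assumes L: "\<And>i j. i \<ge> L \<or> j \<ge> L \<Longrightarrow> Gam a i (Gam b j v) = 0"
    and n: "int n1 + p + 1 \<ge> L" "int n2 + m + 1 \<ge> L"
  shows "W a b v p m = (\<Sum>i<n1. \<Sum>j<n2. xv a i * (xv b j * Gam a (int i + p + 1) (Gam b (int j + m + 1) v)))"
proof -
  let ?f = "\<lambda>i j. xv a i * (xv b j * Gam a (int i + p + 1) (Gam b (int j + m + 1) v))"
  have f0: "?f i j = 0" if "i \<ge> n1 \<or> j \<ge> n2" for i j
    using L[of "int i + p + 1" "int j + m + 1"] that n by auto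
  have inner: "Sum_any (?f i) = (\<Sum>j<n2. ?f i j)" for i
    by (rule Sum_any.expand_superset) (use f0 in \<open>auto simp: not_less[symmetric]\<close>)
  have "(\<Sum>j<n2. ?f i j) = 0" if "i \<ge> n1" for i
    by (rule sum.neutral) (use f0 that in auto)
  then have "Sum_any (\<lambda>i. \<Sum>j<n2. ?f i j) = (\<Sum>i<n1. \<Sum>j<n2. ?f i j)"
    by (intro Sum_any.expand_superset) (auto simp: not_less[symmetric])
  then show ?thesis unfolding W_def inner .
qed

lemma W_trunc: "\<exists>j0. \<forall>i. \<forall>j\<ge>j0. W a b v i j = 0"
proof -
  obtain L where L: "\<And>i j. i \<ge> L \<or> j \<ge> L \<Longrightarrow> Gam a i (Gam b j v) = 0" using Gam2_finite by metis
  have "W a b v p m = 0" if "m \<ge> L" for p m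
    using W_eq_sum[OF L, where ?n1.0="nat (L - p - 1)" and p=p and ?n2.0=0 and m=m] that by simp
  then show ?thesis by blast
qed

lemma W_sym: "W a b v p m = W b a v m p"
proof -
  obtain L where L: "\<And>i j. i \<ge> L \<or> j \<ge> L \<Longrightarrow> Gam a i (Gam b j v) = 0" using Gam2_finite by metis
  then have L': "\<And>i j. i \<ge> L \<or> j \<ge> L \<Longrightarrow> Gam b i (Gam a j v) = 0" using Gam_commute by metis
  define n1 n2 where "n1 = nat (L - p - 1)" and "n2 = nat (L - m - 1)"
  have n: "int n1 + p + 1 \<ge> L" "int n2 + m + 1 \<ge> L" by (simp_all add: n1_def n2_def)
  have "W a b v p m = (\<Sum>i<n1. \<Sum>j<n2. xv a i * (xv b j * Gam a (int i + p + 1) (Gam b (int j + m + 1) v)))"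
    by (rule W_eq_sum[OF L n])
  also have "\<dots> = (\<Sum>j<n2. \<Sum>i<n1. xv a i * (xv b j * Gam a (int i + p + 1) (Gam b (int j + m + 1) v)))"
    by (rule sum.swap)
  also have "\<dots> = (\<Sum>j<n2. \<Sum>i<n1. xv b j * (xv a i * Gam b (int j + m + 1) (Gam a (int i + p + 1) v)))"
    by (simp only: Gam_commute[of a _ b] mult.left_commute)
  also have "\<dots> = W b a v m p"
    by (rule W_eq_sum[OF L' n(2,1), symmetric])
  finally show ?thesis .
qed

lemma sum_triangle_reindex:
  fixes f :: "nat \<Rightarrow> nat \<Rightarrow> 'a::comm_monoid_add"
  assumes "\<And>s j. j + s \<ge> J \<Longrightarrow> f s j = 0"
  shows "(\<Sum>j<J. \<Sum>s\<le>j. f s (j - s)) = (\<Sum>s<J. \<Sum>j<J. f s j)"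
proof -
  have "(\<Sum>j<J. \<Sum>s\<le>j. f s (j - s)) = (\<Sum>(j, s)\<in>(SIGMA j:{..<J}. {..j}). f s (j - s))"
    by (simp add: sum.Sigma)
  also have "\<dots> = (\<Sum>(s, j)\<in>{(s, j). s + j < J}. f s j)"
    by (rule sum.reindex_bij_witness[of _ "\<lambda>(s, j). (s + j, s)" "\<lambda>(j, s). (s, j - s)"]) auto
  also have "\<dots> = (\<Sum>(s, j)\<in>{..<J} \<times> {..<J}. f s j)"
  proof (rule sum.mono_neutral_left)
    have "f s j = 0" if "\<not> s + j < J" for s j using assms[of j s] that by (simp add: add.commute)
    then show "\<forall>x\<in>{..<J} \<times> {..<J} - {(s, j). s + j < J}. (case x of (s, j) \<Rightarrow> f s j) = 0" by auto
  qed auto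
  also have "\<dots> = (\<Sum>s<J. \<Sum>j<J. f s j)" by (simp add: sum.cartesian_product)
  finally show ?thesis .
qed

text \<open>Moving \<open>\<Gamma>\<^sub>a(x)\<close> to the right of \<open>b(y)\<close> gives the factor \<open>\<epsilon>(a,b) (x - y)\<^bsup>-N(a,b)\<^esup>\<close>, expanded for
  \<open>\<bar>x\<bar> > \<bar>y\<bar>\<close>.\<close>

lemma gen_gen: "gen a p (gen b m v) = scl (eps a b) (sp.expand (-1) (W a b v) (- N a b) p m)"
proof -
  let ?N = "N a b"
  obtain L where L: "\<And>i j. i \<ge> L \<or> j \<ge> L \<Longrightarrow> Gam a i (Gam b j v) = 0" using Gam2_finite by metis
  obtain L1 where L1: "\<And>j. j \<ge> L1 \<Longrightarrow> Gam b j v = 0" using Gam_bound by metis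
  obtain L2 where L2: "\<And>j. j \<ge> L2 \<Longrightarrow> Gam a j (gen b m v) = 0" using Gam_bound by metis
  define J where "J = nat (max L L1 - m - 1)"
  define I where "I = nat (max (L - p + ?N + int J) (L2 - p) + 1)"
  have J: "int J + m + 1 \<ge> L" "int J + m + 1 \<ge> L1" unfolding J_def by linarith+
  have I: "int I + (p - ?N - int s) + 1 \<ge> L" if "s < J" for s
    using that unfolding I_def by linarith
  have I2: "int I + p + 1 \<ge> L2" unfolding I_def by linarith
  have inner: "Gam a l (gen b m v) = (\<Sum>s<J. \<Sum>j<J. scl (gam a b s) (xv b j * Gam a (l - ?N - int s) (Gam b (int j + (m + int s) + 1) v)))" for l
  proof -
    define f where "f = (\<lambda>s j. scl (gam a b s) (xv b j * Gam a (l - ?N - int s) (Gam b (int j + (m + int s) + 1) v)))"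
    have "gen b m v = (\<Sum>j<J. xv b j * Gam b (int j + m + 1) v)"
      by (rule gen_eq_sum) (use J L1 in auto)
    then have "Gam a l (gen b m v) = (\<Sum>j<J. \<Sum>s\<le>j. scl (gam a b s) (xv b (j - s) * Gam a (l - ?N - int s) (Gam b (int j + m + 1) v)))"
      by (simp add: Gam_sum Gam_xv)
    also have "\<dots> = (\<Sum>j<J. \<Sum>s\<le>j. f s (j - s))"
      by (intro sum.cong refl) (simp add: f_def of_nat_diff)
    also have "\<dots> = (\<Sum>s<J. \<Sum>j<J. f s j)"
      by (rule sum_triangle_reindex) (use L1 J in \<open>auto simp: f_def\<close>)
    finally show ?thesis by (simp add: f_def)
  qed
  have "gen a p (gen b m v) = (\<Sum>i<I. xv a i * Gam a (int i + p + 1) (gen b m v))"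
    by (rule gen_eq_sum) (use I2 L2 in auto)
  also have "\<dots> = (\<Sum>i<I. \<Sum>s<J. scl (gam a b s) (\<Sum>j<J. xv a i * (xv b j * Gam a (int i + (p - ?N - int s) + 1) (Gam b (int j + (m + int s) + 1) v))))"
    by (simp add: inner sum_distrib_left dpoly.scale_sum_right scl_mult(1)[symmetric] algebra_simps)
  also have "\<dots> = (\<Sum>s<J. scl (gam a b s) (\<Sum>i<I. \<Sum>j<J. xv a i * (xv b j * Gam a (int i + (p - ?N - int s) + 1) (Gam b (int j + (m + int s) + 1) v))))"
    by (subst sum.swap) (simp add: dpoly.scale_sum_right)
  also have "\<dots> = (\<Sum>s<J. scl (gam a b s) (W a b v (p - ?N - int s) (m + int s)))"
  proof (intro sum.cong refl)
    fix s assume "s \<in> {..<J}"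
    then have n: "int I + (p - ?N - int s) + 1 \<ge> L" "int J + (m + int s) + 1 \<ge> L" using I J by auto
    show "scl (gam a b s) (\<Sum>i<I. \<Sum>j<J. xv a i * (xv b j * Gam a (int i + (p - ?N - int s) + 1) (Gam b (int j + (m + int s) + 1) v)))
        = scl (gam a b s) (W a b v (p - ?N - int s) (m + int s))"
      by (simp only: W_eq_sum[OF L n])
  qed
  also have "\<dots> = scl (eps a b) (\<Sum>s<J. scl ((-1) ^ s * (of_int (- ?N) gchoose s)) (W a b v (p + (- ?N) - int s) (m + int s)))"
    by (simp add: dpoly.scale_sum_right gam_def)
  also have "(\<Sum>s<J. scl ((-1) ^ s * (of_int (- ?N) gchoose s)) (W a b v (p + (- ?N) - int s) (m + int s)))
      = sp.expand (-1) (W a b v) (- ?N) p m"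
  proof (rule sp.expand_eq_sum[symmetric])
    fix i j assume "m + int J \<le> j"
    then show "W a b v i j = 0"
      using W_eq_sum[OF L, where ?n1.0="nat (L - i - 1)" and p=i and ?n2.0=0 and m=j] J by simp
  qed
  finally show ?thesis .
qed

lemma eps_swap:
  assumes "N a b = N b a"
  shows "eps a b = koszul_sign (of_int (N a a)) (of_int (N b b)) * (-1) powi (N a b) * eps b a"
proof -
  have sq: "(-1 :: 'k) powi n * (-1) powi n = 1" for n
    by (simp add: power_int_mult_distrib[symmetric])
  have ks2: "koszul_sign (of_int n) (of_int n) * (-1) powi n = (1 :: 'k)" for n
  proof (cases "even n")
    case True
    then obtain k where "n = 2 * k" by blast
    then have "(of_int n :: bit) = 0" by simp
    then show ?thesis using True by (simp add: koszul_sign_def)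
  next
    case False
    then obtain k where "n = 2 * k + 1" by (rule oddE)
    then have "(of_int n :: bit) = 1" by simp
    then show ?thesis using False by (simp add: koszul_sign_def)
  qed
  consider "a < b" | "a = b" | "b < a" by force
  then show ?thesis
  proof cases
    case 1
    define \<kappa> P where "\<kappa> = (koszul_sign (of_int (N a a)) (of_int (N b b)) :: 'k)" and "P = (-1 :: 'k) powi (N a b)"
    have "\<kappa> * P * (\<kappa> * P) = (\<kappa> * \<kappa>) * (P * P)" by (simp only: ac_simps)
    also have "\<kappa> * \<kappa> = 1" by (simp add: \<kappa>_def)
    also have "P * P = 1" unfolding P_def by (rule sq)
    finally have "\<kappa> * P * (\<kappa> * P) = 1" by simp
    moreover have "eps a b = 1" using 1 by (simp add: eps_def less_imp_le)
    moreover have "\<not> b \<le> a" using 1 by (simp only: not_le)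
    then have "eps b a = \<kappa> * P"
      using assms by (simp add: eps_def \<kappa>_def P_def koszul_commute[of "of_int (N b b)"])
    ultimately show ?thesis by (simp only: \<kappa>_def P_def)
  next
    case 2
    then show ?thesis using ks2 by simp
  next
    case 3
    then have "\<not> a \<le> b" "b \<le> a" by (simp_all only: not_le less_imp_le)
    then show ?thesis by (simp add: eps_def)
  qed
qed

text \<open>Multiplied by \<open>(x - y)\<^bsup>N(a,b)\<^esup>\<close>, both orders become multiples of the symmetric \<open>W\<close>.\<close>

lemma gen_R:
  assumes "N a b = N b a"
  shows "sp.R (koszul_sign (of_int (N a a)) (of_int (N b b))) (gen a) (gen b) (N a b) p m v = 0"
proof -
  have E: "sp.E (gen a) (gen b) (N a b) p m v = scl (eps a b) (W a b v p m)" for a b p m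
  proof -
    have t: "\<exists>j0. \<forall>i. \<forall>j\<ge>j0. sp.expand (-1) (W a b v) (- N a b) i j = 0"
      using sp.expand_trunc W_trunc by metis
    show ?thesis
      unfolding sp.E_def gen_gen sp.expand_scale[OF t] sp.expand_expand[OF W_trunc] by simp
  qed
  show ?thesis
    unfolding sp.R_def E E[of b a, folded assms] W_sym[of b a] eps_swap[OF assms] by simp
qed

end

section \<open>Triangularity of the right-normed monomials\<close>

lemma span_image_in:
  fixes f :: "('b, 'k::field_char_0) dpoly \<Rightarrow> ('b, 'k) dpoly"
  assumes f: "\<And>u v. f (u + v) = f u + f v" "\<And>c v. f (scl c v) = scl c (f v)"
    and S: "\<And>x. x \<in> S \<Longrightarrow> f x \<in> dpoly.span T" and v: "v \<in> dpoly.span S"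
  shows "f v \<in> dpoly.span T"
  using v
proof (induction rule: dpoly.span_induct_alt)
  case base
  then show ?case using f(2)[of 0 0] by (simp add: dpoly.span_zero)
next
  case (step c x y)
  then show ?case by (simp add: f dpoly.span_add dpoly.span_scale S)
qed

definition xmono :: "('b \<times> nat) list \<Rightarrow> ('b, 'k::field_char_0) dpoly" where
  "xmono l = Poly_Mapping.single (mset l) 1"

lemma xmono_Nil: "xmono [] = 1"
  by (simp add: xmono_def)

lemma xmono_Cons: "xv b n * xmono l = xmono ((b, n) # l)"
  by (simp add: xmono_def xv_def mult_single)

text \<open>The monomials with which \<open>\<Gamma>\<^sub>a(z)\<close> can replace a monomial: every exponent may drop, and the total drop
  \<open>d\<close> is determined by the power of \<open>z\<close>.\<close>

definition below :: "'b list \<Rightarrow> nat list \<Rightarrow> int \<Rightarrow> ('b, 'k::field_char_0) dpoly set" where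
  "below bs ns d = {xmono (zip bs q) | q. list_all2 (\<le>) q ns \<and> int (sum_list ns) - int (sum_list q) = d}"

lemma list_all2_le_sum:
  "list_all2 (\<le>) q (ns :: nat list) \<Longrightarrow> sum_list q \<le> sum_list ns \<and> (sum_list q = sum_list ns \<longrightarrow> q = ns)"
  by (induction rule: list_all2_induct) auto

lemma below_neg: "d < 0 \<Longrightarrow> below bs ns d = {}"
  unfolding below_def using list_all2_le_sum by fastforce

text \<open>Dominance of sequences: by summation by parts, the condition on all decreasing weights \<open>c\<close> says
  that the partial sums of \<open>q\<close> are at least those of \<open>ns\<close> and that the totals agree.  The weights are used
  directly: \<open>c = ns\<close> compares the sums of squares.\<close>

definition dot :: "int list \<Rightarrow> nat list \<Rightarrow> int" where
  "dot c q = sum_list (map2 (\<lambda>x n. x * int n) c q)"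

lemma dot_simps [simp]: "dot [] q = 0" "dot c [] = 0" "dot (x # c) (n # q) = x * int n + dot c q"
  by (simp_all add: dot_def)

definition dominates :: "nat list \<Rightarrow> nat list \<Rightarrow> bool" where
  "dominates q ns \<longleftrightarrow> length q = length ns \<and> (\<forall>c. length c = length ns \<longrightarrow> sorted_wrt (\<ge>) c \<longrightarrow> dot c ns \<le> dot c q)"

lemma dot_diff_le:
  "list_all2 (\<le>) q q' \<Longrightarrow> length c = length q \<Longrightarrow> \<forall>x\<in>set c. x \<le> y \<Longrightarrow>
    dot c q' - dot c q \<le> y * (int (sum_list q') - int (sum_list q))"
proof (induction q q' arbitrary: c rule: list_all2_induct)
  case (Cons n q n' q')
  then obtain x c' where c: "c = x # c'" by (cases c) auto
  have "x * (int n' - int n) \<le> y * (int n' - int n)"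
    by (rule mult_right_mono) (use Cons c in auto)
  moreover have "dot c' q' - dot c' q \<le> y * (int (sum_list q') - int (sum_list q))"
    using Cons c by simp
  ultimately show ?case by (simp add: c algebra_simps)
qed simp

text \<open>Units taken away from the tail and added in front count with a larger weight than before.\<close>

lemma dominates_Cons:
  assumes "dominates q' ns" "list_all2 (\<le>) q q'" "int (sum_list q') - int (sum_list q) = int i - int e"
  shows "dominates (i # q) (e # ns)"
  unfolding dominates_def
proof (intro conjI allI impI)
  have len: "length q = length q'" "length q' = length ns"
    using assms by (auto simp: dominates_def dest: list_all2_lengthD)
  then show "length (i # q) = length (e # ns)" by simp
  fix c :: "int list" assume c: "length c = length (e # ns)" "sorted_wrt (\<ge>) c"
  then obtain y c' where yc: "c = y # c'" by (cases c) auto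
  have "dot c' q' - dot c' q \<le> y * (int i - int e)"
    using dot_diff_le[OF assms(2), of c' y] c yc len assms(3) by simp
  moreover have "dot c' ns \<le> dot c' q'" using assms(1) c yc by (simp add: dominates_def)
  ultimately show "dot c (e # ns) \<le> dot c (i # q)" by (simp add: yc algebra_simps)
qed

definition sumsq :: "nat list \<Rightarrow> int" where
  "sumsq q = (\<Sum>n\<leftarrow>q. (int n)\<^sup>2)"

lemma sumsq_dot:
  "length q = length ns \<Longrightarrow> 2 * dot (map int ns) q - sumsq ns \<le> sumsq q \<and>
    (q \<noteq> ns \<longrightarrow> 2 * dot (map int ns) q - sumsq ns < sumsq q)"
proof (induction q ns rule: list_induct2)
  case (Cons y q n ns)
  have "0 \<le> (int y - int n)\<^sup>2" "y \<noteq> n \<longrightarrow> 0 < (int y - int n)\<^sup>2" by auto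
  then have "2 * (int n * int y) - (int n)\<^sup>2 \<le> (int y)\<^sup>2" "y \<noteq> n \<longrightarrow> 2 * (int n * int y) - (int n)\<^sup>2 < (int y)\<^sup>2"
    by (auto simp: power2_diff mult.commute)
  then show ?case using Cons.IH by (auto simp: sumsq_def algebra_simps)
qed (simp add: sumsq_def)

lemma dot_self: "dot (map int ns) ns = sumsq ns"
  by (induction ns) (simp_all add: sumsq_def power2_eq_square)

text \<open>\<open>\<Sum> (q\<^sub>i - n\<^sub>i)\<^sup>2 > 0\<close> and \<open>\<Sum> n\<^sub>i q\<^sub>i \<ge> \<Sum> n\<^sub>i\<^sup>2\<close>.\<close>

lemma dominates_sumsq:
  assumes "dominates q ns" "sorted_wrt (\<ge>) ns" "q \<noteq> ns"
  shows "sumsq ns < sumsq q"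
proof -
  have "sorted_wrt (\<ge>) (map int ns)" using assms(2) by (simp add: sorted_wrt_map)
  then have "dot (map int ns) ns \<le> dot (map int ns) q" using assms(1) by (simp add: dominates_def)
  then show ?thesis using sumsq_dot[of q ns] assms by (simp add: dot_self dominates_def)
qed

lemma sorted_wrt_mset_unique:
  assumes P: "\<And>x y. P x y \<Longrightarrow> P y x \<Longrightarrow> x = y"
  shows "sorted_wrt P xs \<Longrightarrow> sorted_wrt P ys \<Longrightarrow> mset xs = mset ys \<Longrightarrow> xs = ys"
proof (induction xs arbitrary: ys)
  case (Cons x xs)
  then obtain y ys' where ys: "ys = y # ys'" by (cases ys) auto
  have "x = y"
  proof (rule ccontr)
    assume "x \<noteq> y"
    have "set (x # xs) = set (y # ys')" using Cons.prems(3) ys by (metis set_mset_mset)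
    then have "x \<in> set ys'" "y \<in> set xs" using \<open>x \<noteq> y\<close> by auto
    then have "P x y" "P y x" using Cons.prems ys by auto
    then show False using P \<open>x \<noteq> y\<close> by blast
  qed
  then show ?case using Cons ys by auto
qed simp

lemma expos_inj: "map fst w = map fst w' \<Longrightarrow> expos N w = expos N w' \<Longrightarrow> w = w'"
proof (induction w arbitrary: w')
  case (Cons x w)
  then obtain y v where w': "w' = y # v" by (cases w') auto
  have e: "expos N (x # w) = (- snd x - 1 + (\<Sum>b\<in>#mset (map fst w). N (fst x) b)) # expos N w" for x w
    by (cases x) simp
  have "w = v" using Cons.prems by (intro Cons.IH) (simp_all add: w' e del: expos.simps)
  moreover have "fst x = fst y" using Cons.prems w' by simp
  moreover have "snd x = snd y" using Cons.prems(2) calculation unfolding w' e by simp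
  ultimately show ?case by (simp add: w' prod_eq_iff)
qed simp

text \<open>The exponents of a word listed with their letters; for straight words this list is sorted, by
  decreasing exponents and increasing letters.\<close>

definition lead :: "('b \<Rightarrow> 'b \<Rightarrow> int) \<Rightarrow> ('b \<times> int) list \<Rightarrow> ('b \<times> nat) list" where
  "lead N w = zip (map fst w) (map nat (expos N w))"

lemma straight_Cons:
  assumes "straight N ((a, m) # w)"
  shows "straight N w" "0 \<le> - m - 1 + (\<Sum>b\<in>#mset (map fst w). N a b)"
proof -
  show "straight N w" using assms by (cases w) auto
  show "0 \<le> - m - 1 + (\<Sum>b\<in>#mset (map fst w). N a b)" using straight_expos_nonneg[OF assms] by simp
qed

lemma lead_sorted:
  fixes w :: "('b::linorder \<times> int) list"
  shows "straight N w \<Longrightarrow> sorted_wrt (\<lambda>x y. snd y < snd x \<or> snd x = snd y \<and> fst x \<le> fst y) (lead N w)"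
proof (induction N w rule: straight.induct)
  case (3 N a m b m' w)
  have tr: "transp (\<lambda>x y :: 'b \<times> nat. snd y < snd x \<or> snd x = snd y \<and> fst x \<le> fst y)"
    by (auto simp: transp_def)
  let ?e = "hd (expos N ((a, m) # (b, m') # w))" and ?e' = "hd (expos N ((b, m') # w))"
  have st: "straight N ((b, m') # w)" using "3.prems" by simp
  have l1: "lead N ((a, m) # (b, m') # w) = (a, nat ?e) # (b, nat ?e') # lead N w"
    and l2: "lead N ((b, m') # w) = (b, nat ?e') # lead N w"
    by (simp_all add: lead_def)
  have e': "0 \<le> ?e'" using straight_expos_nonneg[OF st] by simp
  have "if a \<le> b then ?e' \<le> ?e else ?e' < ?e" using "3.prems" by (simp add: Let_def del: expos.simps)
  then have "nat ?e' < nat ?e \<or> nat ?e = nat ?e' \<and> a \<le> b" using e' by (auto split: if_splits simp del: expos.simps)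
  then show ?case
    unfolding l1 sorted_wrt2[OF tr] using "3.IH"[OF st] unfolding l2 by (simp only: fst_conv snd_conv simp_thms)
qed (auto simp: lead_def)

lemma lead_inj:
  assumes "straight N w" "straight N w'" "mset (lead N w) = mset (lead N w')"
  shows "w = w'"
proof -
  have "lead N w = lead N w'"
    by (rule sorted_wrt_mset_unique[OF _ lead_sorted[OF assms(1)] lead_sorted[OF assms(2)] assms(3)])
       (auto simp: prod_eq_iff)
  then have "map fst (lead N w) = map fst (lead N w')" "map snd (lead N w) = map snd (lead N w')" by simp_all
  moreover have "map fst (lead N w) = map fst w" "map snd (lead N w) = map nat (expos N w)" for w
    by (simp_all add: lead_def)
  ultimately have 1: "map fst w = map fst w'" and 2: "map nat (expos N w) = map nat (expos N w')"
    by metis+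
  have "map int (map nat (expos N w)) = expos N w" if "straight N w" for w
    using straight_expos_nonneg[OF that] by (simp add: map_idI)
  then have "expos N w = expos N w'" using 2 assms by metis
  then show ?thesis using 1 expos_inj by blast
qed

context locality_bound
begin

lemma gen_lin: "gen a m (u + v) = gen a m u + gen a m v" "gen a m (scl c v) = scl c (gen a m v)"
  using sp.linD[OF sp.fieldD(1)[OF field_gen]] by simp_all

lemma Gam_mono:
  "length bs = length ns \<Longrightarrow> Gam a j (xmono (zip bs ns)) \<in> dpoly.span (below bs ns (j - (\<Sum>b\<leftarrow>bs. N a b)))"
proof (induction bs ns arbitrary: j rule: list_induct2)
  case Nil
  have "below [] [] 0 = {1 :: ('b, 'k) dpoly}" by (auto simp: below_def xmono_Nil)
  then show ?case by (simp add: xmono_Nil Gam_one dpoly.span_zero dpoly.span_base)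
next
  case (Cons b bs n ns)
  show ?case
    unfolding zip_Cons_Cons xmono_Cons[symmetric] Gam_xv
  proof (intro dpoly.span_sum dpoly.span_scale)
    fix s assume s: "s \<in> {..n}"
    show "xv b (n - s) * Gam a (j - N a b - int s) (xmono (zip bs ns)) \<in> dpoly.span (below (b # bs) (n # ns) (j - (\<Sum>b\<leftarrow>b # bs. N a b)))"
    proof (rule span_image_in[OF _ _ _ Cons.IH])
      fix x :: "('b, 'k) dpoly" assume "x \<in> below bs ns (j - N a b - int s - (\<Sum>b\<leftarrow>bs. N a b))"
      then obtain q where q: "x = xmono (zip bs q)" "list_all2 (\<le>) q ns" "int (sum_list ns) - int (sum_list q) = j - N a b - int s - (\<Sum>b\<leftarrow>bs. N a b)"
        by (auto simp: below_def)
      have "xv b (n - s) * x = xmono (zip (b # bs) ((n - s) # q))" by (simp add: q xmono_Cons)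
      moreover have "(xmono (zip (b # bs) ((n - s) # q)) :: ('b, 'k) dpoly) \<in> below (b # bs) (n # ns) (j - (\<Sum>b\<leftarrow>b # bs. N a b))"
        unfolding below_def using q s by (intro CollectI exI[of _ "(n - s) # q"]) (auto simp: of_nat_diff)
      ultimately show "xv b (n - s) * x \<in> dpoly.span (below (b # bs) (n # ns) (j - (\<Sum>b\<leftarrow>b # bs. N a b)))"
        by (simp only: dpoly.span_base)
    qed (simp_all add: distrib_left scl_mult(1))
  qed
qed

lemma Gam_mono_lead:
  "length bs = length ns \<Longrightarrow> \<exists>c\<noteq>0. Gam a (\<Sum>b\<leftarrow>bs. N a b) (xmono (zip bs ns)) = scl c (xmono (zip bs ns))"
proof (induction bs ns rule: list_induct2)
  case Nil
  show ?case by (rule exI[of _ 1]) (simp add: xmono_Nil Gam_one)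
next
  case (Cons b bs n ns)
  then obtain c where c: "c \<noteq> 0" "Gam a (\<Sum>b\<leftarrow>bs. N a b) (xmono (zip bs ns)) = scl c (xmono (zip bs ns))" by blast
  let ?S = "\<Sum>b\<leftarrow>b # bs. N a b"
  have z: "Gam a (?S - N a b - int s) (xmono (zip bs ns)) = 0" if "s > 0" for s
    using Gam_mono[OF Cons.hyps, of a "?S - N a b - int s"] that by (simp add: below_neg)
  have "Gam a ?S (xmono (zip (b # bs) (n # ns))) = (\<Sum>s\<le>n. scl (gam a b s) (xv b (n - s) * Gam a (?S - N a b - int s) (xmono (zip bs ns))))"
    unfolding zip_Cons_Cons xmono_Cons[symmetric] Gam_xv ..
  also have "\<dots> = (\<Sum>s\<in>{0}. scl (gam a b s) (xv b (n - s) * Gam a (?S - N a b - int s) (xmono (zip bs ns))))"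
    by (rule sum.mono_neutral_right) (use z in auto)
  also have "\<dots> = scl (eps a b * c) (xmono (zip (b # bs) (n # ns)))"
    by (simp add: c(2) gam_def xmono_Cons scl_mult(1)[symmetric])
  finally have "Gam a ?S (xmono (zip (b # bs) (n # ns))) = scl (eps a b * c) (xmono (zip (b # bs) (n # ns)))" .
  moreover have "eps a b * c \<noteq> 0" using c(1) by (simp add: eps_def koszul_sign_def)
  ultimately show ?case by blast
qed

text \<open>The monomials occurring when the field of \<open>a\<close> is applied to a monomial with exponents \<open>ns\<close>: what
  is taken from \<open>ns\<close> is added to the exponent \<open>e\<close> of \<open>a\<close>.\<close>

definition above :: "'b \<Rightarrow> 'b list \<Rightarrow> nat list \<Rightarrow> int \<Rightarrow> nat set \<Rightarrow> ('b, 'k) dpoly set" where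
  "above a bs ns e I = {xmono (zip (a # bs) (i # q)) | i q. i \<in> I \<and> list_all2 (\<le>) q ns \<and>
     int (sum_list ns) - int (sum_list q) = int i - e}"

lemma gen_term:
  assumes len: "length bs = length ns" and i: "i \<in> I"
  shows "xv a i * Gam a (int i + m + 1) (xmono (zip bs ns))
    \<in> dpoly.span (above a bs ns (- m - 1 + (\<Sum>b\<leftarrow>bs. N a b)) I)"
proof (rule span_image_in[OF _ _ _ Gam_mono[OF len]])
  fix x :: "('b, 'k) dpoly" assume "x \<in> below bs ns (int i + m + 1 - (\<Sum>b\<leftarrow>bs. N a b))"
  then obtain q where q: "x = xmono (zip bs q)" "list_all2 (\<le>) q ns" "int (sum_list ns) - int (sum_list q) = int i + m + 1 - (\<Sum>b\<leftarrow>bs. N a b)"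
    by (auto simp: below_def)
  have "xv a i * x = xmono (zip (a # bs) (i # q))" by (simp add: q xmono_Cons)
  moreover have "xmono (zip (a # bs) (i # q)) \<in> above a bs ns (- m - 1 + (\<Sum>b\<leftarrow>bs. N a b)) I"
    unfolding above_def using q i by (intro CollectI exI[of _ i] exI[of _ q]) auto
  ultimately show "xv a i * x \<in> dpoly.span (above a bs ns (- m - 1 + (\<Sum>b\<leftarrow>bs. N a b)) I)"
    by (simp only: dpoly.span_base)
qed (simp_all add: distrib_left scl_mult(1))

lemma gen_mono:
  assumes len: "length bs = length ns" and e: "e = - m - 1 + (\<Sum>b\<leftarrow>bs. N a b)"
  shows "gen a m (xmono (zip bs ns)) \<in> dpoly.span (above a bs ns e UNIV)"
    and "e \<ge> 0 \<Longrightarrow> \<exists>c\<noteq>0. gen a m (xmono (zip bs ns)) - scl c (xmono (zip (a # bs) (nat e # ns)))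
      \<in> dpoly.span (above a bs ns e (- {nat e}))"
proof -
  let ?v = "xmono (zip bs ns)"
  obtain L where L: "\<And>j. j \<ge> L \<Longrightarrow> Gam a j ?v = 0" using Gam_bound by metis
  define I where "I = nat (max (L - m - 1) 0 + \<bar>e\<bar> + 1)"
  have g: "gen a m ?v = (\<Sum>i<I. xv a i * Gam a (int i + m + 1) ?v)"
    by (rule gen_eq_sum) (use L in \<open>auto simp: I_def\<close>)
  show "gen a m ?v \<in> dpoly.span (above a bs ns e UNIV)"
    unfolding g e by (intro dpoly.span_sum gen_term[OF len]) simp
  assume e0: "e \<ge> 0"
  have I: "nat e \<in> {..<I}" using e0 by (simp add: I_def)
  obtain c where c: "c \<noteq> 0" "Gam a (\<Sum>b\<leftarrow>bs. N a b) ?v = scl c ?v" using Gam_mono_lead[OF len] by blast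
  have "int (nat e) + m + 1 = (\<Sum>b\<leftarrow>bs. N a b)" using e0 e by simp
  then have "xv a (nat e) * Gam a (int (nat e) + m + 1) ?v = scl c (xmono (zip (a # bs) (nat e # ns)))"
    by (simp add: c(2) xmono_Cons scl_mult(1)[symmetric])
  then have "gen a m ?v - scl c (xmono (zip (a # bs) (nat e # ns))) = (\<Sum>i\<in>{..<I} - {nat e}. xv a i * Gam a (int i + m + 1) ?v)"
    unfolding g using sum.remove[OF _ I, of "\<lambda>i. xv a i * Gam a (int i + m + 1) ?v"] by simp
  also have "\<dots> \<in> dpoly.span (above a bs ns e (- {nat e}))"
    unfolding e by (intro dpoly.span_sum gen_term[OF len]) simp
  finally show "\<exists>c\<noteq>0. gen a m ?v - scl c (xmono (zip (a # bs) (nat e # ns))) \<in> dpoly.span (above a bs ns e (- {nat e}))"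
    using c(1) by blast
qed

definition word_vec :: "('b \<times> int) list \<Rightarrow> ('b, 'k) dpoly" where
  "word_vec w = foldr (\<lambda>(a, m) v. gen a m v) w 1"

definition higher :: "('b \<times> int) list \<Rightarrow> ('b, 'k) dpoly set" where
  "higher w = {xmono (zip (map fst w) q) | q. dominates q (map nat (expos N w)) \<and> q \<noteq> map nat (expos N w)}"

text \<open>The term of \<open>\<Gamma>\<^sub>a\<close> without any drop puts the exponent \<open>e\<close> of \<open>a\<close> in front of the leading monomial; all
  other terms dominate it strictly, by \<open>dominates_Cons\<close>.\<close>

lemma word_vec_lead:
  "straight N w \<Longrightarrow> \<exists>c\<noteq>0. word_vec w - scl c (xmono (lead N w)) \<in> dpoly.span (higher w)"
proof (induction w)
  case Nil
  show ?case by (rule exI[of _ 1]) (simp add: word_vec_def lead_def xmono_Nil dpoly.span_zero)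
next
  case (Cons x w)
  obtain a m where x: "x = (a, m)" by (cases x)
  let ?bs = "map fst w" and ?ns = "map nat (expos N w)"
  define e where "e = - m - 1 + (\<Sum>b\<leftarrow>?bs. N a b)"
  have "(\<Sum>b\<leftarrow>bs. N a b) = (\<Sum>b\<in>#mset bs. N a b)" for bs by (induction bs) auto
  note es = this[of ?bs]
  have ex: "expos N (x # w) = e # expos N w" by (simp only: x e_def es expos.simps)
  have st: "straight N w" and e0: "e \<ge> 0"
    using straight_Cons[OF Cons.prems[unfolded x]] by (simp_all only: e_def es)
  obtain c where c: "c \<noteq> 0" "word_vec w - scl c (xmono (lead N w)) \<in> dpoly.span (higher w)"
    using Cons.IH[OF st] by blast
  have len: "length ?bs = length ?ns" by simp
  obtain c' where c': "c' \<noteq> 0" "gen a m (xmono (lead N w)) - scl c' (xmono (zip (a # ?bs) (nat e # ?ns))) \<in> dpoly.span (above a ?bs ?ns e (- {nat e}))"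
    using gen_mono(2)[OF len e_def e0] unfolding lead_def by blast
  have lead: "lead N (x # w) = zip (a # ?bs) (nat e # ?ns)" by (simp add: lead_def ex[unfolded x] x del: expos.simps)
  have hi: "higher (x # w) = {xmono (zip (a # ?bs) q) | q. dominates q (nat e # ?ns) \<and> q \<noteq> nat e # ?ns}"
    by (simp add: higher_def ex[unfolded x] x del: expos.simps)
  have "above a ?bs ?ns e (- {nat e}) \<subseteq> higher (x # w)"
    unfolding above_def hi
  proof (rule subsetI, elim CollectE exE conjE, rule CollectI, rule exI, intro conjI)
    fix v i q assume *: "v = xmono (zip (a # ?bs) (i # q))" "i \<in> - {nat e}" "list_all2 (\<le>) q ?ns"
      "int (sum_list ?ns) - int (sum_list q) = int i - e"
    show "v = xmono (zip (a # ?bs) (i # q))" by fact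
    show "dominates (i # q) (nat e # ?ns)"
      by (rule dominates_Cons[of ?ns]) (use * e0 in \<open>simp_all add: dominates_def\<close>)
    show "i # q \<noteq> nat e # ?ns" using * by simp
  qed
  then have 1: "gen a m (xmono (lead N w)) - scl c' (xmono (lead N (x # w))) \<in> dpoly.span (higher (x # w))"
    using c'(2) dpoly.span_mono unfolding lead by blast
  have 2: "gen a m (word_vec w - scl c (xmono (lead N w))) \<in> dpoly.span (higher (x # w))"
  proof (rule span_image_in[OF gen_lin _ c(2)])
    fix v assume "v \<in> higher w"
    then obtain q' where q': "v = xmono (zip ?bs q')" "dominates q' ?ns" "q' \<noteq> ?ns" by (auto simp: higher_def)
    have len': "length ?bs = length q'" using q'(2) by (simp add: dominates_def)
    have "above a ?bs q' e UNIV \<subseteq> higher (x # w)"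
      unfolding above_def hi
    proof (rule subsetI, elim CollectE exE conjE, rule CollectI, rule exI, intro conjI)
      fix v i q assume *: "v = xmono (zip (a # ?bs) (i # q))" "list_all2 (\<le>) q q'"
        "int (sum_list q') - int (sum_list q) = int i - e"
      show "v = xmono (zip (a # ?bs) (i # q))" by fact
      show "dominates (i # q) (nat e # ?ns)"
        by (rule dominates_Cons[OF q'(2)]) (use * e0 in simp_all)
      show "i # q \<noteq> nat e # ?ns"
      proof
        assume "i # q = nat e # ?ns"
        then have "i = nat e" "q = ?ns" by simp_all
        then have "sum_list q' = sum_list q" using *(3) e0 by simp
        then show False using list_all2_le_sum[OF *(2)] \<open>q = ?ns\<close> q'(3) by simp
      qed
    qed
    then show "gen a m v \<in> dpoly.span (higher (x # w))"
      unfolding q'(1) using gen_mono(1)[OF len' e_def] dpoly.span_mono by blast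
  qed
  have gd: "gen a m (u - v) = gen a m u - gen a m v" for u v
    using sp.lin_diff[OF sp.fieldD(1)[OF field_gen]] by simp
  have "word_vec (x # w) - scl (c * c') (xmono (lead N (x # w)))
     = gen a m (word_vec w - scl c (xmono (lead N w))) + scl c (gen a m (xmono (lead N w)) - scl c' (xmono (lead N (x # w))))"
    by (simp add: gd gen_lin word_vec_def x dpoly.scale_right_diff_distrib)
  also have "\<dots> \<in> dpoly.span (higher (x # w))"
    using 1 2 by (intro dpoly.span_add dpoly.span_scale)
  finally show ?case using c(1) c'(1) by (intro exI[of _ "c * c'"]) simp
qed

definition weight :: "('b \<times> nat) multiset \<Rightarrow> int" where
  "weight K = (\<Sum>x\<in>#K. (int (snd x))\<^sup>2)"

lemma weight_zip: "length bs = length q \<Longrightarrow> weight (mset (zip bs q)) = sumsq q"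
  by (induction bs q rule: list_induct2) (simp_all add: weight_def sumsq_def)

lemma word_vec_lookup:
  assumes w: "straight N w"
  shows "Poly_Mapping.lookup (word_vec w) (mset (lead N w)) \<noteq> 0"
    and "Poly_Mapping.lookup (word_vec w) K \<noteq> 0 \<Longrightarrow> K = mset (lead N w) \<or> weight (mset (lead N w)) < weight K"
proof -
  let ?ns = "map nat (expos N w)"
  obtain c r where c: "c \<noteq> 0" and r: "r \<in> dpoly.span (higher w)" and eq: "word_vec w = scl c (xmono (lead N w)) + r"
    using word_vec_lead[OF w] by (metis add.commute diff_add_cancel)
  have sorted: "sorted_wrt (\<ge>) ?ns"
  proof -
    have "sorted_wrt (\<lambda>x y. snd y \<le> snd x) (lead N w)"
      using lead_sorted[OF w] by (rule sorted_wrt_mono_rel[rotated]) auto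
    then have "sorted_wrt (\<ge>) (map snd (lead N w))" by (simp add: sorted_wrt_map)
    then show ?thesis by (simp add: lead_def)
  qed
  have rK: "weight (mset (lead N w)) < weight K" if nz: "Poly_Mapping.lookup r K \<noteq> 0" for K
  proof -
    have "Poly_Mapping.lookup r K \<noteq> 0 \<longrightarrow> (\<exists>v\<in>higher w. Poly_Mapping.lookup v K \<noteq> 0)"
      using r
    proof (induction rule: dpoly.span_induct_alt)
      case (step c x y)
      then show ?case by (auto simp: lookup_add)
    qed simp
    then obtain q where q: "dominates q ?ns" "q \<noteq> ?ns" "Poly_Mapping.lookup (xmono (zip (map fst w) q) :: ('b, 'k) dpoly) K \<noteq> 0"
      using nz by (auto simp: higher_def)
    then have "K = mset (zip (map fst w) q)" by (simp add: xmono_def lookup_single when_def split: if_splits)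
    moreover have "length (map fst w) = length q" using q(1) by (simp add: dominates_def)
    ultimately have "weight K = sumsq q" using weight_zip by blast
    moreover have "weight (mset (lead N w)) = sumsq ?ns" unfolding lead_def by (rule weight_zip) simp
    ultimately show ?thesis using dominates_sumsq[OF q(1) sorted q(2)] by simp
  qed
  have "Poly_Mapping.lookup r (mset (lead N w)) = 0" using rK[of "mset (lead N w)"] by auto
  then show "Poly_Mapping.lookup (word_vec w) (mset (lead N w)) \<noteq> 0"
    using c by (simp add: eq lookup_add xmono_def)
  show "K = mset (lead N w) \<or> weight (mset (lead N w)) < weight K" if "Poly_Mapping.lookup (word_vec w) K \<noteq> 0"
  proof (rule ccontr)
    assume no: "\<not> ?thesis"
    then have "Poly_Mapping.lookup r K = 0" "Poly_Mapping.lookup (xmono (lead N w) :: ('b, 'k) dpoly) K = 0"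
      using rK by (auto simp: xmono_def lookup_single when_def)
    then show False using that by (simp add: eq lookup_add)
  qed
qed

text \<open>In a linear relation look at the coefficient of the leading monomial of a word of minimal weight
  among those that occur.\<close>

lemma word_vec_independent:
  assumes fin: "finite S" and S: "\<And>w. w \<in> S \<Longrightarrow> straight N w" and sum: "(\<Sum>w\<in>S. scl (u w) (word_vec w)) = 0" and w: "w \<in> S"
  shows "u w = 0"
proof (rule ccontr)
  assume "u w \<noteq> 0"
  define S' where "S' = {w \<in> S. u w \<noteq> 0}"
  have "finite S'" "S' \<noteq> {}" using fin w \<open>u w \<noteq> 0\<close> by (auto simp: S'_def)
  then obtain w0 where w0: "w0 \<in> S'" "\<And>v. v \<in> S' \<Longrightarrow> weight (mset (lead N w0)) \<le> weight (mset (lead N v))"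
    using ex_min_if_finite[of "(\<lambda>w. weight (mset (lead N w))) ` S'"] by (smt (verit, ccfv_SIG) arg_min_least arg_min_if_finite(1))
  let ?K = "mset (lead N w0)"
  have z: "u v * Poly_Mapping.lookup (word_vec v) ?K = 0" if "v \<in> S - {w0}" for v
  proof (rule ccontr)
    assume nz: "u v * Poly_Mapping.lookup (word_vec v) ?K \<noteq> 0"
    then have v: "v \<in> S'" using that by (auto simp: S'_def)
    have "?K = mset (lead N v) \<or> weight (mset (lead N v)) < weight ?K"
      using word_vec_lookup(2)[OF S, of v ?K] nz that by auto
    then have "?K = mset (lead N v)" using w0(2)[OF v] by auto
    then have "w0 = v" using lead_inj[of N w0 v] S w0(1) v by (auto simp: S'_def)
    then show False using that by simp
  qed
  have w0S: "w0 \<in> S" using w0 by (simp add: S'_def)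
  have "0 = (\<Sum>v\<in>S. u v * Poly_Mapping.lookup (word_vec v) ?K)"
    using arg_cong[OF sum, of "\<lambda>v. Poly_Mapping.lookup v ?K"] by (simp add: lookup_sum)
  also have "\<dots> = u w0 * Poly_Mapping.lookup (word_vec w0) ?K"
    using sum.remove[OF fin w0S, of "\<lambda>v. u v * Poly_Mapping.lookup (word_vec v) ?K"] z by simp
  finally show False using word_vec_lookup(1)[OF S[OF w0S]] w0 by (simp add: S'_def)
qed

end

section \<open>The target of the universal property\<close>

text \<open>A field is determined by its matrix coefficients with respect to the monomials.  Lists over
  \<open>'b \<times> int\<close> are rich enough to encode the positions of these coefficients.\<close>

lemma ex_decoding:
  "\<exists>dec :: ('b \<times> int) list \<Rightarrow> bit \<times> int \<times> ('b \<times> nat) multiset \<times> ('b \<times> nat) multiset. surj dec"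
proof -
  define f where "f = (\<lambda>(b :: 'b, i). (b, nat i))"
  define dec where "dec = (\<lambda>l :: ('b \<times> int) list. (of_int (snd (l ! 0)) :: bit, snd (l ! 1),
    mset (map f (take (nat (snd (l ! 2))) (drop 3 l))), mset (map f (drop (nat (snd (l ! 2))) (drop 3 l)))))"
  have "\<exists>l. dec l = (p, n, M, K)" for p n M K
  proof -
    obtain ms ks where M: "mset ms = M" "mset ks = K" using ex_mset by metis
    define g where "g = (\<lambda>(b :: 'b, i). (b, int i))"
    have fg: "map f (map g xs) = xs" for xs by (induction xs) (auto simp: f_def g_def)
    have "dec ((undefined, if p = 0 then 0 else 1) # (undefined, n) # (undefined, int (length ms)) # map g ms @ map g ks) = (p, n, M, K)"
      using fg[of ms] fg[of ks] M by (cases p) (simp_all add: dec_def numeral_3_eq_3 numeral_2_eq_2 del: map_map mset_map)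
    then show ?thesis by blast
  qed
  then have "\<exists>l. y = dec l" for y by (metis prod_cases4)
  then have "surj dec" by (simp add: surj_def)
  then show ?thesis by blast
qed

context locality_bound
begin

context
  fixes B :: "'b set"
  assumes sym: "\<And>a b. a \<in> B \<Longrightarrow> b \<in> B \<Longrightarrow> N a b = N b a"
begin

definition Gen :: "bit \<Rightarrow> (int \<Rightarrow> ('b, 'k) dpoly \<Rightarrow> ('b, 'k) dpoly) \<Rightarrow> bool" where
  "Gen p a \<longleftrightarrow> (\<exists>b\<in>B. p = of_int (N b b) \<and> a = gen b)"

interpretation fa: field_algebra scl Gen
proof
  show "sp.field a" if "Gen p a" for p a using that field_gen by (auto simp: Gen_def)
  show "sp.local (koszul_sign p q) a b" if ab: "Gen p a" "Gen q b" for p a q b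
  proof -
    obtain c d where cd: "c \<in> B" "d \<in> B" "p = of_int (N c c)" "q = of_int (N d d)" "a = gen c" "b = gen d"
      using ab by (auto simp: Gen_def)
    show ?thesis unfolding cd(3-6)
      by (rule sp.localI[OF field_gen field_gen, where k="N c d"]) (rule gen_R[OF sym[OF cd(1,2)]])
  qed
qed

definition gen_elt :: "'b \<Rightarrow> bit \<Rightarrow> int \<Rightarrow> ('b, 'k) dpoly \<Rightarrow> ('b, 'k) dpoly" where
  "gen_elt a = fa.pure (of_int (N a a)) (gen a)"

lemma Fld_gen_elt: "a \<in> B \<Longrightarrow> fa.Fld (of_int (N a a)) (gen a)"
  by (rule fa.Fld_gen) (auto simp: Gen_def)

lemma gen_elt_carrier: "a \<in> B \<Longrightarrow> \<forall>p. fa.Fld p (gen_elt a p)"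
  using Fld_gen_elt fa.Fld_zero by (auto simp: gen_elt_def fa.pure_def)

lemma respects_bound_gen_elt: "respects_bound B N fa.field_struct gen_elt"
  unfolding respects_bound_def
proof (intro conjI ballI allI impI)
  show "gen_elt a \<in> vpart fa.field_struct (of_int (N a a))" if "a \<in> B" for a
    using Fld_gen_elt[OF that] by (auto simp: gen_elt_def)
  fix a b n assume ab: "a \<in> B" "b \<in> B" and n: "n \<ge> N a b"
  have R: "sp.R (koszul_sign (of_int (N a a)) (of_int (N b b))) (gen a) (gen b) n 0 m v = 0" for m v
    by (rule sp.R_zero_up[OF field_gen field_gen _ gen_R n]) (simp_all add: sym ab)
  have "fa.fprd n (gen_elt a) (gen_elt b) r = (\<lambda>n v. 0)" for r
  proof (cases "r + of_int (N a a) = of_int (N b b)")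
    case True
    then show ?thesis
      unfolding gen_elt_def fa.fprd_pure_left[OF Fld_gen_elt[OF ab(1)] gen_elt_carrier[OF ab(2), unfolded gen_elt_def]] True
      by (simp add: fa.pure_def sp.prd_def R fun_eq_iff)
  next
    case False
    then have "fa.pure (of_int (N b b)) (gen b) (r + of_int (N a a)) = (\<lambda>n v. 0)" by (simp only: fa.pure_def if_False)
    then show ?thesis
      unfolding gen_elt_def fa.fprd_pure_left[OF Fld_gen_elt[OF ab(1)] gen_elt_carrier[OF ab(2), unfolded gen_elt_def]]
      by (simp only: fa.prd_zero(1)[OF field_gen])
  qed
  then show "vprod fa.field_struct n (gen_elt a) (gen_elt b) = 0" by (simp add: fun_eq_iff)
qed

text \<open>Acting on the constant polynomial \<open>1\<close>, the fields create the vectors of the words.\<close>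

lemma monomial_gen_elt:
  "fst ` set w \<subseteq> B \<Longrightarrow> \<exists>q g. monomial fa.field_struct gen_elt w = fa.pure q g \<and> fa.Fld q g \<and>
     g (-1) 1 = word_vec w \<and> (\<forall>n\<ge>0. g n 1 = 0)"
proof (induction w)
  case Nil
  show ?case
    by (intro exI[of _ 0] exI[of _ fa.idf]) (simp add: monomial_def fa.Fld_id, simp add: fa.idf_def word_vec_def)
next
  case (Cons x w)
  obtain a m where x: "x = (a, m)" by (cases x)
  have a: "a \<in> B" and w: "fst ` set w \<subseteq> B" using Cons.prems by (simp_all add: x)
  obtain q g where g: "monomial fa.field_struct gen_elt w = fa.pure q g" "fa.Fld q g" "g (-1) 1 = word_vec w" "\<forall>n\<ge>0. g n 1 = 0"
    using Cons.IH[OF w] by blast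
  note fg = fa.Fld_field[OF g(2)]
  let ?p = "of_int (N a a) :: bit"
  let ?h = "sp.prd (koszul_sign ?p q) m (gen a) g"
  have a1: "gen a n 1 = 0" if "n \<ge> 0" for n
    using gen_eq_sum[of 0 n a 1] that by (simp add: Gam_one)
  have second: "sp.E g (gen a) m n 0 1 = 0" for n
    unfolding sp.E_def by (rule sp.expand_trunc[of 0]) (use a1 fg in auto)
  have h: "?h n 1 = sp.E (gen a) g m 0 n 1" for n
    by (simp add: sp.prd_def sp.R_def second)
  have "?h n 1 = 0" if "n \<ge> 0" for n
    unfolding h sp.E_def by (rule sp.expand_trunc[of 0]) (use g(4) field_gen that in auto)
  moreover have "?h (-1) 1 = word_vec (x # w)"
  proof -
    have "sp.E (gen a) g m 0 (-1) 1 = (\<Sum>s<1. scl ((-1) ^ s * (of_int m gchoose s)) (gen a (0 + m - int s) (g (-1 + int s) 1)))"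
      unfolding sp.E_def by (rule sp.expand_eq_sum) (use g(4) field_gen in simp)
    then show ?thesis by (simp add: h g(3) word_vec_def x)
  qed
  moreover have "monomial fa.field_struct gen_elt (x # w) = fa.fprd m (gen_elt a) (monomial fa.field_struct gen_elt w)"
    by (simp add: monomial_def x)
  moreover have "fa.fprd m (gen_elt a) (fa.pure q g) = fa.pure (?p + q) ?h"
    unfolding gen_elt_def by (rule fa.fprd_pure_pure[OF Fld_gen_elt[OF a] g(2)])
  ultimately show ?case using fa.Fld_prd[OF Fld_gen_elt[OF a] g(2)] g(1) by metis
qed

text \<open>The algebra of fields, seen inside the functions on lists, and the evaluation of its elements at
  the constant polynomial \<open>1\<close>.\<close>

lemma ex_target:
  "\<exists>(A :: ('k, ('b \<times> int) list \<Rightarrow> 'k) vertex_struct) \<kappa> ev. vertex_algebra A \<and> respects_bound B N A \<kappa> \<and>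
     (\<forall>x\<in>carrier A. \<forall>y\<in>carrier A. ev (x + y) = ev x + (ev y :: ('b, 'k) dpoly)) \<and>
     (\<forall>r. \<forall>x\<in>carrier A. ev (vscale A r x) = scl r (ev x)) \<and>
     (\<forall>w. fst ` set w \<subseteq> B \<longrightarrow> ev (monomial A \<kappa> w) = word_vec w)"
proof -
  obtain dec :: "('b \<times> int) list \<Rightarrow> bit \<times> int \<times> ('b \<times> nat) multiset \<times> ('b \<times> nat) multiset" where dec: "surj dec"
    using ex_decoding by blast
  let ?F = "fa.field_struct"
  define \<phi> :: "(bit \<Rightarrow> int \<Rightarrow> ('b, 'k) dpoly \<Rightarrow> ('b, 'k) dpoly) \<Rightarrow> ('b \<times> int) list \<Rightarrow> 'k" where
    "\<phi> = (\<lambda>x l. case dec l of (p, n, M, K) \<Rightarrow> Poly_Mapping.lookup (x p n (Poly_Mapping.single M 1)) K)"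
  define sc :: "'k \<Rightarrow> (('b \<times> int) list \<Rightarrow> 'k) \<Rightarrow> ('b \<times> int) list \<Rightarrow> 'k" where "sc = (\<lambda>r f l. r * f l)"
  interpret F: vertex_algebra ?F by (rule fa.vertex_algebra_field_struct)
  have vs: "vector_space sc" by unfold_locales (simp_all add: sc_def fun_eq_iff algebra_simps)
  have add: "\<phi> (x + y) = \<phi> x + \<phi> y" for x y
    by (simp add: \<phi>_def fun_eq_iff lookup_add split: prod.split)
  have scale: "\<phi> (vscale ?F r x) = sc r (\<phi> x)" for r x
    by (simp add: \<phi>_def sc_def fun_eq_iff fa.fscale_def split: prod.split)
  have car: "x \<in> carrier ?F \<longleftrightarrow> (\<forall>p. fa.Fld p (x p))" for x by (simp add: fa.carrier_field_struct)
  have inj: "inj_on \<phi> (carrier ?F)"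
  proof (rule inj_onI)
    fix x y assume x: "x \<in> carrier ?F" and y: "y \<in> carrier ?F" and eq: "\<phi> x = \<phi> y"
    have "x p n v = y p n v" for p n v
    proof (induction v rule: dpoly_induct)
      case (1 M c)
      have "Poly_Mapping.lookup (x p n (Poly_Mapping.single M 1)) K = Poly_Mapping.lookup (y p n (Poly_Mapping.single M 1)) K" for K
      proof -
        obtain l where "dec l = (p, n, M, K)" using dec by (metis surjD)
        then show ?thesis using fun_cong[OF eq, of l] by (simp add: \<phi>_def)
      qed
      then have "x p n (Poly_Mapping.single M 1) = y p n (Poly_Mapping.single M 1)" by (rule poly_mapping_eqI)
      moreover have "Poly_Mapping.single M c = scl c (Poly_Mapping.single M 1)" by (simp add: scl_def mult_single)
      moreover have "x p n (scl c v) = scl c (x p n v)" "y p n (scl c v) = scl c (y p n v)" for v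
        using sp.linD(3)[OF sp.fieldD(1)[OF fa.fields]] x y car by blast+
      ultimately show ?case by simp
    next
      case (2 u v)
      moreover have "x p n (u + v) = x p n u + x p n v" "y p n (u + v) = y p n u + y p n v"
        using sp.linD(2)[OF sp.fieldD(1)[OF fa.fields]] x y car by blast+
      ultimately show ?case by simp
    qed
    then show "x = y" by (simp add: fun_eq_iff)
  qed
  note T = F.vertex_algebra_axioms vs add scale inj
  define A where "A = transport sc \<phi> ?F"
  define \<kappa> where "\<kappa> = (\<lambda>a. \<phi> (gen_elt a))"
  define ev where "ev = (\<lambda>y. let x = inv_into (carrier ?F) \<phi> y in x 0 (-1) (1 :: ('b, 'k) dpoly) + x 1 (-1) 1)"
  have evp: "ev (\<phi> x) = x 0 (-1) 1 + x 1 (-1) 1" if "x \<in> carrier ?F" for x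
    using that by (simp add: ev_def inv_into_f_f[OF inj])
  have cA: "carrier A = \<phi> ` carrier ?F" unfolding A_def by (rule transport_carrier[OF T])
  have "vertex_algebra A" unfolding A_def by (rule vertex_algebra_transport[OF T])
  moreover have "respects_bound B N A \<kappa>"
    unfolding respects_bound_def
  proof (intro conjI ballI allI impI)
    show "\<kappa> a \<in> vpart A (of_int (N a a))" if "a \<in> B" for a
      using respects_bound_gen_elt that unfolding respects_bound_def A_def transport_simps \<kappa>_def by blast
    fix a b n assume ab: "a \<in> B" "b \<in> B" "n \<ge> N a b"
    have "vprod A n (\<kappa> a) (\<kappa> b) = \<phi> (vprod ?F n (gen_elt a) (gen_elt b))"
      unfolding A_def \<kappa>_def by (rule transport_prod[OF T]) (use gen_elt_carrier ab car in blast)+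
    then show "vprod A n (\<kappa> a) (\<kappa> b) = 0"
      using respects_bound_gen_elt ab phi_0[OF T] unfolding respects_bound_def by simp
  qed
  moreover have "ev (x + y) = ev x + ev y" if xy: "x \<in> carrier A" "y \<in> carrier A" for x y
  proof -
    obtain x' where x': "x' \<in> carrier ?F" "x = \<phi> x'" using xy(1) unfolding cA by (rule imageE)
    obtain y' where y': "y' \<in> carrier ?F" "y = \<phi> y'" using xy(2) unfolding cA by (rule imageE)
    have "ev (x + y) = ev (\<phi> (x' + y'))" by (simp only: x'(2) y'(2) add)
    also have "\<dots> = (x' + y') 0 (-1) 1 + (x' + y') 1 (-1) 1"
      by (rule evp[OF F.subspace_add[OF F.subspace_carrier x'(1) y'(1)]])
    also have "\<dots> = ev x + ev y" unfolding x'(2) y'(2) evp[OF x'(1)] evp[OF y'(1)] by simp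
    finally show ?thesis .
  qed
  moreover have "ev (vscale A r x) = scl r (ev x)" if x: "x \<in> carrier A" for r x
  proof -
    obtain x' where x': "x' \<in> carrier ?F" "x = \<phi> x'" using x unfolding cA by (rule imageE)
    have "vscale A r x = \<phi> (vscale ?F r x')" unfolding scale by (simp add: A_def x')
    then have "ev (vscale A r x) = vscale ?F r x' 0 (-1) 1 + vscale ?F r x' 1 (-1) 1"
      using evp[OF F.subspace_scale[OF F.subspace_carrier x'(1), of r]] by simp
    also have "\<dots> = scl r (ev x)"
      unfolding x'(2) evp[OF x'(1)] by (simp add: fa.fscale_def dpoly.scale_right_distrib)
    finally show ?thesis .
  qed
  moreover have "ev (monomial A \<kappa> w) = word_vec w" if w: "fst ` set w \<subseteq> B" for w
  proof -
    have mon: "monomial A \<kappa> w = \<phi> (monomial ?F gen_elt w) \<and> monomial ?F gen_elt w \<in> carrier ?F" using w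
    proof (induction w)
      case Nil
      then show ?case using F.vac_carrier by (simp add: monomial_def A_def)
    next
      case (Cons x w)
      obtain a m where x: "x = (a, m)" by (cases x)
      have a: "gen_elt a \<in> carrier ?F" using Cons.prems gen_elt_carrier car by (simp add: x)
      have IH: "monomial A \<kappa> w = \<phi> (monomial ?F gen_elt w)" "monomial ?F gen_elt w \<in> carrier ?F" using Cons by auto
      have "monomial A \<kappa> (x # w) = vprod A m (\<phi> (gen_elt a)) (\<phi> (monomial ?F gen_elt w))"
        using IH(1) by (simp add: monomial_def x \<kappa>_def)
      also have "\<dots> = \<phi> (vprod ?F m (gen_elt a) (monomial ?F gen_elt w))"
        unfolding A_def by (rule transport_prod[OF T a IH(2)])
      also have "vprod ?F m (gen_elt a) (monomial ?F gen_elt w) = monomial ?F gen_elt (x # w)"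
        by (simp add: monomial_def x)
      finally show ?case using F.prod_carrier[OF a IH(2), of m] by (simp add: monomial_def x)
    qed
    obtain q g where g: "monomial ?F gen_elt w = fa.pure q g" "g (-1) 1 = word_vec w"
      using monomial_gen_elt[OF w] by blast
    then have "monomial ?F gen_elt w 0 (-1) 1 + monomial ?F gen_elt w 1 (-1) 1 = word_vec w"
      by (cases q) (simp_all add: fa.pure_def)
    then show ?thesis using mon evp by simp
  qed
  ultimately show ?thesis by blast
qed

end

end

section \<open>The basis theorem\<close>

theorem mainTheorem1:
  fixes B :: "'b::linorder set"
    and N :: "'b \<Rightarrow> 'b \<Rightarrow> int"
    and F :: "('k::field_char_0, 'v::ab_group_add) vertex_struct"
    and \<iota> :: "'b \<Rightarrow> 'v"
  assumes symmetric: "\<And>a b. a \<in> B \<Longrightarrow> b \<in> B \<Longrightarrow> N a b = N b a"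
    and free: "free_vertex_algebra B N F \<iota>"
  shows "inj_on (monomial F \<iota>) (basis_words B N)
    \<and> module.independent (vscale F) (monomial F \<iota> ` basis_words B N)
    \<and> module.span (vscale F) (monomial F \<iota> ` basis_words B N) = carrier F"
proof -
  interpret F: vertex_algebra F using free by (simp add: free_vertex_algebra_def)
  interpret locality_bound N "TYPE('k)" .
  let ?mon = "monomial F \<iota>" and ?W = "basis_words B N"
  \<comment> \<open>\<open>h\<close> is linear and maps the monomial of a word to the vector of the word in the polynomial ring.\<close>
  have rb: "respects_bound B N F \<iota>" and gen: "generated_by F (\<iota> ` B)"
    using free by (simp_all add: free_vertex_algebra_def)
  obtain A :: "('k, ('b \<times> int) list \<Rightarrow> 'k) vertex_struct" and \<kappa> and ev :: "_ \<Rightarrow> ('b, 'k) dpoly"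
    where A: "vertex_algebra A" "respects_bound B N A \<kappa>"
      and ev: "\<And>x y. x \<in> carrier A \<Longrightarrow> y \<in> carrier A \<Longrightarrow> ev (x + y) = ev x + ev y"
        "\<And>r x. x \<in> carrier A \<Longrightarrow> ev (vscale A r x) = scl r (ev x)"
        "\<And>w. fst ` set w \<subseteq> B \<Longrightarrow> ev (monomial A \<kappa> w) = word_vec w"
    using ex_target[of B] symmetric by blast
  obtain f where f: "vertex_hom F A f" "\<And>a. a \<in> B \<Longrightarrow> f (\<iota> a) = \<kappa> a"
    using free A unfolding free_vertex_algebra_def by blast
  have words: "fst ` set w \<subseteq> B" "straight N w" if "w \<in> ?W" for w
    using that by (simp_all add: basis_words_iff)
  have mc: "?mon w \<in> carrier F" if "fst ` set w \<subseteq> B" for w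
    using F.words_carrier[OF rb symmetric that] by blast
  define h where "h = (\<lambda>x. ev (f x))"
  have h_add: "h (x + y) = h x + h y" if "x \<in> carrier F" "y \<in> carrier F" for x y
    using f(1) that ev(1) by (simp add: h_def vertex_hom_def)
  have h_scale: "h (vscale F r x) = scl r (h x)" if "x \<in> carrier F" for r x
    using f(1) that ev(2) by (simp add: h_def vertex_hom_def)
  have f_mon: "f (?mon w) = monomial A \<kappa> w" if "fst ` set w \<subseteq> B" for w
    using that
  proof (induction w)
    case Nil
    then show ?case using f(1) by (simp add: monomial_def vertex_hom_def)
  next
    case (Cons x w)
    obtain a m where x: "x = (a, m)" by (cases x)
    have a: "a \<in> B" and w: "fst ` set w \<subseteq> B" using Cons.prems by (simp_all add: x)
    have "\<iota> a \<in> carrier F" using rb a F.part_carrier by (auto simp: respects_bound_def)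
    then have "f (vprod F m (\<iota> a) (?mon w)) = vprod A m (f (\<iota> a)) (f (?mon w))"
      using f(1) mc[OF w] by (simp add: vertex_hom_def)
    then show ?case using Cons.IH[OF w] f(2)[OF a] by (simp add: monomial_def x)
  qed
  have h_mon: "h (?mon w) = word_vec w" if "w \<in> ?W" for w
    using words[OF that] by (simp add: h_def f_mon ev(3))
  have h_sum: "h (\<Sum>w\<in>S. vscale F (u w) (?mon w)) = (\<Sum>w\<in>S. scl (u w) (word_vec w))"
    if "S \<subseteq> ?W" for S u
    using that
  proof (induction S rule: infinite_finite_induct)
    case (insert w S)
    have "(\<Sum>w\<in>S. vscale F (u w) (?mon w)) \<in> carrier F"
      using insert.prems words mc by (intro F.subspace_sum[OF F.subspace_carrier] F.subspace_scale[OF F.subspace_carrier]) auto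
    moreover have "?mon w \<in> carrier F" using insert.prems words mc by simp
    ultimately show ?case using insert by (simp add: h_add h_scale h_mon)
  qed (use h_scale[of 0 0] F.subspace_0[OF F.subspace_carrier] in simp_all)
  have indep: "u w = 0"
    if S: "finite S" "S \<subseteq> ?W" and sum: "(\<Sum>w\<in>S. vscale F (u w) (?mon w)) = 0" and w: "w \<in> S" for S u w
  proof -
    have "(\<Sum>w\<in>S. scl (u w) (word_vec w)) = 0"
      using h_sum[OF S(2), of u] sum h_scale[of 0 0] F.subspace_0[OF F.subspace_carrier] by simp
    then show ?thesis using word_vec_independent[OF S(1) _ _ w, of u] S(2) words by blast
  qed
  have inj: "inj_on ?mon ?W"
  proof (rule inj_onI, rule ccontr)
    fix w w' assume w: "w \<in> ?W" "w' \<in> ?W" "?mon w = ?mon w'" "w \<noteq> w'"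
    have "(\<Sum>v\<in>{w, w'}. vscale F (if v = w then 1 else -1) (?mon v)) = 0" using w by simp
    then have "(if w = w then 1 else -1 :: 'k) = 0"
      by (intro indep[of "{w, w'}" "\<lambda>v. if v = w then 1 else -1" w]) (use w in auto)
    then show False by simp
  qed
  have "F.independent (?mon ` ?W)"
    unfolding F.independent_explicit_module
  proof (intro allI impI)
    fix t u v assume t: "finite t" "t \<subseteq> ?mon ` ?W" "(\<Sum>v\<in>t. vscale F (u v) v) = 0" "v \<in> t"
    obtain S where S: "S \<subseteq> ?W" "t = ?mon ` S" using t(2) by (rule subset_imageE)
    have injS: "inj_on ?mon S" using inj S(1) inj_on_subset by blast
    obtain w where w: "w \<in> S" "v = ?mon w" using t(4) S by blast
    have "(\<Sum>w\<in>S. vscale F (u (?mon w)) (?mon w)) = 0" using t(3) by (simp add: S(2) sum.reindex[OF injS])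
    moreover have "finite S" using t(1) S(2) injS finite_image_iff by blast
    ultimately show "u v = 0" using indep[of S "\<lambda>w. u (?mon w)" w] S(1) w by simp
  qed
  moreover have "F.span (?mon ` ?W) = carrier F"
    using F.span_basis_words[OF rb symmetric gen] by blast
  ultimately show ?thesis using inj by blast
qed

end
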